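(* Let $L,T>0$, $\Omega=(0,L)\times(0,T)$, $\alpha>0$, $y\in L^2(\Omega)$, and let $v_c$ be a given finite bound defining $\mathcal{V}_{ad}=\{v\in L^2(0,L):\|v\|_{L^2(0,L)}\le v_c\}$. Let $k\in L^\infty(0,L)$ be positive and finite-valued, $w\in H^2(0,L)$ and $F\in L^2(\Omega)$. For $v\in\mathcal{V}_{ad}$ let $u(x,t;v)$ be the weak solution of the beam problem with data $(w,v,F)$, let $\psi(x,t;v)$ be the weak solution of the adjoint problem corresponding to $u(\cdot,\cdot;v)$, and let $J'_\alpha(v)$ be the Fréchet derivative of $$J_\alpha(v)=\int_0^T\int_0^L\big[u(x,t;v)-y(x,t)\big]^2\,dx\,dt+\alpha\int_0^L v(x)^2\,dx .$$ For $v,\,v+\delta v\in\mathcal{V}_{ad}$ put $\delta\psi(x,t;v)=\psi(x,t;v+\delta v)-\psi(x,t;v)$. (i) For all $v,\,v+\delta v\in\mathcal{V}_{ad}$, $$\|J'_\alpha(v+\delta v)-J'_\alpha(v)\|_{L^2(0,L)}^2=\int_0^L\big(-\delta\psi(x,0;v)+2\alpha\,\delta v(x)\big)^2dx .$$ (ii) There exists a Lipschitz constant $\mathcal{L}$ (independent of $v$ and $\delta v$) such that, for all $v,\,v+\delta v\in\mathcal{V}_{ad}$, $$\|J'_\alpha(v+\delta v)-J'_\alpha(v)\|_{L^2(0,L)}\le\mathcal{L}\,\|\delta v\|_{L^2(0,L)} .$$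
   Context: All functions are real-valued. $H^{2,1}(\Omega)$ is the space of all $f\in L^2(\Omega)$ with weak derivatives $f_t,f_x,f_{xx}\in L^2(\Omega)$, with norm $\|f\|_{H^{2,1}(\Omega)}=\big(\int_0^T\int_0^L[f^2+f_t^2+f_x^2+f_{xx}^2]\,dx\,dt\big)^{1/2}$. $\hat H^{2,1}(\Omega)$ is the subset of those $f\in H^{2,1}(\Omega)$ with $f(0,t)=f(L,t)=0$ for all $t\in[0,T]$, with the same norm. The beam problem with data $(w,v,F)$ is: $u_{tt}+(k(x)u_{xx})_{xx}=F(x,t)$ in $\Omega$; $u(x,0)=w(x)$, $u_t(x,0)=v(x)$ for $x\in(0,L)$; $u(0,t)=u(L,t)=u_{xx}(0,t)=u_{xx}(L,t)=0$ for $t\in(0,T)$. A weak solution is a function $u\in\hat H^{2,1}(\Omega)$ with $u(x,0)=w(x)$ for $x\in(0,L)$ such that $$\int_0^T\int_0^L(-u_t\eta_t+k(x)u_{xx}\eta_{xx})\,dx\,dt=\int_0^T\int_0^L\eta F\,dx\,dt+\int_0^L v(x)\eta(x,0)\,dx$$ for all $\eta\in\hat H^{2,1}(\Omega)$ with $\eta(x,T)=0$ for all $x\in(0,L)$. The adjoint problem corresponding to $u$ is: $\psi_{tt}+(k(x)\psi_{xx})_{xx}=-2[u(x,t)-y(x,t)]$ in $\Omega$; $\psi(x,T)=0$, $\psi_t(x,T)=0$ for $x\in(0,L)$; $\psi(0,t)=\psi(L,t)=\psi_{xx}(0,t)=\psi_{xx}(L,t)=0$ for $t\in(0,T)$. The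 substitution $t\mapsto T-t$ turns it into a beam problem with zero initial data, and its weak solution is understood accordingly: $\psi\in\hat H^{2,1}(\Omega)$, $\psi(x,T)=0$, and $\int_0^T\int_0^L(-\psi_t\eta_t+k\psi_{xx}\eta_{xx})\,dx\,dt=-2\int_0^T\int_0^L(u-y)\eta\,dx\,dt$ for all $\eta\in\hat H^{2,1}(\Omega)$ with $\eta(x,0)=0$ for all $x\in(0,L)$. The Fréchet derivative of $J_\alpha$ at $v\in\mathcal{V}_{ad}$ is identified with a function $J'_\alpha(v)\in L^2(0,L)$ satisfying $J_\alpha(v+\delta v)-J_\alpha(v)=\langle J'_\alpha(v),\delta v\rangle_{L^2(0,L)}+o(\|\delta v\|_{L^2(0,L)})$ for increments $\delta v\in L^2(0,L)$ with $v+\delta v\in\mathcal{V}_{ad}$, where $\langle f,g\rangle_{L^2(0,L)}=\int_0^L fg\,dx$. In the paper it is given by $J'_\alpha(v)=-\psi(x,0;v)+2\alpha v$. *)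

theory Defs
  imports "HOL-Analysis.Analysis"
begin

text \<open>Elements of Lebesgue and Sobolev spaces are Borel representatives; two representatives that
  agree almost everywhere stand for the same element.\<close>

definition L2 :: "'a::euclidean_space set \<Rightarrow> ('a \<Rightarrow> real) set" where
  "L2 S = {f. set_borel_measurable lborel S f \<and> set_integrable lborel S (\<lambda>p. (f p)\<^sup>2)}"

definition L2_inner :: "'a::euclidean_space set \<Rightarrow> ('a \<Rightarrow> real) \<Rightarrow> ('a \<Rightarrow> real) \<Rightarrow> real" where
  "L2_inner S f g = (LINT p:S|lborel. f p * g p)"

definition L2_norm :: "'a::euclidean_space set \<Rightarrow> ('a \<Rightarrow> real) \<Rightarrow> real" where
  "L2_norm S f = sqrt (LINT p:S|lborel. (f p)\<^sup>2)"

definition Linf :: "'a::euclidean_space set \<Rightarrow> ('a \<Rightarrow> real) set" where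
  "Linf S = {f. set_borel_measurable lborel S f \<and> (\<exists>M. AE p\<in>S in lborel. \<bar>f p\<bar> \<le> M)}"

primrec Ck :: "nat \<Rightarrow> ('a::euclidean_space \<Rightarrow> real) \<Rightarrow> bool" where
  "Ck 0 \<phi> \<longleftrightarrow> continuous_on UNIV \<phi>"
| "Ck (Suc n) \<phi> \<longleftrightarrow> (\<forall>p. \<phi> differentiable (at p)) \<and>
     (\<forall>b\<in>Basis. Ck n (\<lambda>p. frechet_derivative \<phi> (at p) b))"

definition test_fun :: "'a::euclidean_space set \<Rightarrow> ('a \<Rightarrow> real) set" where
  "test_fun S = {\<phi>. (\<forall>n. Ck n \<phi>) \<and> compact (closure {p. \<phi> p \<noteq> 0}) \<and> closure {p. \<phi> p \<noteq> 0} \<subseteq> S}"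

definition has_weak_deriv ::
  "'a::euclidean_space set \<Rightarrow> 'a \<Rightarrow> ('a \<Rightarrow> real) \<Rightarrow> ('a \<Rightarrow> real) \<Rightarrow> bool" where
  "has_weak_deriv S e f g \<longleftrightarrow>
     (\<forall>\<phi>\<in>test_fun S.
        (LINT p:S|lborel. f p * frechet_derivative \<phi> (at p) e) = - (LINT p:S|lborel. g p * \<phi> p))"

definition weakly_diff :: "'a::euclidean_space set \<Rightarrow> 'a \<Rightarrow> ('a \<Rightarrow> real) \<Rightarrow> bool" where
  "weakly_diff S e f \<longleftrightarrow> (\<exists>g\<in>L2 S. has_weak_deriv S e f g)"

text \<open>The weak derivative is unique up to null sets, and it is used below only under integrals.\<close>

definition weak_deriv :: "'a::euclidean_space set \<Rightarrow> 'a \<Rightarrow> ('a \<Rightarrow> real) \<Rightarrow> 'a \<Rightarrow> real" where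
  "weak_deriv S e f = (SOME g. g \<in> L2 S \<and> has_weak_deriv S e f g)"

definition H2 :: "real set \<Rightarrow> (real \<Rightarrow> real) set" where
  "H2 S = {f \<in> L2 S. weakly_diff S 1 f \<and> weakly_diff S 1 (weak_deriv S 1 f)}"

definition Omega :: "real \<Rightarrow> real \<Rightarrow> (real \<times> real) set" where
  "Omega L T = {0<..<L} \<times> {0<..<T}"

text \<open>Points of \<^term>\<open>Omega L T\<close> are pairs (x, t): space first, time second.\<close>

abbreviation Dx :: "real \<Rightarrow> real \<Rightarrow> (real \<times> real \<Rightarrow> real) \<Rightarrow> real \<times> real \<Rightarrow> real" where
  "Dx L T \<equiv> weak_deriv (Omega L T) (1, 0)"

abbreviation Dt :: "real \<Rightarrow> real \<Rightarrow> (real \<times> real \<Rightarrow> real) \<Rightarrow> real \<times> real \<Rightarrow> real" where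
  "Dt L T \<equiv> weak_deriv (Omega L T) (0, 1)"

abbreviation Dxx :: "real \<Rightarrow> real \<Rightarrow> (real \<times> real \<Rightarrow> real) \<Rightarrow> real \<times> real \<Rightarrow> real" where
  "Dxx L T f \<equiv> Dx L T (Dx L T f)"

definition H21 :: "real \<Rightarrow> real \<Rightarrow> (real \<times> real \<Rightarrow> real) set" where
  "H21 L T = {f \<in> L2 (Omega L T).
     weakly_diff (Omega L T) (0, 1) f \<and>
     weakly_diff (Omega L T) (1, 0) f \<and>
     weakly_diff (Omega L T) (1, 0) (Dx L T f)}"

text \<open>By the embedding of \<open>L\<^sup>2(0,T; H\<^sup>2(0,L)) \<inter> H\<^sup>1(0,T; L\<^sup>2(0,L))\<close> into \<open>C([0,T]; H\<^sup>1(0,L))\<close>, every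
  element of \<^term>\<open>H21 L T\<close> has exactly one representative that is continuous on the closed
  rectangle, and its values at single points of the boundary are those of this representative.
  The elements of \<open>hatH21\<close> are taken to be these continuous representatives.\<close>

definition hatH21 :: "real \<Rightarrow> real \<Rightarrow> (real \<times> real \<Rightarrow> real) set" where
  "hatH21 L T = {f \<in> H21 L T. continuous_on ({0..L} \<times> {0..T}) f \<and>
     (\<forall>t\<in>{0..T}. f (0, t) = 0 \<and> f (L, t) = 0)}"

definition beam_weak_solution ::
  "real \<Rightarrow> real \<Rightarrow> (real \<Rightarrow> real) \<Rightarrow> (real \<Rightarrow> real) \<Rightarrow> (real \<Rightarrow> real) \<Rightarrow> (real \<times> real \<Rightarrow> real) \<Rightarrow>
   (real \<times> real \<Rightarrow> real) \<Rightarrow> bool" where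
  "beam_weak_solution L T k w v F u \<longleftrightarrow>
     u \<in> hatH21 L T \<and>
     (AE x\<in>{0<..<L} in lborel. u (x, 0) = w x) \<and>
     (\<forall>\<eta>\<in>hatH21 L T. (\<forall>x\<in>{0<..<L}. \<eta> (x, T) = 0) \<longrightarrow>
        (LINT p:Omega L T|lborel. - Dt L T u p * Dt L T \<eta> p + k (fst p) * Dxx L T u p * Dxx L T \<eta> p)
        = (LINT p:Omega L T|lborel. \<eta> p * F p) + (LINT x:{0<..<L}|lborel. v x * \<eta> (x, 0)))"

definition adjoint_weak_solution ::
  "real \<Rightarrow> real \<Rightarrow> (real \<Rightarrow> real) \<Rightarrow> (real \<times> real \<Rightarrow> real) \<Rightarrow> (real \<times> real \<Rightarrow> real) \<Rightarrow>
   (real \<times> real \<Rightarrow> real) \<Rightarrow> bool" where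
  "adjoint_weak_solution L T k y u \<psi> \<longleftrightarrow>
     \<psi> \<in> hatH21 L T \<and>
     (\<forall>x\<in>{0<..<L}. \<psi> (x, T) = 0) \<and>
     (\<forall>\<eta>\<in>hatH21 L T. (\<forall>x\<in>{0<..<L}. \<eta> (x, 0) = 0) \<longrightarrow>
        (LINT p:Omega L T|lborel. - Dt L T \<psi> p * Dt L T \<eta> p + k (fst p) * Dxx L T \<psi> p * Dxx L T \<eta> p)
        = - 2 * (LINT p:Omega L T|lborel. (u p - y p) * \<eta> p))"

definition Vad :: "real \<Rightarrow> real \<Rightarrow> (real \<Rightarrow> real) set" where
  "Vad L vc = {v \<in> L2 {0<..<L}. L2_norm {0<..<L} v \<le> vc}"

definition J :: "real \<Rightarrow> real \<Rightarrow> real \<Rightarrow> (real \<times> real \<Rightarrow> real) \<Rightarrow>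
    ((real \<Rightarrow> real) \<Rightarrow> real \<times> real \<Rightarrow> real) \<Rightarrow> (real \<Rightarrow> real) \<Rightarrow> real" where
  "J L T \<alpha> y u v =
     (LINT p:Omega L T|lborel. (u v p - y p)\<^sup>2) + \<alpha> * (LINT x:{0<..<L}|lborel. (v x)\<^sup>2)"

definition is_L2_gradient :: "'a::euclidean_space set \<Rightarrow> ('a \<Rightarrow> real) set \<Rightarrow>
    (('a \<Rightarrow> real) \<Rightarrow> real) \<Rightarrow> ('a \<Rightarrow> real) \<Rightarrow> ('a \<Rightarrow> real) \<Rightarrow> bool" where
  "is_L2_gradient S V \<Phi> v g \<longleftrightarrow> g \<in> L2 S \<and>
     (\<forall>\<epsilon>>0. \<exists>\<delta>>0. \<forall>h\<in>L2 S. (\<lambda>x. v x + h x) \<in> V \<and> L2_norm S h < \<delta> \<longrightarrow>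
        \<bar>\<Phi> (\<lambda>x. v x + h x) - \<Phi> v - L2_inner S g h\<bar> \<le> \<epsilon> * L2_norm S h)"

definition L2_gradient :: "'a::euclidean_space set \<Rightarrow> ('a \<Rightarrow> real) set \<Rightarrow>
    (('a \<Rightarrow> real) \<Rightarrow> real) \<Rightarrow> ('a \<Rightarrow> real) \<Rightarrow> 'a \<Rightarrow> real" where
  "L2_gradient S V \<Phi> v = (SOME g. is_L2_gradient S V \<Phi> v g)"

abbreviation J' :: "real \<Rightarrow> real \<Rightarrow> real \<Rightarrow> (real \<times> real \<Rightarrow> real) \<Rightarrow>
    ((real \<Rightarrow> real) \<Rightarrow> real \<times> real \<Rightarrow> real) \<Rightarrow> real \<Rightarrow> (real \<Rightarrow> real) \<Rightarrow> real \<Rightarrow> real" where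
  "J' L T \<alpha> y u vc \<equiv> L2_gradient {0<..<L} (Vad L vc) (J L T \<alpha> y u)"

end

theory Submission
  imports Defs
begin

text \<open>For two admissible velocities the difference of the states solves the beam problem with \<open>w = 0\<close>
  and \<open>F = 0\<close>. Testing it with \<open>\<eta>(x,t) = - \<integral>\<^sub>t\<^sup>T \<rho>(s) u(x,s) ds\<close>, where \<open>\<rho>(s) = T + 1 - s\<close>, gives an energy
  identity: \<open>- u\<^sub>t \<eta>\<^sub>t\<close> contributes half of \<open>- \<parallel>u(T)\<parallel>\<^sup>2 - \<parallel>u\<parallel>\<^sup>2\<close>, and the elastic term is nonpositive because
  \<open>\<rho>\<close> is positive and decreasing. Hence \<open>u\<close> is bounded by the data, and no positive lower bound on \<open>k\<close>
  is required. The reflection \<open>t \<mapsto> T - t\<close> carries the estimate over to the adjoint problem, including the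
  trace \<open>\<psi>(x,0)\<close>. Testing the two weak formulations with each other's solutions identifies
  \<open>-\<psi>(x,0) + 2\<alpha>v\<close> as a gradient of the cost. If \<open>vc > 0\<close> then a gradient is unique up to null sets,
  since the ball of admissible velocities spans \<open>L\<^sup>2\<close>.\<close>

section \<open>Smooth functions and test functions\<close>

text \<open>The multiplier \<open>u_t\<close> of the classical energy method need not lie in
  \<open>hatH21\<close>. A primitive of \<open>u\<close> in time keeps the spatial regularity and
  the boundary values of \<open>u\<close>, and integrating backwards from \<open>T\<close> makes it
  vanish at the final time, as the weak formulation demands of its test functions. The right-hand
  side is controlled by the norm of \<open>u\<close> over \<open>Omega\<close>, so this norm has to
  appear on the left as well: the slope -1 of \<rho> produces it, and \<rho>(T) = 1 keeps the trace
  at \<open>T\<close>. A constant weight would give the trace alone. To use the multiplier,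
  \<open>u\<close> must be a genuine primitive of its weak time derivative for almost every x, and
  integration in time must commute with weak derivatives in x; these two facts take up much of the
  preparation. As \<open>k\<close> depends on x alone, it leaves the integral over time, and the
  sign of the elastic term is decided for each x separately. \<open>J'\<close> is a choice among all
  gradients, so a formula for one gradient says something about \<open>J'\<close> only after the
  other candidates have been dealt with.\<close>

lemma Ck_SucI:
  assumes "\<And>p. (f has_derivative D p) (at p)" and "\<And>b. b \<in> Basis \<Longrightarrow> Ck n (\<lambda>p. D p b)"
  shows "Ck (Suc n) f"
proof -
  have "frechet_derivative f (at p) = D p" for p
    using assms(1) frechet_derivative_at by metis
  thus ?thesis using assms by (auto simp: differentiable_def)
qed

lemma Ck_deriv: "Ck (Suc n) f \<Longrightarrow> (f has_derivative frechet_derivative f (at p)) (at p)"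
  by (simp add: frechet_derivative_works)

lemma Ck_continuous: "Ck n f \<Longrightarrow> continuous_on UNIV f"
  by (cases n) (auto intro!: differentiable_imp_continuous_on simp: differentiable_on_def
      intro: differentiable_at_withinI)

text \<open>The product rule pairs a function of class \<open>Suc n\<close> with a derivative of
  class \<open>n\<close>; lowering the former brings both factors to the same order.\<close>

lemma Ck_down: "Ck (Suc n) f \<Longrightarrow> Ck n f"
proof (induction n arbitrary: f)
  case 0
  thus ?case using Ck_continuous by fastforce
next
  case (Suc n)
  show ?case using Suc.prems Suc.IH by (metis Ck.simps(2))
qed

lemma Ck_const: "Ck n (\<lambda>p. c)"
proof (induction n arbitrary: c)
  case (Suc n)
  show ?case by (rule Ck_SucI[where D = "\<lambda>p h. 0"]) (auto simp: Suc)
qed auto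

lemma Ck_add: "Ck n f \<Longrightarrow> Ck n g \<Longrightarrow> Ck n (\<lambda>p. f p + g p)"
proof (induction n arbitrary: f g)
  case 0 thus ?case by (auto intro: continuous_intros)
next
  case (Suc n)
  show ?case
    by (rule Ck_SucI[OF has_derivative_add[OF Ck_deriv[OF Suc.prems(1)] Ck_deriv[OF Suc.prems(2)]]])
      (use Suc in auto)
qed

lemma Ck_mult: "Ck n f \<Longrightarrow> Ck n g \<Longrightarrow> Ck n (\<lambda>p. f p * g p)"
proof (induction n arbitrary: f g)
  case 0 thus ?case by (auto intro: continuous_intros)
next
  case (Suc n)
  show ?case
  proof (rule Ck_SucI[OF has_derivative_mult[OF Ck_deriv[OF Suc.prems(1)] Ck_deriv[OF Suc.prems(2)]]])
    fix b :: 'a assume b: "b \<in> Basis"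
    have 1: "Ck n (\<lambda>p. frechet_derivative f (at p) b)" using Suc.prems(1) b by simp
    have 2: "Ck n (\<lambda>p. frechet_derivative g (at p) b)" using Suc.prems(2) b by simp
    show "Ck n (\<lambda>p. f p * frechet_derivative g (at p) b + frechet_derivative f (at p) b * g p)"
      by (rule Ck_add[OF Suc.IH[OF Ck_down[OF Suc.prems(1)] 2] Suc.IH[OF 1 Ck_down[OF Suc.prems(2)]]])
  qed
qed

lemma Ck_sum: "finite I \<Longrightarrow> (\<And>i. i \<in> I \<Longrightarrow> Ck n (f i)) \<Longrightarrow> Ck n (\<lambda>p. \<Sum>i\<in>I. f i p)"
  by (induction I rule: finite_induct) (auto intro!: Ck_const Ck_add)

text \<open>Slices, projections, scalings and the time reflection are all affine, so this one chain
  rule serves them all.\<close>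

lemma Ck_affine:
  fixes A :: "'a::euclidean_space \<Rightarrow> 'b::euclidean_space"
  assumes "linear A"
  shows "Ck n f \<Longrightarrow> Ck n (\<lambda>p. f (A p + c))"
proof (induction n arbitrary: f)
  case 0 thus ?case
    using linear_continuous_on[of A UNIV] assms linear_conv_bounded_linear
    by (auto intro!: continuous_intros continuous_on_compose2[of UNIV f])
next
  case (Suc n)
  have A: "((\<lambda>p. A p + c) has_derivative A) (at p)" for p
    using bounded_linear_imp_has_derivative[of A "at p"] assms
    by (auto simp: linear_conv_bounded_linear intro!: has_derivative_add_const)
  show ?case
  proof (rule Ck_SucI)
    show "((\<lambda>p. f (A p + c)) has_derivative
        (\<lambda>h. frechet_derivative f (at (A p + c)) (A h))) (at p)" for p
      by (rule has_derivative_compose[OF A Ck_deriv[OF Suc.prems]])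
    fix b :: 'a
    \<comment> \<open>\<open>Ck\<close> speaks of basis directions only, so the direction
      \<open>A b\<close> is expanded in the basis; the induction hypothesis then applies to each
      term.\<close>
    have "frechet_derivative f (at q) (A b) =
        (\<Sum>e\<in>Basis. (A b \<bullet> e) * frechet_derivative f (at q) e)" for q
    proof -
      interpret linear "frechet_derivative f (at q)"
        using Ck_deriv[OF Suc.prems] has_derivative_linear by blast
      have "frechet_derivative f (at q) (\<Sum>e\<in>Basis. (A b \<bullet> e) *\<^sub>R e) =
          (\<Sum>e\<in>Basis. (A b \<bullet> e) * frechet_derivative f (at q) e)"
        by (simp add: sum scale)
      thus ?thesis by (simp add: euclidean_representation)
    qed
    thus "Ck n (\<lambda>p. frechet_derivative f (at (A p + c)) (A b))"
      using Suc by (auto intro!: Ck_sum Ck_mult Ck_const)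
  qed
qed

lemma Ck_real_SucI:
  fixes f :: "real \<Rightarrow> real"
  assumes "\<And>x. (f has_real_derivative f' x) (at x)" "Ck n f'"
  shows "Ck (Suc n) f"
  by (rule Ck_SucI[where D="\<lambda>p h. f' p * h"])
     (use assms in \<open>auto simp: has_field_derivative_def\<close>)

text \<open>The power of x in the denominator makes the family closed under differentiation up to
  linear combinations, so one induction yields the smoothness of all members at once.\<close>

definition flat :: "nat \<Rightarrow> real \<Rightarrow> real" where
  "flat m x = (if x > 0 then exp (- (1 / x)) / x ^ m else 0)"

text \<open>With y = 1/x the expression becomes y^m / exp y, and the exponential wins at
  infinity.\<close>

lemma flat_limit: "((\<lambda>x. exp (- (1 / x)) / x ^ m) \<longlongrightarrow> 0) (at_right (0::real))"
proof -
  have "((\<lambda>y. y ^ m / exp y) \<longlongrightarrow> 0) (at_top :: real filter)"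
    by (rule tendsto_power_div_exp_0)
  hence "((\<lambda>x::real. inverse x ^ m / exp (inverse x)) \<longlongrightarrow> 0) (at_right 0)"
    by (rule filterlim_compose[OF _ filterlim_inverse_at_top_right])
  thus ?thesis
    by (simp add: exp_minus field_simps inverse_eq_divide)
qed

lemma flat_deriv: "(flat m has_real_derivative flat (m + 2) x - m * flat (m + 1) x) (at x)"
proof -
  consider "x > 0" | "x < 0" | "x = 0" by linarith
  thus ?thesis
  proof cases
    case 1
    have "((\<lambda>x. exp (- (1 / x)) / x ^ m) has_real_derivative flat (m + 2) x - m * flat (m + 1) x) (at x)"
      using 1 apply (auto intro!: derivative_eq_intros simp: flat_def)
      \<comment> \<open>The power rule produces the exponent \<open>m - 1\<close>, so
        \<open>m = 0\<close> is treated apart.\<close>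
      apply (cases m)
       apply (auto simp: field_simps power2_eq_square)
      done
    moreover have "\<forall>\<^sub>F y in nhds x. flat m y = exp (- (1 / y)) / y ^ m"
      using 1 by (auto simp: flat_def eventually_nhds intro!: exI[of _ "{0<..}"])
    ultimately show ?thesis by (simp add: DERIV_cong_ev)
  next
    case 2
    have "\<forall>\<^sub>F y in nhds x. flat m y = 0"
      using 2 by (auto simp: flat_def eventually_nhds intro!: exI[of _ "{..<0}"])
    thus ?thesis using 2 by (simp add: DERIV_cong_ev flat_def)
  next
    case 3
    have "((\<lambda>y. flat m y / y) \<longlongrightarrow> 0) (at 0)"
      proof (rule filterlim_split_at)
      \<comment> \<open>From the right, the difference quotient at 0 is the same expression with
        \<open>m + 1\<close>.\<close>
      have "((\<lambda>x. exp (- (1 / x)) / x ^ (m + 1)) \<longlongrightarrow> 0) (at_right (0::real))"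
        by (rule flat_limit)
      thus "((\<lambda>y. flat m y / y) \<longlongrightarrow> 0) (at_right 0)"
        by (rule Lim_transform_eventually)
           (auto simp: flat_def eventually_at_right_less eventually_at_filter)
      show "((\<lambda>y. flat m y / y) \<longlongrightarrow> 0) (at_left 0)"
        by (rule tendsto_eventually) (auto simp: flat_def eventually_at_filter)
    qed
    thus ?thesis using 3 by (simp add: has_field_derivative_iff flat_def)
  qed
qed

lemma Ck_flat: "Ck n (flat m)"
proof (induction n arbitrary: m)
  case 0
  show ?case
    using DERIV_isCont[OF flat_deriv] by (simp add: continuous_on_eq_continuous_at)
next
  case (Suc n)
  have "Ck n (\<lambda>x. flat (m + 2) x + (- real m) * flat (m + 1) x)"
    by (intro Ck_add Ck_mult Ck_const Suc)
  thus ?case using Ck_real_SucI[OF flat_deriv] by simp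
qed

lemma test_funI:
  assumes "\<And>n. Ck n \<phi>" "compact K" "K \<subseteq> S" "\<And>p. p \<notin> K \<Longrightarrow> \<phi> p = 0"
  shows "\<phi> \<in> test_fun S"
proof -
  have "closure {p. \<phi> p \<noteq> 0} \<subseteq> K"
    by (rule closure_minimal) (use assms in \<open>auto intro: compact_imp_closed\<close>)
  moreover from this have "compact (closure {p. \<phi> p \<noteq> 0})"
    using bounded_subset[OF compact_imp_bounded[OF assms(2)]] by (simp add: compact_eq_bounded_closed)
  ultimately show ?thesis using assms by (auto simp: test_fun_def)
qed

lemma test_fun_support:
  "\<phi> \<in> test_fun S \<Longrightarrow> \<exists>K. compact K \<and> K \<subseteq> S \<and> (\<forall>p. p \<notin> K \<longrightarrow> \<phi> p = 0)"
  using closure_subset[of "{p. \<phi> p \<noteq> 0}"]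
  by (intro exI[of _ "closure {p. \<phi> p \<noteq> 0}"]) (auto simp: test_fun_def)

lemma test_fun_Ck: "\<phi> \<in> test_fun S \<Longrightarrow> Ck n \<phi>"
  by (simp add: test_fun_def)

lemma test_fun_outside: "\<phi> \<in> test_fun S \<Longrightarrow> p \<notin> S \<Longrightarrow> \<phi> p = 0"
  using test_fun_support[of \<phi> S] by blast

lemma test_fun_has_derivative:
  "\<phi> \<in> test_fun S \<Longrightarrow> (\<phi> has_derivative frechet_derivative \<phi> (at p)) (at p)"
  using Ck_deriv[OF test_fun_Ck[of _ _ "Suc 0"]] by blast

lemma Ck_frechet_derivative:
  assumes "Ck (Suc n) f" shows "Ck n (\<lambda>p. frechet_derivative f (at p) e)"
proof -
  have "frechet_derivative f (at p) e = (\<Sum>b\<in>Basis. (e \<bullet> b) * frechet_derivative f (at p) b)" for p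
  proof -
    interpret linear "frechet_derivative f (at p)"
      using Ck_deriv[OF assms] has_derivative_linear by blast
    have "frechet_derivative f (at p) (\<Sum>b\<in>Basis. (e \<bullet> b) *\<^sub>R b) =
        (\<Sum>b\<in>Basis. (e \<bullet> b) * frechet_derivative f (at p) b)"
      by (simp add: sum scale)
    thus ?thesis by (simp add: euclidean_representation)
  qed
  thus ?thesis using assms by (auto intro!: Ck_sum Ck_mult Ck_const)
qed

lemma test_fun_frechet_derivative:
  assumes "\<phi> \<in> test_fun S"
  shows "(\<lambda>p. frechet_derivative \<phi> (at p) e) \<in> test_fun S"
proof -
  obtain K where K: "compact K" "K \<subseteq> S" "\<And>p. p \<notin> K \<Longrightarrow> \<phi> p = 0"
    using test_fun_support[OF assms] by auto
  note K = K test_fun_Ck[OF assms]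
  show ?thesis
  proof (rule test_funI[OF _ K(1,2)])
    show "Ck n (\<lambda>p. frechet_derivative \<phi> (at p) e)" for n
      by (rule Ck_frechet_derivative[OF K(4)])
    fix p assume "p \<notin> K"
    have "(\<phi> has_derivative (\<lambda>h. 0)) (at p)"
    proof (rule has_derivative_transform_within_open)
      show "((\<lambda>_. 0) has_derivative (\<lambda>h. 0)) (at p)" by simp
      show "open (- K)" using compact_imp_closed[OF K(1)] by (rule open_Compl)
      show "p \<in> - K" using \<open>p \<notin> K\<close> by simp
      show "0 = \<phi> q" if "q \<in> - K" for q using K(3)[of q] that by simp
    qed
    from frechet_derivative_at[OF this, symmetric] show "frechet_derivative \<phi> (at p) e = 0" by simp
  qed
qed

lemma test_fun_bounded:
  fixes \<phi> :: "'a::euclidean_space \<Rightarrow> real"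
  assumes "\<phi> \<in> test_fun S" obtains B where "\<And>p. \<bar>\<phi> p\<bar> \<le> B" "B \<ge> 0"
proof -
  obtain K where K: "compact K" "K \<subseteq> S" "\<And>p. p \<notin> K \<Longrightarrow> \<phi> p = 0"
    using test_fun_support[OF assms] by auto
  note K = K test_fun_Ck[OF assms]
  have "compact (\<phi> ` K)"
    using K(4)[of 0] continuous_on_subset[of UNIV \<phi> K] by (intro compact_continuous_image K(1)) simp
  then obtain B where "\<forall>p\<in>K. \<bar>\<phi> p\<bar> \<le> B"
    using compact_imp_bounded[of "\<phi> ` K"] by (auto simp: bounded_iff)
  hence "\<bar>\<phi> p\<bar> \<le> max B 0" for p using K(3)[of p] by (cases "p \<in> K") (auto intro: max.coboundedI1)
  thus ?thesis by (intro that[of "max B 0"]) auto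
qed

lemma test_fun_borel: "\<phi> \<in> test_fun S \<Longrightarrow> \<phi> \<in> borel_measurable borel"
  using test_fun_Ck[of \<phi> S 0] by (auto intro: borel_measurable_continuous_onI)

lemma test_fun_integrable:
  assumes "\<phi> \<in> test_fun S" shows "integrable lborel \<phi>"
proof -
  obtain K where K: "compact K" "K \<subseteq> S" "\<And>p. p \<notin> K \<Longrightarrow> \<phi> p = 0"
    using test_fun_support[OF assms] by auto
  note K = K test_fun_Ck[OF assms]
  have "integrable lborel (\<lambda>p. indicator K p *\<^sub>R \<phi> p)"
    using K(4)[of 0] continuous_on_subset[of UNIV \<phi> K] by (intro borel_integrable_compact K(1)) simp
  moreover have "(\<lambda>p. indicator K p *\<^sub>R \<phi> p) = \<phi>"
    using K(3) by (auto simp: indicator_def fun_eq_iff)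
  ultimately show ?thesis by simp
qed

text \<open>Each factor vanishes within distance 1/(n+1) of its end point, which keeps the support
  compact inside the open interval. For growing n and fixed x inside, both arguments tend to
  infinity, where \<open>flat 0\<close> tends to 1. The result is a pointwise approximation of the
  indicator, bounded by 1 and thus ready for dominated convergence; if the interval is empty, it is
  identically 0.\<close>

definition bump :: "real \<Rightarrow> real \<Rightarrow> nat \<Rightarrow> real \<Rightarrow> real" where
  "bump a b n x = flat 0 (real (Suc n) * (x - a) - 1) * flat 0 (real (Suc n) * (b - x) - 1)"

lemma flat_bounds: "0 \<le> flat 0 x" "flat 0 x \<le> 1"
  by (auto simp: flat_def)

lemma bump_bounds: "0 \<le> bump a b n x" "bump a b n x \<le> 1"
  by (auto simp: bump_def flat_bounds mult_le_one)

lemma flat_at_top: "(flat 0 \<longlongrightarrow> 1) at_top"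
proof -
  have "((\<lambda>x::real. exp (- (1 / x))) \<longlongrightarrow> exp (- 0)) at_top"
    by (intro tendsto_intros tendsto_divide_0[OF tendsto_const] filterlim_at_top_imp_at_infinity filterlim_ident)
  thus ?thesis
    unfolding exp_zero minus_zero
    by (rule Lim_transform_eventually)
       (auto simp: flat_def intro: eventually_mono[OF eventually_gt_at_top[of 0]])
qed

lemma flat_scaled_tendsto: "c > 0 \<Longrightarrow> (\<lambda>n. flat 0 (real (Suc n) * c - 1)) \<longlonglongrightarrow> 1"
proof (rule filterlim_compose[OF flat_at_top])
  assume c: "c > 0"
  show "filterlim (\<lambda>n. real (Suc n) * c - 1) at_top sequentially"
    unfolding filterlim_at_top
  proof
    fix Z :: real
    obtain N where N: "real N * c > Z + 1" using reals_Archimedean3[OF c] by blast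
    show "\<forall>\<^sub>F n in sequentially. Z \<le> real (Suc n) * c - 1"
      using eventually_ge_at_top[of N]
    proof eventually_elim
      case (elim n)
      have "real N * c \<le> real (Suc n) * c" using elim c by (intro mult_right_mono) auto
      thus ?case using N by linarith
    qed
  qed
qed

lemma bump_tendsto: "(\<lambda>n. bump a b n x) \<longlonglongrightarrow> indicator {a<..<b} x"
proof (cases "x \<in> {a<..<b}")
  case True
  have "(\<lambda>n. bump a b n x) \<longlonglongrightarrow> 1 * 1"
    unfolding bump_def by (intro tendsto_mult flat_scaled_tendsto) (use True in auto)
  thus ?thesis using True by simp
next
  case False
  have "bump a b n x = 0" for n
  proof -
    have "real (Suc n) * (x - a) \<le> 0 \<or> real (Suc n) * (b - x) \<le> 0"
      using False by (auto simp: mult_le_0_iff)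
    thus ?thesis by (auto simp: bump_def flat_def)
  qed
  thus ?thesis using False by simp
qed

lemma bump_test_fun: "bump a b n \<in> test_fun {a<..<b}"
proof (rule test_funI)
  show "Ck m (bump a b n)" for m
  proof -
    have "Ck m (\<lambda>x. flat 0 ((*) (real (Suc n)) x + (- real (Suc n) * a - 1)))"
         "Ck m (\<lambda>x. flat 0 ((*) (- real (Suc n)) x + (real (Suc n) * b - 1)))"
      by (rule Ck_affine[OF _ Ck_flat], simp add: linear_times)+
    hence "Ck m (\<lambda>x. flat 0 ((*) (real (Suc n)) x + (- real (Suc n) * a - 1)) * flat 0 ((*) (- real (Suc n)) x + (real (Suc n) * b - 1)))"
      by (rule Ck_mult)
    moreover have "bump a b n = (\<lambda>x. flat 0 ((*) (real (Suc n)) x + (- real (Suc n) * a - 1)) * flat 0 ((*) (- real (Suc n)) x + (real (Suc n) * b - 1)))"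
      by (auto simp: bump_def fun_eq_iff algebra_simps)
    ultimately show ?thesis by metis
  qed
  show "{a + 1 / Suc n..b - 1 / Suc n} \<subseteq> {a<..<b}"
  proof
    fix x assume "x \<in> {a + 1 / Suc n..b - 1 / Suc n}"
    moreover have "1 / real (Suc n) > 0" by simp
    ultimately show "x \<in> {a<..<b}" unfolding atLeastAtMost_iff greaterThanLessThan_iff by linarith
  qed
  fix x assume "x \<notin> {a + 1 / real (Suc n)..b - 1 / real (Suc n)}"
  hence "real (Suc n) * (x - a) - 1 \<le> 0 \<or> real (Suc n) * (b - x) - 1 \<le> 0"
    by (auto simp: field_simps)
  thus "bump a b n x = 0" by (auto simp: bump_def flat_def)
qed auto

lemma bump_test_fun_superset: "{a<..<b} \<subseteq> S \<Longrightarrow> bump a b n \<in> test_fun S"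
  using bump_test_fun[of a b n] by (auto simp: test_fun_def)

lemma frechet_derivative_real:
  "(f has_real_derivative D) (at x) \<Longrightarrow> frechet_derivative f (at x) h = D * h"
  using frechet_derivative_at[of f "(*) D" x] by (auto simp: has_field_derivative_def)

lemma test_fun_real_derivative:
  fixes \<phi> :: "real \<Rightarrow> real"
  shows "\<phi> \<in> test_fun S \<Longrightarrow> (\<phi> has_real_derivative frechet_derivative \<phi> (at x) 1) (at x)"
  using frechet_derivative_real DERIV_deriv_iff_has_field_derivative test_fun_has_derivative
  by (metis differentiableI mult.right_neutral real_differentiable_def)

section \<open>Test functions on rectangles: products and slices\<close>

lemma test_fun_product:
  fixes a b :: "real \<Rightarrow> real"
  assumes a: "a \<in> test_fun A" and b: "b \<in> test_fun B"
  shows "(\<lambda>p. a (fst p) * b (snd p)) \<in> test_fun (A \<times> B)"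
    and "frechet_derivative (\<lambda>p. a (fst p) * b (snd p)) (at p) (1, 0)
      = frechet_derivative a (at (fst p)) 1 * b (snd p)"
    and "frechet_derivative (\<lambda>p. a (fst p) * b (snd p)) (at p) (0, 1)
      = a (fst p) * frechet_derivative b (at (snd p)) 1"
proof -
  obtain K where K: "compact K" "K \<subseteq> A" "\<And>p. p \<notin> K \<Longrightarrow> a p = 0"
    using test_fun_support[OF a] by auto
  note K = K test_fun_Ck[OF a]
  obtain M where M: "compact M" "M \<subseteq> B" "\<And>p. p \<notin> M \<Longrightarrow> b p = 0"
    using test_fun_support[OF b] by auto
  note M = M test_fun_Ck[OF b]
  show "(\<lambda>p. a (fst p) * b (snd p)) \<in> test_fun (A \<times> B)"
  proof (rule test_funI)
    show "Ck n (\<lambda>p. a (fst p) * b (snd p))" for n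
      using Ck_affine[OF linear_fst K(4), where c=0] Ck_affine[OF linear_snd M(4), where c=0]
      by (intro Ck_mult) simp_all
    show "compact (K \<times> M)" using K M by (intro compact_Times)
  qed (use K M in \<open>auto simp: mem_Times_iff\<close>)
  have D: "((\<lambda>p. a (fst p) * b (snd p)) has_derivative
      (\<lambda>h. a (fst p) * frechet_derivative b (at (snd p)) (snd h)
         + frechet_derivative a (at (fst p)) (fst h) * b (snd p))) (at p)"
    by (intro has_derivative_mult has_derivative_compose[OF _ test_fun_has_derivative[OF a]]
        has_derivative_compose[OF _ test_fun_has_derivative[OF b]] has_derivative_fst has_derivative_snd
        has_derivative_ident)
  have z: "frechet_derivative b (at t) 0 = 0" "frechet_derivative a (at t) 0 = 0" for t
    using linear_0[OF has_derivative_linear[OF test_fun_has_derivative[OF b]]]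
      linear_0[OF has_derivative_linear[OF test_fun_has_derivative[OF a]]] by auto
  show "frechet_derivative (\<lambda>p. a (fst p) * b (snd p)) (at p) (1, 0)
      = frechet_derivative a (at (fst p)) 1 * b (snd p)"
    and "frechet_derivative (\<lambda>p. a (fst p) * b (snd p)) (at p) (0, 1)
      = a (fst p) * frechet_derivative b (at (snd p)) 1"
    unfolding frechet_derivative_at[OF D, symmetric] by (simp_all add: z)
qed

lemma test_fun_slice:
  fixes \<phi> :: "real \<times> real \<Rightarrow> real"
  assumes \<phi>: "\<phi> \<in> test_fun (A \<times> B)"
  shows "(\<lambda>x. \<phi> (x, t)) \<in> test_fun A" "(\<lambda>t. \<phi> (x, t)) \<in> test_fun B"
    and "frechet_derivative (\<lambda>x. \<phi> (x, t)) (at x) 1 = frechet_derivative \<phi> (at (x, t)) (1, 0)"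
    and "frechet_derivative (\<lambda>t. \<phi> (x, t)) (at t) 1 = frechet_derivative \<phi> (at (x, t)) (0, 1)"
proof -
  obtain K where K: "compact K" "K \<subseteq> A \<times> B" "\<And>p. p \<notin> K \<Longrightarrow> \<phi> p = 0"
    using test_fun_support[OF \<phi>] by auto
  note K = K test_fun_Ck[OF \<phi>]
  have l1: "linear (\<lambda>x::real. (x, 0::real))" "linear (\<lambda>x::real. (0::real, x))"
    by (auto intro!: linearI)
  show "(\<lambda>x. \<phi> (x, t)) \<in> test_fun A"
  proof (rule test_funI)
    show "Ck n (\<lambda>x. \<phi> (x, t))" for n
      using Ck_affine[OF l1(1) K(4), where c="(0, t)"] by simp
    show "compact (fst ` K)" using K(1) by (auto intro!: compact_continuous_image continuous_intros)
    show "fst ` K \<subseteq> A" using K(2) by auto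
    show "x \<notin> fst ` K \<Longrightarrow> \<phi> (x, t) = 0" for x using K(3)[of "(x,t)"] by force
  qed
  show "(\<lambda>t. \<phi> (x, t)) \<in> test_fun B"
  proof (rule test_funI)
    show "Ck n (\<lambda>t. \<phi> (x, t))" for n
      using Ck_affine[OF l1(2) K(4), where c="(x, 0)"] by simp
    show "compact (snd ` K)" using K(1) by (auto intro!: compact_continuous_image continuous_intros)
    show "snd ` K \<subseteq> B" using K(2) by auto
    show "t \<notin> snd ` K \<Longrightarrow> \<phi> (x, t) = 0" for t using K(3)[of "(x,t)"] by force
  qed
  have "((\<lambda>x. \<phi> (x, t)) has_derivative (\<lambda>h. frechet_derivative \<phi> (at (x,t)) (h, 0))) (at x)"
    by (rule has_derivative_compose[of "\<lambda>x. (x,t)" _ _ _ \<phi>, OF _ test_fun_has_derivative[OF \<phi>]])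
       (auto intro!: derivative_eq_intros)
  from frechet_derivative_at[OF this, symmetric]
  show "frechet_derivative (\<lambda>x. \<phi> (x, t)) (at x) 1 = frechet_derivative \<phi> (at (x, t)) (1, 0)" by simp
  have "((\<lambda>t. \<phi> (x, t)) has_derivative (\<lambda>h. frechet_derivative \<phi> (at (x,t)) (0, h))) (at t)"
    by (rule has_derivative_compose[of "\<lambda>t. (x,t)" _ _ _ \<phi>, OF _ test_fun_has_derivative[OF \<phi>]])
       (auto intro!: derivative_eq_intros)
  from frechet_derivative_at[OF this, symmetric]
  show "frechet_derivative (\<lambda>t. \<phi> (x, t)) (at t) 1 = frechet_derivative \<phi> (at (x, t)) (0, 1)" by simp
qed

text \<open>An antiderivative may be nonzero in the gaps of the support of its derivative, so the
  support is first enclosed in an interval with margins on both sides.\<close>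

lemma compact_subset_open_interval:
  fixes K :: "real set"
  assumes "compact K" "K \<subseteq> {a<..<b}" "a < b"
  obtains c d where "a < c" "c < d" "d < b" "K \<subseteq> {c<..<d}"
proof (cases "K = {}")
  case True
  have "a < a + (b - a) / 3" "a + (b - a) / 3 < b - (b - a) / 3" "b - (b - a) / 3 < b"
    using assms(3) by (auto simp: field_simps)
  thus ?thesis using that True by blast
next
  case False
  obtain l where l: "l \<in> K" "\<And>x. x \<in> K \<Longrightarrow> l \<le> x" using compact_attains_inf[OF assms(1) False] by blast
  obtain h where h: "h \<in> K" "\<And>x. x \<in> K \<Longrightarrow> x \<le> h" using compact_attains_sup[OF assms(1) False] by blast
  have "a < l" "h < b" using l h assms by auto
  obtain c where "a < c" "c < l" using dense[OF \<open>a < l\<close>] by blast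
  obtain d where "h < d" "d < b" using dense[OF \<open>h < b\<close>] by blast
  have "l \<le> h" using l h by auto
  show ?thesis
  proof (rule that[of c d])
    show "K \<subseteq> {c<..<d}"
      using l h \<open>c < l\<close> \<open>h < d\<close> by (force intro: less_le_trans le_less_trans)
  qed (use \<open>a < c\<close> \<open>c < l\<close> \<open>h < d\<close> \<open>d < b\<close> \<open>l \<le> h\<close> in auto)
qed

text \<open>Normalised to vanish at \<open>c\<close>, an antiderivative is constant beyond
  \<open>d\<close>, with the total mass of \<beta> as its value. Zero mean is therefore what makes
  its support compact.\<close>

lemma test_fun_antiderivative:
  fixes \<beta> :: "real \<Rightarrow> real"
  assumes \<beta>: "\<beta> \<in> test_fun {a<..<b}" and "a < b" and int0: "(LINT t|lborel. \<beta> t) = 0"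
  obtains B where "B \<in> test_fun {a<..<b}" "\<And>t. frechet_derivative B (at t) 1 = \<beta> t"
proof -
  obtain K where K: "compact K" "K \<subseteq> {a<..<b}" "\<And>p. p \<notin> K \<Longrightarrow> \<beta> p = 0"
    using test_fun_support[OF \<beta>] by auto
  note K = K test_fun_Ck[OF \<beta>]
  obtain c d where cd: "a < c" "c < d" "d < b" "K \<subseteq> {c<..<d}"
    using compact_subset_open_interval[OF K(1,2) \<open>a < b\<close>] .
  have cont: "isCont \<beta> t" for t using K(4)[of 0] by (simp add: continuous_on_eq_continuous_at)
  obtain G where G: "(G has_real_derivative \<beta> t) (at t)" for t
    using einterval_antiderivative[of "-\<infinity>" "\<infinity>" \<beta>] cont
    by (auto simp: has_real_derivative_iff_has_vector_derivative)
  have FTC: "G y - G x = (LINT t|lborel. \<beta> t * indicator {x..y} t)" if "x \<le> y" for x y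
    using integral_FTC_Icc_real[OF that, of G \<beta>] G cont by simp
  define B where "B t = G t - G c" for t
  have dB: "(B has_real_derivative \<beta> t) (at t)" for t
    unfolding B_def by (auto intro!: derivative_eq_intros G)
  show ?thesis
  proof (rule that)
    show "frechet_derivative B (at t) 1 = \<beta> t" for t
      using frechet_derivative_real[OF dB] by simp
    show "B \<in> test_fun {a<..<b}"
    proof (rule test_funI)
      show "Ck n B" for n using Ck_real_SucI[OF dB K(4)] by (rule Ck_down)
      show "{c..d} \<subseteq> {a<..<b}" using cd by auto
      fix t assume "t \<notin> {c..d}"
      then consider "t < c" | "t > d" by fastforce
      thus "B t = 0"
      proof cases
        case 1
        have "\<beta> s * indicator {t..c} s = 0" for s
          using K(3)[of s] cd(4) by (cases "s \<in> K") (auto simp: indicator_def)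
        hence "G c - G t = 0" using FTC[of t c] 1 by (simp only: integral_zero less_imp_le)
        thus ?thesis by (simp add: B_def)
      next
        case 2
        have "\<beta> s * indicator {c..t} s = \<beta> s" for s
          using K(3)[of s] cd(4) 2 by (cases "s \<in> K") (auto simp: indicator_def)
        hence "G t - G c = 0" using FTC[of c t] 2 cd int0 by (simp only: less_imp_le order.strict_trans)
        thus ?thesis by (simp add: B_def)
      qed
    qed auto
  qed
qed

section \<open>Square integrable functions and the fundamental lemma\<close>

lemma L2_measurable: "f \<in> L2 S \<Longrightarrow> set_borel_measurable lborel S f"
  and L2_square_integrable: "f \<in> L2 S \<Longrightarrow> set_integrable lborel S (\<lambda>p. (f p)\<^sup>2)"
  by (simp_all add: L2_def)

lemma set_borel_measurable_mult:
  fixes f g :: "'a \<Rightarrow> real"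
  assumes "set_borel_measurable M S f" "set_borel_measurable M S g"
  shows "set_borel_measurable M S (\<lambda>p. f p * g p)"
proof -
  have "(\<lambda>p. (indicator S p *\<^sub>R f p) * (indicator S p *\<^sub>R g p)) \<in> borel_measurable M"
    using assms unfolding set_borel_measurable_def by (rule borel_measurable_times)
  moreover have "(\<lambda>p. (indicator S p *\<^sub>R f p) * (indicator S p *\<^sub>R g p)) = (\<lambda>p. indicator S p *\<^sub>R (f p * g p))"
    by (auto simp: indicator_def fun_eq_iff)
  ultimately show ?thesis unfolding set_borel_measurable_def by simp
qed

lemma set_borel_measurable_add:
  fixes f g :: "'a \<Rightarrow> real"
  assumes "set_borel_measurable M S f" "set_borel_measurable M S g"
  shows "set_borel_measurable M S (\<lambda>p. f p + g p)"
  using borel_measurable_add[OF assms[unfolded set_borel_measurable_def]]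
  by (simp add: set_borel_measurable_def algebra_simps)

lemma set_borel_measurable_cmult:
  fixes f :: "'a \<Rightarrow> real"
  assumes "set_borel_measurable M S f"
  shows "set_borel_measurable M S (\<lambda>p. c * f p)"
proof -
  have "(\<lambda>p. c * (indicator S p *\<^sub>R f p)) \<in> borel_measurable M"
    using assms unfolding set_borel_measurable_def by (intro borel_measurable_times) auto
  thus ?thesis by (simp add: set_borel_measurable_def algebra_simps)
qed

lemma set_integrable_bound_AE:
  fixes f g :: "'a \<Rightarrow> real"
  assumes "set_integrable M S g" "set_borel_measurable M S f" "AE p\<in>S in M. \<bar>f p\<bar> \<le> g p"
  shows "set_integrable M S f"
  using assms(3) unfolding set_integrable_def
  by (intro Bochner_Integration.integrable_bound[OF assms(1)[unfolded set_integrable_def]]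
       assms(2)[unfolded set_borel_measurable_def]) (auto simp: indicator_def)

lemma L2_mult_integrable:
  assumes "f \<in> L2 S" "g \<in> L2 S"
  shows "set_integrable lborel S (\<lambda>p. f p * g p)"
proof (rule set_integrable_bound_AE)
  show "set_integrable lborel S (\<lambda>p. (f p)\<^sup>2 + (g p)\<^sup>2)"
    using assms by (intro set_integral_add L2_square_integrable)
  show "set_borel_measurable lborel S (\<lambda>p. f p * g p)"
    using assms by (intro set_borel_measurable_mult L2_measurable)
  have "\<bar>f p * g p\<bar> \<le> (f p)\<^sup>2 + (g p)\<^sup>2" for p
    using sum_squares_bound[of "\<bar>f p\<bar>" "\<bar>g p\<bar>"] mult_nonneg_nonneg[of "\<bar>f p\<bar>" "\<bar>g p\<bar>"]
    unfolding abs_mult power2_abs by linarith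
  thus "AE p\<in>S in lborel. \<bar>f p * g p\<bar> \<le> (f p)\<^sup>2 + (g p)\<^sup>2" by simp
qed

lemma L2_add:
  assumes "f \<in> L2 S" "g \<in> L2 S"
  shows "(\<lambda>p. f p + g p) \<in> L2 S"
proof -
  have "set_integrable lborel S (\<lambda>p. ((f p)\<^sup>2 + (g p)\<^sup>2) + 2 * (f p * g p))"
    using assms by (intro set_integral_add set_integrable_mult_right L2_square_integrable L2_mult_integrable) auto
  moreover have "(\<lambda>p. (f p + g p)\<^sup>2) = (\<lambda>p. ((f p)\<^sup>2 + (g p)\<^sup>2) + 2 * (f p * g p))"
    by (simp add: power2_sum fun_eq_iff mult.assoc)
  ultimately show ?thesis using assms
    by (simp add: L2_def set_borel_measurable_add)
qed

lemma L2_cmult: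
  assumes "f \<in> L2 S" shows "(\<lambda>p. c * f p) \<in> L2 S"
  using assms by (simp add: L2_def power_mult_distrib set_borel_measurable_cmult)

lemma L2_minus: "f \<in> L2 S \<Longrightarrow> (\<lambda>p. - f p) \<in> L2 S"
  using L2_cmult[of f S "-1"] by simp

lemma L2_diff: "f \<in> L2 S \<Longrightarrow> g \<in> L2 S \<Longrightarrow> (\<lambda>p. f p - g p) \<in> L2 S"
  using L2_add[of f S "\<lambda>p. - g p"] L2_minus[of g S] by simp

lemma L2_bounded_mult:
  assumes "f \<in> L2 S" "set_borel_measurable lborel S k" "AE p\<in>S in lborel. \<bar>k p\<bar> \<le> M"
  shows "(\<lambda>p. k p * f p) \<in> L2 S"
proof -
  have m: "set_borel_measurable lborel S (\<lambda>p. k p * f p)"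
    using assms by (simp add: set_borel_measurable_mult L2_measurable)
  have "set_integrable lborel S (\<lambda>p. (k p * f p)\<^sup>2)"
  proof (rule set_integrable_bound_AE)
    show "set_integrable lborel S (\<lambda>p. M\<^sup>2 * (f p)\<^sup>2)"
      using assms by (intro set_integrable_mult_right L2_square_integrable)
    show "set_borel_measurable lborel S (\<lambda>p. (k p * f p)\<^sup>2)"
      using set_borel_measurable_mult[OF m m] by (simp add: power2_eq_square)
    show "AE p\<in>S in lborel. \<bar>(k p * f p)\<^sup>2\<bar> \<le> M\<^sup>2 * (f p)\<^sup>2"
      using assms(3)
    proof eventually_elim
      case (elim p)
      show ?case
      proof
        assume "p \<in> S"
        hence "\<bar>k p\<bar>\<^sup>2 \<le> M\<^sup>2" using elim by (intro power_mono) auto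
        thus "\<bar>(k p * f p)\<^sup>2\<bar> \<le> M\<^sup>2 * (f p)\<^sup>2"
          by (simp add: power_mult_distrib mult_right_mono)
      qed
    qed
  qed
  thus ?thesis using m by (simp add: L2_def)
qed

lemma set_integral_cong_AE_on:
  assumes "set_borel_measurable M S f" "set_borel_measurable M S g" "AE p\<in>S in M. f p = g p"
  shows "(LINT p:S|M. f p) = (LINT p:S|M. g p)"
  unfolding set_lebesgue_integral_def
  using assms by (intro Bochner_Integration.integral_cong_AE)
    (auto simp: set_borel_measurable_def indicator_def elim: eventually_mono)

lemma set_borel_measurable_bounded_L2:
  assumes "set_borel_measurable lborel S f" "AE p\<in>S in lborel. \<bar>f p\<bar> \<le> M"
    and S: "S \<in> sets lborel" "emeasure lborel S < \<infinity>"
  shows "f \<in> L2 S"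
proof -
  have one: "(\<lambda>p. 1) \<in> L2 S"
    using S by (simp add: L2_def set_borel_measurable_def set_integrable_def integrable_indicator_iff)
  show ?thesis using L2_bounded_mult[OF one assms(1,2)] by simp
qed

lemma L2_const: "S \<in> sets lborel \<Longrightarrow> emeasure lborel S < \<infinity> \<Longrightarrow> (\<lambda>p. c) \<in> L2 S"
  by (rule set_borel_measurable_bounded_L2[where M="\<bar>c\<bar>"]) (auto simp: set_borel_measurable_def)

lemma L2_integrable:
  assumes "f \<in> L2 S" "S \<in> sets lborel" "emeasure lborel S < \<infinity>"
  shows "set_integrable lborel S f"
  using L2_mult_integrable[OF assms(1) L2_const[OF assms(2,3), of 1]] by simp

lemma set_integral_square_nonneg: "(LINT p:S|M. (f p :: real)\<^sup>2) \<ge> 0"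
  unfolding set_lebesgue_integral_def by (rule integral_nonneg_AE) auto

lemma L2_norm_nonneg: "L2_norm S f \<ge> 0"
  by (simp add: L2_norm_def set_integral_square_nonneg)

lemma L2_norm_power2: "(L2_norm S f)\<^sup>2 = (LINT p:S|lborel. (f p)\<^sup>2)"
  by (simp add: L2_norm_def set_integral_square_nonneg)

lemma Cauchy_Schwarz_L2:
  assumes f: "f \<in> L2 S" and g: "g \<in> L2 S"
  shows "\<bar>LINT p:S|lborel. f p * g p\<bar> \<le> L2_norm S f * L2_norm S g"
proof -
  define I where "I = (LINT p:S|lborel. f p * g p)"
  let ?F = "(L2_norm S f)\<^sup>2" and ?G = "(L2_norm S g)\<^sup>2"
  have *: "0 \<le> ?F - 2 * t * I + t\<^sup>2 * ?G" for t
  proof -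
    have "0 \<le> (LINT p:S|lborel. (f p - t * g p)\<^sup>2)"
      by (rule set_integral_square_nonneg)
    also have "(\<lambda>p. (f p - t * g p)\<^sup>2) = (\<lambda>p. ((f p)\<^sup>2 - 2 * t * (f p * g p)) + t\<^sup>2 * (g p)\<^sup>2)"
      by (auto simp: fun_eq_iff power2_eq_square algebra_simps)
    also have "(LINT p:S|lborel. ((f p)\<^sup>2 - 2 * t * (f p * g p)) + t\<^sup>2 * (g p)\<^sup>2)
        = ?F - 2 * t * I + t\<^sup>2 * ?G"
    proof -
      have 1: "set_integrable lborel S (\<lambda>p. (f p)\<^sup>2)" "set_integrable lborel S (\<lambda>p. 2 * t * (f p * g p))"
        "set_integrable lborel S (\<lambda>p. t\<^sup>2 * (g p)\<^sup>2)"
        using f g by (auto intro!: set_integrable_mult_right L2_square_integrable L2_mult_integrable)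
      show ?thesis
        unfolding I_def L2_norm_power2 set_integral_add(2)[OF set_integral_diff(1)[OF 1(1,2)] 1(3)]
          set_integral_diff(2)[OF 1(1,2)] by simp
    qed
    finally show ?thesis .
  qed
  have "I\<^sup>2 \<le> ?F * ?G"
  proof (cases "?G = 0")
    case True
    have "I = 0"
    proof (rule ccontr)
      \<comment> \<open>With \<open>?G = 0\<close> the expression in \<open>*\<close> is affine in
        \<open>t\<close>, and the value of \<open>t\<close> chosen below would make it -1.\<close>
      assume "I \<noteq> 0"
      thus False using *[of "(?F + 1) / (2 * I)"] True by simp
    qed
    thus ?thesis by simp
  next
    case False
    hence G: "?G > 0" by simp
    define c where "c = ?G"
    \<comment> \<open>\<open>I / c\<close> is the minimiser of the quadratic in
      \<open>t\<close>.\<close>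
    have "0 \<le> ?F - 2 * (I / c) * I + (I / c)\<^sup>2 * c" using *[of "I / c"] by (simp add: c_def)
    also have "\<dots> = ?F - I\<^sup>2 / c" using G by (simp add: c_def[symmetric] power2_eq_square)
    finally show ?thesis using G by (simp add: c_def[symmetric] field_simps)
  qed
  hence "\<bar>I\<bar>\<^sup>2 \<le> (L2_norm S f * L2_norm S g)\<^sup>2" by (simp add: power_mult_distrib)
  thus ?thesis unfolding I_def
    by (rule power2_le_imp_le) (simp add: L2_norm_nonneg)
qed

text \<open>The sets over which \<open>f\<close> integrates to zero form a Dynkin system, and the
  open boxes are an intersection-stable generator of the Borel sets.\<close>

lemma AE_zero_of_boxes:
  fixes f :: "'a::euclidean_space \<Rightarrow> real"
  assumes f: "integrable lborel f"
    and box: "\<And>l u. (LINT p:box l u|lborel. f p) = 0"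
  shows "AE p in lborel. f p = 0"
proof (rule density_unique_real[OF f])
  let ?E = "range (\<lambda>(a, b). box a b::'a set)"
  have int: "A \<in> sets borel \<Longrightarrow> set_integrable lborel A f" for A
    unfolding set_integrable_def by (rule integrable_mult_indicator[OF _ f]) simp
  \<comment> \<open>The step for complements needs the integral over the whole space, obtained as a
    limit over growing boxes.\<close>
  have UNIV0: "(LINT p|lborel. f p) = 0"
  proof -
    have "(\<lambda>n. LINT p|lborel. indicator (box (- (real n *\<^sub>R One)) (real n *\<^sub>R One)) p *\<^sub>R f p)
        \<longlonglongrightarrow> (LINT p|lborel. f p)"
    proof (rule integral_dominated_convergence[where w="\<lambda>p. \<bar>f p\<bar>"])
      show "AE p in lborel. (\<lambda>n. indicator (box (- (real n *\<^sub>R One)) (real n *\<^sub>R One)) p *\<^sub>R f p) \<longlonglongrightarrow> f p"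
      proof (intro AE_I2 tendsto_eventually)
        fix p :: 'a
        obtain N where N: "real N > norm p" using reals_Archimedean2 by blast
        show "\<forall>\<^sub>F n in sequentially. indicator (box (- (real n *\<^sub>R One)) (real n *\<^sub>R One)) p *\<^sub>R f p = f p"
          using eventually_ge_at_top[of N]
        proof eventually_elim
          case (elim n)
          have "\<bar>p \<bullet> b\<bar> < real n" if "b \<in> Basis" for b
            using Basis_le_norm[OF that, of p] N elim by linarith
          hence "p \<in> box (- (real n *\<^sub>R One)) (real n *\<^sub>R One)" by (auto simp: mem_box abs_less_iff)
             (metis minus_less_iff)
          thus ?case by simp
        qed
      qed
    qed (use f in \<open>auto simp: indicator_def\<close>)
    moreover have "(LINT p|lborel. indicator (box (- (real n *\<^sub>R One)) (real n *\<^sub>R One)) p *\<^sub>R f p) = 0" for n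
      using box unfolding set_lebesgue_integral_def by blast
    ultimately show ?thesis by (simp add: LIMSEQ_const_iff)
  qed
  have "(LINT p:A|lborel. f p) = 0" if "A \<in> sigma_sets UNIV ?E" for A
  proof -
    have "Int_stable ?E" "?E \<subseteq> Pow UNIV" by (auto simp: Int_stable_def box_Int_box)
    from this that show ?thesis
    proof (induct rule: sigma_sets_induct_disjoint)
      case (compl A)
      hence A: "A \<in> sets borel" by (simp add: borel_eq_box)
      have "(LINT p:A \<union> (UNIV - A)|lborel. f p) = (LINT p:A|lborel. f p) + (LINT p:UNIV - A|lborel. f p)"
        using A by (intro set_integral_Un int) auto
      thus ?case using compl UNIV0 by (simp add: set_lebesgue_integral_def)
    next
      case (union A)
      hence A: "A i \<in> sets borel" for i by (auto simp: borel_eq_box)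
      have "(LINT p:(\<Union>i. A i)|lborel. f p) = (\<Sum>i. (LINT p:(A i)|lborel. f p))"
        using union(1) A by (intro lebesgue_integral_countable_add int) (auto simp: disjoint_family_on_def)
      thus ?case using union by simp
    qed (use box in \<open>auto simp: set_lebesgue_integral_def\<close>)
  qed
  thus "(LINT p:A|lborel. f p) = (LINT p:A|lborel. 0)" if "A \<in> sets lborel" for A
    using that by (simp add: borel_eq_box)
qed simp

text \<open>Test functions in product form suffice because the indicator of a box is itself a
  product, and products of bumps converge to it boundedly.\<close>

lemma fundamental_lemma_rectangle:
  fixes f :: "real \<times> real \<Rightarrow> real"
  assumes f: "set_integrable lborel ({a<..<b} \<times> {c<..<d}) f"
    and orth: "\<And>\<phi> \<psi>. \<phi> \<in> test_fun {a<..<b} \<Longrightarrow> \<psi> \<in> test_fun {c<..<d} \<Longrightarrow>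
      (LINT p:{a<..<b} \<times> {c<..<d}|lborel. f p * (\<phi> (fst p) * \<psi> (snd p))) = 0"
  shows "AE p\<in>{a<..<b} \<times> {c<..<d} in lborel. f p = 0"
proof -
  let ?O = "{a<..<b} \<times> {c<..<d}"
  define g where "g p = indicator ?O p *\<^sub>R f p" for p
  have g: "integrable lborel g" using f unfolding g_def set_integrable_def .
  hence gm [measurable]: "g \<in> borel_measurable borel" by auto
  have "AE p in lborel. g p = 0"
  proof (rule AE_zero_of_boxes[OF g])
    fix l u :: "real \<times> real"
    \<comment> \<open>Cutting the box down to the rectangle keeps the supports inside; an empty
      intersection gives the zero bump.\<close>
    define \<phi> where "\<phi> n = bump (max (fst l) a) (min (fst u) b) n" for n
    define \<psi> where "\<psi> n = bump (max (snd l) c) (min (snd u) d) n" for n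
    have t: "\<phi> n \<in> test_fun {a<..<b}" "\<psi> n \<in> test_fun {c<..<d}" for n
      unfolding \<phi>_def \<psi>_def by (auto intro!: bump_test_fun_superset)
    have "(\<lambda>n. LINT p|lborel. g p * (\<phi> n (fst p) * \<psi> n (snd p))) \<longlonglongrightarrow>
      (LINT p|lborel. indicator (box l u) p *\<^sub>R g p)"
    proof (rule integral_dominated_convergence[where w="\<lambda>p. \<bar>g p\<bar>"])
      show "AE p in lborel. (\<lambda>n. g p * (\<phi> n (fst p) * \<psi> n (snd p))) \<longlonglongrightarrow> indicator (box l u) p *\<^sub>R g p"
      proof (rule AE_I2)
        fix p
        have "(\<lambda>n. g p * (\<phi> n (fst p) * \<psi> n (snd p))) \<longlonglongrightarrow>
          g p * (indicator {max (fst l) a<..<min (fst u) b} (fst p) * indicator {max (snd l) c<..<min (snd u) d} (snd p))"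
          unfolding \<phi>_def \<psi>_def by (intro tendsto_intros bump_tendsto)
        also have "g p * (indicator {max (fst l) a<..<min (fst u) b} (fst p) * indicator {max (snd l) c<..<min (snd u) d} (snd p))
           = indicator (box l u) p *\<^sub>R g p"
          by (cases p, cases l, cases u) (auto simp: g_def indicator_def box_def Basis_prod_def)
        finally show "(\<lambda>n. g p * (\<phi> n (fst p) * \<psi> n (snd p))) \<longlonglongrightarrow> indicator (box l u) p *\<^sub>R g p" .
      qed
      show "AE p in lborel. norm (g p * (\<phi> n (fst p) * \<psi> n (snd p))) \<le> \<bar>g p\<bar>" for n
      proof (rule AE_I2)
        fix p
        have "\<bar>\<phi> n (fst p)\<bar> * \<bar>\<psi> n (snd p)\<bar> \<le> 1"
          unfolding \<phi>_def \<psi>_def using bump_bounds by (simp add: mult_le_one)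
        thus "norm (g p * (\<phi> n (fst p) * \<psi> n (snd p))) \<le> \<bar>g p\<bar>"
          by (simp add: abs_mult mult_left_le)
      qed
      show "(\<lambda>p. g p * (\<phi> n (fst p) * \<psi> n (snd p))) \<in> borel_measurable lborel" for n
      proof -
        note [measurable] = test_fun_borel[OF test_fun_product(1)[OF t, of n n]]
        show ?thesis by measurable
      qed
    qed (use g in auto)
    moreover have "(LINT p|lborel. g p * (\<phi> n (fst p) * \<psi> n (snd p))) = 0" for n
      using orth[OF t, of n n] unfolding g_def set_lebesgue_integral_def by (simp add: mult.assoc)
    ultimately show "(LINT p:box l u|lborel. g p) = 0"
      by (simp add: LIMSEQ_const_iff set_lebesgue_integral_def)
  qed
  thus ?thesis unfolding g_def by (auto elim: eventually_mono)
qed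

lemma fundamental_lemma_interval:
  fixes f :: "real \<Rightarrow> real"
  assumes f: "set_integrable lborel {a<..<b} f"
    and orth: "\<And>\<phi>. \<phi> \<in> test_fun {a<..<b} \<Longrightarrow> (LINT t:{a<..<b}|lborel. f t * \<phi> t) = 0"
  shows "AE t\<in>{a<..<b} in lborel. f t = 0"
proof -
  define g where "g p = indicator {a<..<b} p *\<^sub>R f p" for p
  have g: "integrable lborel g" using f unfolding g_def set_integrable_def .
  hence gm [measurable]: "g \<in> borel_measurable borel" by auto
  have "AE p in lborel. g p = 0"
  proof (rule AE_zero_of_boxes[OF g])
    fix l u :: real
    define \<phi> where "\<phi> n = bump (max l a) (min u b) n" for n
    have t: "\<phi> n \<in> test_fun {a<..<b}" for n
      unfolding \<phi>_def by (auto intro!: bump_test_fun_superset)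
    have "(\<lambda>n. LINT p|lborel. g p * \<phi> n p) \<longlonglongrightarrow> (LINT p|lborel. indicator (box l u) p *\<^sub>R g p)"
    proof (rule integral_dominated_convergence[where w="\<lambda>p. \<bar>g p\<bar>"])
      show "AE p in lborel. (\<lambda>n. g p * \<phi> n p) \<longlonglongrightarrow> indicator (box l u) p *\<^sub>R g p"
      proof (rule AE_I2)
        fix p
        have "(\<lambda>n. g p * \<phi> n p) \<longlonglongrightarrow> g p * indicator {max l a<..<min u b} p"
          unfolding \<phi>_def by (intro tendsto_intros bump_tendsto)
        also have "g p * indicator {max l a<..<min u b} p = indicator (box l u) p *\<^sub>R g p"
          by (auto simp: g_def indicator_def)
        finally show "(\<lambda>n. g p * \<phi> n p) \<longlonglongrightarrow> indicator (box l u) p *\<^sub>R g p" .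
      qed
      show "AE p in lborel. norm (g p * \<phi> n p) \<le> \<bar>g p\<bar>" for n
        unfolding \<phi>_def using bump_bounds by (simp add: abs_mult mult_left_le)
      show "(\<lambda>p. g p * \<phi> n p) \<in> borel_measurable lborel" for n
      proof -
        have [measurable]: "\<phi> n \<in> borel_measurable borel"
          using t test_fun_borel by blast
        show ?thesis by measurable
      qed
    qed (use g in auto)
    moreover have "(LINT p|lborel. g p * \<phi> n p) = 0" for n
      using orth[OF t, of n] unfolding g_def set_lebesgue_integral_def by (simp add: mult.assoc)
    ultimately show "(LINT p:box l u|lborel. g p) = 0"
      by (simp add: LIMSEQ_const_iff set_lebesgue_integral_def)
  qed
  thus ?thesis unfolding g_def by (auto elim: eventually_mono)
qed

section \<open>Weak derivatives and time reflection\<close>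

lemma Omega_sets [measurable, simp]: "Omega L T \<in> sets borel"
  unfolding Omega_def by (intro borel_open open_Times) auto

lemma emeasure_Omega: "emeasure lborel (Omega L T) < \<infinity>"
proof -
  have "bounded (Omega L T)"
    unfolding Omega_def by (intro bounded_Times) auto
  thus ?thesis by (rule emeasure_bounded_finite)
qed

lemma emeasure_interval: "emeasure lborel {a<..<b::real} < \<infinity>"
  by (rule emeasure_bounded_finite) simp

lemma test_fun_L2: "\<phi> \<in> test_fun S' \<Longrightarrow> S \<in> sets lborel \<Longrightarrow> emeasure lborel S < \<infinity> \<Longrightarrow> \<phi> \<in> L2 S"
proof -
  assume a: "\<phi> \<in> test_fun S'" "S \<in> sets lborel" "emeasure lborel S < \<infinity>"
  obtain B where "\<bar>\<phi> p\<bar> \<le> B" for p using test_fun_bounded[OF a(1)] by metis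
  moreover have "set_borel_measurable lborel S \<phi>"
    using test_fun_borel[OF a(1)] a(2) unfolding set_borel_measurable_def by measurable
  ultimately show ?thesis using a(2,3) by (intro set_borel_measurable_bounded_L2[where M=B]) auto
qed

lemma test_fun_Omega_L2: "\<phi> \<in> test_fun (Omega L T) \<Longrightarrow> \<phi> \<in> L2 (Omega L T)"
  by (rule test_fun_L2[OF _ _ emeasure_Omega]) auto

lemma test_fun_deriv_Omega_L2:
  "\<phi> \<in> test_fun (Omega L T) \<Longrightarrow> (\<lambda>p. frechet_derivative \<phi> (at p) e) \<in> L2 (Omega L T)"
  by (intro test_fun_Omega_L2 test_fun_frechet_derivative)

lemma L2_Omega_integrable: "f \<in> L2 (Omega L T) \<Longrightarrow> set_integrable lborel (Omega L T) f"
  by (rule L2_integrable[OF _ _ emeasure_Omega]) auto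

lemma set_integral_mult_cong_AE:
  assumes "f \<in> L2 S" "f' \<in> L2 S" "g \<in> L2 S" "AE p\<in>S in lborel. f p = f' p"
  shows "(LINT p:S|lborel. f p * g p) = (LINT p:S|lborel. f' p * g p)"
  by (rule set_integral_cong_AE_on[OF set_borel_measurable_mult[OF L2_measurable L2_measurable]
        set_borel_measurable_mult[OF L2_measurable L2_measurable]])
    (use assms in \<open>auto elim: eventually_mono\<close>)

text \<open>\<open>Dxx\<close> differentiates the particular representative that
  \<open>weak_deriv\<close> selects for \<open>Dx\<close>, so a derivative known for another
  representative has to be carried over.\<close>

lemma has_weak_deriv_cong:
  assumes "has_weak_deriv (Omega L T) e f g" "f \<in> L2 (Omega L T)" "f' \<in> L2 (Omega L T)"
    "g \<in> L2 (Omega L T)" "g' \<in> L2 (Omega L T)"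
    "AE p\<in>Omega L T in lborel. f p = f' p" "AE p\<in>Omega L T in lborel. g p = g' p"
  shows "has_weak_deriv (Omega L T) e f' g'"
  unfolding has_weak_deriv_def
proof
  fix \<phi> assume t: "\<phi> \<in> test_fun (Omega L T)"
  show "(LINT p:Omega L T|lborel. f' p * frechet_derivative \<phi> (at p) e) = - (LINT p:Omega L T|lborel. g' p * \<phi> p)"
    using assms(1) t
      set_integral_mult_cong_AE[OF assms(2,3) test_fun_deriv_Omega_L2[OF t, of e] assms(6)]
      set_integral_mult_cong_AE[OF assms(4,5) test_fun_Omega_L2[OF t] assms(7)]
    unfolding has_weak_deriv_def by simp
qed

lemma has_weak_deriv_diff:
  assumes "has_weak_deriv (Omega L T) e f g" "has_weak_deriv (Omega L T) e f' g'"
    and L2: "f \<in> L2 (Omega L T)" "f' \<in> L2 (Omega L T)" "g \<in> L2 (Omega L T)" "g' \<in> L2 (Omega L T)"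
  shows "has_weak_deriv (Omega L T) e (\<lambda>p. f p - f' p) (\<lambda>p. g p - g' p)"
  unfolding has_weak_deriv_def
proof
  fix \<phi> assume t: "\<phi> \<in> test_fun (Omega L T)"
  note i = L2_mult_integrable[OF _ test_fun_deriv_Omega_L2[OF t]] L2_mult_integrable[OF _ test_fun_Omega_L2[OF t]]
  show "(LINT p:Omega L T|lborel. (f p - f' p) * frechet_derivative \<phi> (at p) e)
      = - (LINT p:Omega L T|lborel. (g p - g' p) * \<phi> p)"
    using assms(1,2) t
    unfolding has_weak_deriv_def left_diff_distrib
      set_integral_diff(2)[OF i(1)[OF L2(1)] i(1)[OF L2(2)]]
      set_integral_diff(2)[OF i(2)[OF L2(3)] i(2)[OF L2(4)]] by simp
qed

lemma has_weak_deriv_unique: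
  assumes "has_weak_deriv (Omega L T) e f g" "has_weak_deriv (Omega L T) e f g'"
    and L2: "g \<in> L2 (Omega L T)" "g' \<in> L2 (Omega L T)"
  shows "AE p\<in>Omega L T in lborel. g p = g' p"
proof -
  have "AE p\<in>{0<..<L} \<times> {0<..<T} in lborel. g p - g' p = 0"
  proof (rule fundamental_lemma_rectangle)
    show "set_integrable lborel ({0<..<L} \<times> {0<..<T}) (\<lambda>p. g p - g' p)"
      using L2_Omega_integrable[OF L2_diff[OF L2]] unfolding Omega_def .
    fix \<phi> \<psi> :: "real \<Rightarrow> real" assume "\<phi> \<in> test_fun {0<..<L}" "\<psi> \<in> test_fun {0<..<T}"
    hence t: "(\<lambda>p. \<phi> (fst p) * \<psi> (snd p)) \<in> test_fun (Omega L T)"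
      unfolding Omega_def by (rule test_fun_product)
    note i = L2_mult_integrable[OF _ test_fun_Omega_L2[OF t]]
    have "(LINT p:Omega L T|lborel. g p * (\<phi> (fst p) * \<psi> (snd p)))
        = (LINT p:Omega L T|lborel. g' p * (\<phi> (fst p) * \<psi> (snd p)))"
      using assms(1,2) t unfolding has_weak_deriv_def by fastforce
    thus "(LINT p:{0<..<L} \<times> {0<..<T}|lborel. (g p - g' p) * (\<phi> (fst p) * \<psi> (snd p))) = 0"
      unfolding left_diff_distrib Omega_def[symmetric] set_integral_diff(2)[OF i[OF L2(1)] i[OF L2(2)]] by simp
  qed
  thus ?thesis unfolding Omega_def by simp
qed

lemma weak_deriv_works:
  assumes "weakly_diff S e f"
  shows "weak_deriv S e f \<in> L2 S" "has_weak_deriv S e f (weak_deriv S e f)"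
  using assms someI_ex[of "\<lambda>g. g \<in> L2 S \<and> has_weak_deriv S e f g"]
  unfolding weakly_diff_def weak_deriv_def by blast+

lemma weak_deriv_AE_eq:
  assumes "has_weak_deriv (Omega L T) e f g" "g \<in> L2 (Omega L T)"
  shows "AE p\<in>Omega L T in lborel. weak_deriv (Omega L T) e f p = g p"
proof -
  have "weakly_diff (Omega L T) e f" using assms unfolding weakly_diff_def by blast
  from has_weak_deriv_unique[OF weak_deriv_works(2)[OF this] assms(1) weak_deriv_works(1)[OF this] assms(2)]
  show ?thesis .
qed

lemma H21D:
  assumes "f \<in> H21 L T"
  shows "f \<in> L2 (Omega L T)" "Dt L T f \<in> L2 (Omega L T)" "Dx L T f \<in> L2 (Omega L T)" "Dxx L T f \<in> L2 (Omega L T)"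
    "has_weak_deriv (Omega L T) (0, 1) f (Dt L T f)"
    "has_weak_deriv (Omega L T) (1, 0) f (Dx L T f)"
    "has_weak_deriv (Omega L T) (1, 0) (Dx L T f) (Dxx L T f)"
  using assms weak_deriv_works unfolding H21_def by blast+

text \<open>This is the only bridge from exhibited weak derivatives to the selected ones
  \<open>Dt\<close> and \<open>Dxx\<close>. The two agree only up to null sets, hence the
  almost-everywhere form of the conclusions; that is enough under integrals.\<close>

lemma H21I:
  assumes L2: "f \<in> L2 (Omega L T)" "ft \<in> L2 (Omega L T)" "fx \<in> L2 (Omega L T)" "fxx \<in> L2 (Omega L T)"
    and d: "has_weak_deriv (Omega L T) (0, 1) f ft" "has_weak_deriv (Omega L T) (1, 0) f fx"
     "has_weak_deriv (Omega L T) (1, 0) fx fxx"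
  shows "f \<in> H21 L T" "AE p\<in>Omega L T in lborel. Dt L T f p = ft p"
    "AE p\<in>Omega L T in lborel. Dxx L T f p = fxx p"
proof -
  have w: "weakly_diff (Omega L T) (0, 1) f" "weakly_diff (Omega L T) (1, 0) f"
    using assms unfolding weakly_diff_def by blast+
  have x: "AE p\<in>Omega L T in lborel. fx p = Dx L T f p"
    using weak_deriv_AE_eq[OF d(2) L2(3)] by (auto elim: eventually_mono)
  have xx: "has_weak_deriv (Omega L T) (1, 0) (Dx L T f) fxx"
    by (rule has_weak_deriv_cong[OF d(3) L2(3) weak_deriv_works(1)[OF w(2)] L2(4) L2(4) x]) simp
  show "f \<in> H21 L T"
    using L2(1,4) w xx unfolding H21_def by (auto simp: weakly_diff_def[of _ _ "Dx L T f"])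
  show "AE p\<in>Omega L T in lborel. Dt L T f p = ft p"
    by (rule weak_deriv_AE_eq[OF d(1) L2(2)])
  show "AE p\<in>Omega L T in lborel. Dxx L T f p = fxx p"
    by (rule weak_deriv_AE_eq[OF xx L2(4)])
qed

lemma hatH21_H21: "f \<in> hatH21 L T \<Longrightarrow> f \<in> H21 L T"
  by (simp add: hatH21_def)

lemma hatH21_diff:
  assumes f: "f \<in> hatH21 L T" and g: "g \<in> hatH21 L T"
  shows "(\<lambda>p. f p - g p) \<in> hatH21 L T"
    "AE p\<in>Omega L T in lborel. Dt L T (\<lambda>p. f p - g p) p = Dt L T f p - Dt L T g p"
    "AE p\<in>Omega L T in lborel. Dxx L T (\<lambda>p. f p - g p) p = Dxx L T f p - Dxx L T g p"
proof -
  note F = H21D[OF hatH21_H21[OF f]] and G = H21D[OF hatH21_H21[OF g]]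
  note h = H21I[OF L2_diff[OF F(1) G(1)] L2_diff[OF F(2) G(2)] L2_diff[OF F(3) G(3)] L2_diff[OF F(4) G(4)]
      has_weak_deriv_diff[OF F(5) G(5) F(1) G(1) F(2) G(2)] has_weak_deriv_diff[OF F(6) G(6) F(1) G(1) F(3) G(3)]
      has_weak_deriv_diff[OF F(7) G(7) F(3) G(3) F(4) G(4)]]
  show "(\<lambda>p. f p - g p) \<in> hatH21 L T"
    using f g h(1) by (auto simp: hatH21_def intro!: continuous_on_diff)
  show "AE p\<in>Omega L T in lborel. Dt L T (\<lambda>p. f p - g p) p = Dt L T f p - Dt L T g p"
    "AE p\<in>Omega L T in lborel. Dxx L T (\<lambda>p. f p - g p) p = Dxx L T f p - Dxx L T g p"
    using h(2,3) by simp_all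
qed

section \<open>Reflection in time\<close>

definition treflect :: "real \<Rightarrow> real \<times> real \<Rightarrow> real \<times> real" where
  "treflect T p = (fst p, T - snd p)"

lemma treflect_simps [simp]: "treflect T (x, t) = (x, T - t)" "fst (treflect T p) = fst p"
  "snd (treflect T p) = T - snd p" "treflect T (treflect T p) = p"
  by (simp_all add: treflect_def)

lemma treflect_Omega [simp]: "treflect T p \<in> Omega L T \<longleftrightarrow> p \<in> Omega L T"
  by (cases p) (auto simp: Omega_def)

lemma indicator_treflect [simp]: "indicator (Omega L T) (treflect T p) = (indicator (Omega L T) p :: real)"
  by (simp add: indicator_def)

lemma treflect_borel: "treflect T \<in> borel_measurable borel"
  unfolding treflect_def by (intro borel_measurable_continuous_onI continuous_intros)

lemma distr_treflect: "distr lborel lborel (treflect T) = lborel"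
proof -
  \<comment> \<open>The reflection is the affine map with diagonal entries 1 and -1 and translation
    \<open>(0, T)\<close>; its Jacobian has modulus 1.\<close>
  define c :: "real \<times> real \<Rightarrow> real" where "c j = (if j = (1, 0) then 1 else - 1)" for j
  have "lborel = density (distr lborel borel (\<lambda>x. (0, T) + (\<Sum>j\<in>Basis. (c j * (x \<bullet> j)) *\<^sub>R j)))
      (\<lambda>_. (\<Prod>j\<in>Basis. \<bar>c j\<bar>))"
    by (rule lborel_affine_euclidean) (auto simp: c_def)
  moreover have "(\<lambda>x. (0, T) + (\<Sum>j\<in>Basis. (c j * (x \<bullet> j)) *\<^sub>R j)) = treflect T"
    by (auto simp: fun_eq_iff c_def Basis_prod_def sum.union_disjoint treflect_def)
  moreover have "(\<Prod>j\<in>Basis. \<bar>c j\<bar>) = 1"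
    by (rule prod.neutral) (auto simp: c_def)
  moreover have "distr lborel borel (treflect T) = distr lborel lborel (treflect T)"
    by (rule distr_cong) auto
  ultimately show ?thesis by (simp add: density_1)
qed

lemma set_borel_measurable_treflect:
  assumes "set_borel_measurable lborel (Omega L T) f"
  shows "set_borel_measurable lborel (Omega L T) (\<lambda>p. f (treflect T p))"
proof -
  have "(\<lambda>p. indicator (Omega L T) p *\<^sub>R f p) \<in> borel_measurable borel"
    using assms by (simp add: set_borel_measurable_def)
  from measurable_compose[OF treflect_borel[of T] this]
  show ?thesis by (simp add: set_borel_measurable_def)
qed

lemma set_integral_treflect:
  fixes f :: "real \<times> real \<Rightarrow> real"
  assumes "set_borel_measurable lborel (Omega L T) f"
  shows "(LINT p:Omega L T|lborel. f (treflect T p)) = (LINT p:Omega L T|lborel. f p)"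
    and "set_integrable lborel (Omega L T) (\<lambda>p. f (treflect T p)) \<longleftrightarrow> set_integrable lborel (Omega L T) f"
proof -
  have m: "(\<lambda>p. indicator (Omega L T) p *\<^sub>R f p) \<in> borel_measurable lborel"
    using assms by (simp add: set_borel_measurable_def)
  have r: "treflect T \<in> measurable lborel lborel" using treflect_borel by simp
  show "(LINT p:Omega L T|lborel. f (treflect T p)) = (LINT p:Omega L T|lborel. f p)"
    using integral_distr[OF r m] by (simp add: distr_treflect set_lebesgue_integral_def)
  show "set_integrable lborel (Omega L T) (\<lambda>p. f (treflect T p)) \<longleftrightarrow> set_integrable lborel (Omega L T) f"
    using integrable_distr_eq[OF r m] by (simp add: distr_treflect set_integrable_def)
qed

lemma L2_treflect:
  assumes "f \<in> L2 (Omega L T)" shows "(\<lambda>p. f (treflect T p)) \<in> L2 (Omega L T)"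
  using assms set_borel_measurable_treflect[of L T f]
    set_integral_treflect(2)[of L T "\<lambda>p. (f p)\<^sup>2"] set_borel_measurable_mult[of lborel "Omega L T" f f]
  by (simp add: L2_def power2_eq_square)

lemma test_fun_treflect:
  assumes \<phi>: "\<phi> \<in> test_fun (Omega L T)"
  shows "(\<lambda>p. \<phi> (treflect T p)) \<in> test_fun (Omega L T)"
    "frechet_derivative (\<lambda>p. \<phi> (treflect T p)) (at p) (1, 0) = frechet_derivative \<phi> (at (treflect T p)) (1, 0)"
    "frechet_derivative (\<lambda>p. \<phi> (treflect T p)) (at p) (0, 1) = - frechet_derivative \<phi> (at (treflect T p)) (0, 1)"
proof -
  obtain K where K: "compact K" "K \<subseteq> Omega L T" "\<And>p. p \<notin> K \<Longrightarrow> \<phi> p = 0"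
    using test_fun_support[OF \<phi>] by metis
  have lin: "linear (\<lambda>p::real\<times>real. (fst p, - snd p))"
    by (auto intro!: linearI)
  have eq: "treflect T = (\<lambda>p. (fst p, - snd p) + (0, T))"
    by (auto simp: treflect_def)
  show "(\<lambda>p. \<phi> (treflect T p)) \<in> test_fun (Omega L T)"
  proof (rule test_funI)
    show "Ck n (\<lambda>p. \<phi> (treflect T p))" for n
      unfolding eq by (rule Ck_affine[OF lin test_fun_Ck[OF \<phi>]])
    show "compact (treflect T ` K)"
      unfolding treflect_def by (intro compact_continuous_image K continuous_intros)
    show "treflect T ` K \<subseteq> Omega L T" using K(2) treflect_Omega by blast
    show "\<phi> (treflect T p) = 0" if "p \<notin> treflect T ` K" for p
    proof (rule K(3))
      show "treflect T p \<notin> K" using that by (metis imageI treflect_simps(4))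
    qed
  qed
  have D: "((\<lambda>p. \<phi> (treflect T p)) has_derivative (\<lambda>h. frechet_derivative \<phi> (at (treflect T p)) (fst h, - snd h))) (at p)"
  proof (rule has_derivative_compose[OF _ test_fun_has_derivative[OF \<phi>]])
    show "(treflect T has_derivative (\<lambda>h. (fst h, - snd h))) (at p)"
      unfolding treflect_def by (auto intro!: derivative_eq_intros)
  qed
  interpret linear "frechet_derivative \<phi> (at (treflect T p))"
    using has_derivative_linear[OF test_fun_has_derivative[OF \<phi>]] .
  show "frechet_derivative (\<lambda>p. \<phi> (treflect T p)) (at p) (1, 0) = frechet_derivative \<phi> (at (treflect T p)) (1, 0)"
    "frechet_derivative (\<lambda>p. \<phi> (treflect T p)) (at p) (0, 1) = - frechet_derivative \<phi> (at (treflect T p)) (0, 1)"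
    unfolding frechet_derivative_at[OF D, symmetric] using neg[of "(0, 1)"] by simp_all
qed

text \<open>\<open>s\<close> is the factor by which the reflection scales the direction
  \<open>e\<close>: 1 in space and -1 in time. The test function is reflected instead of
  \<open>f\<close> and \<open>g\<close>, and \<open>s * s = 1\<close> moves the sign to the other
  side.\<close>

lemma has_weak_deriv_treflect:
  assumes w: "has_weak_deriv (Omega L T) e f g" and L2: "f \<in> L2 (Omega L T)" "g \<in> L2 (Omega L T)"
    and e: "(e, s) = ((1, 0), 1) \<or> (e, s) = ((0, 1), - 1)"
  shows "has_weak_deriv (Omega L T) e (\<lambda>p. f (treflect T p)) (\<lambda>p. s * g (treflect T p))"
  unfolding has_weak_deriv_def
proof
  fix \<phi> assume \<phi>: "\<phi> \<in> test_fun (Omega L T)"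
  define \<theta> where "\<theta> p = \<phi> (treflect T p)" for p
  have \<theta>: "\<theta> \<in> test_fun (Omega L T)" "\<phi> p = \<theta> (treflect T p)" for p
    unfolding \<theta>_def using test_fun_treflect(1)[OF \<phi>] by simp_all
  have \<theta>': "frechet_derivative \<theta> (at (treflect T p)) e = s * frechet_derivative \<phi> (at p) e" for p
  proof (cases "e = (1, 0)")
    case True
    thus ?thesis
      using test_fun_treflect(2)[OF \<phi>, of "treflect T p"] e unfolding \<theta>_def treflect_simps(4) by simp
  next
    case False
    thus ?thesis
      using test_fun_treflect(3)[OF \<phi>, of "treflect T p"] e unfolding \<theta>_def treflect_simps(4) by simp
  qed
  have s: "s * s = 1" using e by auto
  have "(LINT p:Omega L T|lborel. f (treflect T p) * frechet_derivative \<phi> (at p) e)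
    = s * (LINT p:Omega L T|lborel. f (treflect T p) * frechet_derivative \<theta> (at (treflect T p)) e)"
  proof -
    have "f (treflect T p) * frechet_derivative \<phi> (at p) e
        = s * (f (treflect T p) * frechet_derivative \<theta> (at (treflect T p)) e)" for p
    proof -
      have "s * (f (treflect T p) * (s * frechet_derivative \<phi> (at p) e))
          = (s * s) * (f (treflect T p) * frechet_derivative \<phi> (at p) e)"
        by (simp only: ac_simps)
      thus ?thesis unfolding \<theta>' s by simp
    qed
    thus ?thesis by (simp only: set_integral_mult_right)
  qed
  also have "\<dots> = s * (LINT p:Omega L T|lborel. f p * frechet_derivative \<theta> (at p) e)"
    using set_integral_treflect(1)[OF set_borel_measurable_mult[OF L2_measurable[OF L2(1)]
      L2_measurable[OF test_fun_deriv_Omega_L2[OF \<theta>(1), of e]]]] by simp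
  also have "\<dots> = - (s * (LINT p:Omega L T|lborel. g p * \<theta> p))"
    using w \<theta>(1) by (simp add: has_weak_deriv_def)
  also have "(LINT p:Omega L T|lborel. g p * \<theta> p) = (LINT p:Omega L T|lborel. g (treflect T p) * \<phi> p)"
    using set_integral_treflect(1)[OF set_borel_measurable_mult[OF L2_measurable[OF L2(2)]
      L2_measurable[OF test_fun_Omega_L2[OF \<theta>(1)]]]] unfolding \<theta>(2)[symmetric] by simp
  finally show "(LINT p:Omega L T|lborel. f (treflect T p) * frechet_derivative \<phi> (at p) e)
    = - (LINT p:Omega L T|lborel. s * g (treflect T p) * \<phi> p)"
    by (simp add: mult.assoc)
qed

lemma hatH21_treflect:
  assumes f: "f \<in> hatH21 L T"
  shows "(\<lambda>p. f (treflect T p)) \<in> hatH21 L T"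
    "AE p\<in>Omega L T in lborel. Dt L T (\<lambda>p. f (treflect T p)) p = - Dt L T f (treflect T p)"
    "AE p\<in>Omega L T in lborel. Dxx L T (\<lambda>p. f (treflect T p)) p = Dxx L T f (treflect T p)"
proof -
  note F = H21D[OF hatH21_H21[OF f]]
  note h = H21I[OF L2_treflect[OF F(1)] L2_cmult[OF L2_treflect[OF F(2)]] L2_cmult[OF L2_treflect[OF F(3)]]
      L2_cmult[OF L2_treflect[OF F(4)]] has_weak_deriv_treflect[OF F(5) F(1,2)]
      has_weak_deriv_treflect[OF F(6) F(1,3)], of "-1" 1 1]
  have xx: "has_weak_deriv (Omega L T) (1, 0) (\<lambda>p. 1 * Dx L T f (treflect T p)) (\<lambda>p. 1 * Dxx L T f (treflect T p))"
    using has_weak_deriv_treflect[OF F(7) F(3,4), of 1] by simp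
  have "continuous_on ({0..L} \<times> {0..T}) (\<lambda>p. f (treflect T p))"
    unfolding treflect_def
    by (rule continuous_on_compose2[of "{0..L} \<times> {0..T}" f]) (use f in \<open>auto simp: hatH21_def intro!: continuous_intros\<close>)
  thus "(\<lambda>p. f (treflect T p)) \<in> hatH21 L T"
    using f h(1)[OF _ _ xx] by (auto simp: hatH21_def)
  show "AE p\<in>Omega L T in lborel. Dt L T (\<lambda>p. f (treflect T p)) p = - Dt L T f (treflect T p)"
    "AE p\<in>Omega L T in lborel. Dxx L T (\<lambda>p. f (treflect T p)) p = Dxx L T f (treflect T p)"
    using h(2,3)[OF _ _ xx] by simp_all
qed

section \<open>Integration by parts for Lebesgue primitives\<close>

text \<open>The later arguments work slice by slice. An identity between inner integrals that holds
  for almost every slice can be integrated once both sides are measurable, which is why the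
  integrability of slices and inner integrals is recorded along with the two iterated
  integrals.\<close>

lemma Fubini_set_integral:
  fixes f :: "real \<times> real \<Rightarrow> real"
  assumes "set_integrable lborel (A \<times> B) f"
  shows "(LINT p:A \<times> B|lborel. f p) = (LINT x:A|lborel. LINT y:B|lborel. f (x, y))"
    and "(LINT p:A \<times> B|lborel. f p) = (LINT y:B|lborel. LINT x:A|lborel. f (x, y))"
    and "AE x\<in>A in lborel. set_integrable lborel B (\<lambda>y. f (x, y))"
    and "AE y\<in>B in lborel. set_integrable lborel A (\<lambda>x. f (x, y))"
    and "set_integrable lborel A (\<lambda>x. LINT y:B|lborel. f (x, y))"
    and "set_integrable lborel B (\<lambda>y. LINT x:A|lborel. f (x, y))"
proof -
  define F where "F x y = indicator A x * (indicator B y * f (x, y))" for x y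
  have F: "integrable (lborel \<Otimes>\<^sub>M lborel) (\<lambda>(x, y). F x y)"
    using assms unfolding set_integrable_def lborel_prod
    by (simp add: F_def case_prod_beta' indicator_times mult.assoc)
  have eq: "(LINT p:A \<times> B|lborel. f p) = integral\<^sup>L (lborel \<Otimes>\<^sub>M lborel) (\<lambda>(x, y). F x y)"
    unfolding lborel_prod set_lebesgue_integral_def
    by (simp add: F_def case_prod_beta' indicator_times mult.assoc)
  have F1: "(LINT y|lborel. F x y) = indicator A x *\<^sub>R (LINT y:B|lborel. f (x, y))" for x
    by (simp add: F_def set_lebesgue_integral_def)
  have F2: "(LINT x|lborel. F x y) = indicator B y *\<^sub>R (LINT x:A|lborel. f (x, y))" for y
    by (simp add: F_def set_lebesgue_integral_def mult.left_commute[of "indicator A _"])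
  show "(LINT p:A \<times> B|lborel. f p) = (LINT x:A|lborel. LINT y:B|lborel. f (x, y))"
    unfolding eq lborel_pair.integral_fst[OF F, symmetric] F1 by (simp add: set_lebesgue_integral_def)
  show "(LINT p:A \<times> B|lborel. f p) = (LINT y:B|lborel. LINT x:A|lborel. f (x, y))"
    unfolding eq lborel_pair.integral_snd[OF F, symmetric] F2 by (simp add: set_lebesgue_integral_def)
  show "AE x\<in>A in lborel. set_integrable lborel B (\<lambda>y. f (x, y))"
    using lborel_pair.AE_integrable_fst[OF F]
    by eventually_elim (auto simp: F_def set_integrable_def)
  show "AE y\<in>B in lborel. set_integrable lborel A (\<lambda>x. f (x, y))"
    using lborel_pair.AE_integrable_snd[OF F]
    by eventually_elim (auto simp: F_def set_integrable_def)
  show "set_integrable lborel A (\<lambda>x. LINT y:B|lborel. f (x, y))"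
    using lborel_pair.integrable_fst[OF F] unfolding F1 set_integrable_def .
  show "set_integrable lborel B (\<lambda>y. LINT x:A|lborel. f (x, y))"
    using lborel_pair.integrable_snd[OF F] unfolding F2 set_integrable_def .
qed

lemma set_integrable_product:
  fixes g h :: "real \<Rightarrow> real"
  assumes g: "set_integrable lborel A g" and h: "set_integrable lborel B h"
  shows "set_integrable lborel (A \<times> B) (\<lambda>p. g (fst p) * h (snd p))"
proof -
  define G where "G x = indicator A x *\<^sub>R g x" for x
  define H where "H x = indicator B x *\<^sub>R h x" for x
  have G: "integrable lborel G" and H: "integrable lborel H"
    using g h unfolding G_def H_def set_integrable_def .
  have [measurable]: "G \<in> borel_measurable borel" "H \<in> borel_measurable borel"
    using G H by auto
  have "integrable (lborel \<Otimes>\<^sub>M lborel) (\<lambda>p. G (fst p) * H (snd p))"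
    by (rule lborel_pair.Fubini_integrable)
       (use G H in \<open>auto simp: abs_mult\<close>)
  thus ?thesis unfolding set_integrable_def lborel_prod
    by (simp add: G_def H_def indicator_times mult.assoc mult.left_commute[of "g _"])
qed

lemma set_borel_measurable_continuous_closed:
  fixes f :: "real \<Rightarrow> real"
  assumes "continuous_on {a..b} f"
  shows "set_borel_measurable lborel {a<..<b} f"
  using borel_measurable_continuous_on_indicator[of "{a<..<b}" f] continuous_on_subset[OF assms, of "{a<..<b}"]
  by (simp add: set_borel_measurable_def greaterThanLessThan_subseteq_atLeastAtMost_iff)

lemma continuous_closed_bounded:
  fixes f :: "real \<Rightarrow> real"
  assumes "continuous_on {a..b} f"
  shows "\<exists>B. \<forall>t\<in>{a..b}. \<bar>f t\<bar> \<le> B"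
proof -
  have "compact (f ` {a..b})" using assms by (intro compact_continuous_image) auto
  thus ?thesis
    using compact_imp_bounded[of "f ` {a..b}"] by (auto simp: bounded_iff)
qed

lemma L2_continuous_closed:
  fixes f :: "real \<Rightarrow> real"
  assumes "continuous_on {a..b} f" shows "f \<in> L2 {a<..<b}"
proof -
  obtain B where B: "\<forall>t\<in>{a..b}. \<bar>f t\<bar> \<le> B" using continuous_closed_bounded[OF assms] by blast
  show ?thesis
    by (rule set_borel_measurable_bounded_L2[where M=B, OF set_borel_measurable_continuous_closed[OF assms] _ _ emeasure_interval])
       (use B in auto)
qed

lemma set_integrable_mult_continuous:
  fixes f g :: "real \<Rightarrow> real"
  assumes g: "set_integrable lborel {a<..<b} g" and f: "continuous_on {a..b} f"
  shows "set_integrable lborel {a<..<b} (\<lambda>t. g t * f t)"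
proof -
  obtain B where B: "\<forall>t\<in>{a..b}. \<bar>f t\<bar> \<le> B" using continuous_closed_bounded[OF f] by blast
  show ?thesis
  proof (rule set_integrable_bound_AE)
    show "set_integrable lborel {a<..<b} (\<lambda>t. \<bar>g t\<bar> * B)"
      using set_integrable_abs[OF g] by simp
    show "set_borel_measurable lborel {a<..<b} (\<lambda>t. g t * f t)"
    proof (rule set_borel_measurable_mult[OF _ set_borel_measurable_continuous_closed[OF f]])
      show "set_borel_measurable lborel {a<..<b} g"
        using g unfolding set_integrable_def set_borel_measurable_def by (rule borel_measurable_integrable)
    qed
    show "AE t\<in>{a<..<b} in lborel. \<bar>g t * f t\<bar> \<le> \<bar>g t\<bar> * B"
      using B by (auto simp: abs_mult intro!: mult_left_mono)
  qed
qed

text \<open>The open interval matches the slices of \<open>Omega\<close>, on which alone the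
  elements of \<open>L2 (Omega L T)\<close> are controlled.\<close>

definition prim :: "(real \<Rightarrow> real) \<Rightarrow> real \<Rightarrow> real" where
  "prim g t = (LINT s:{0<..<t}|lborel. g s)"

lemma prim_0 [simp]: "prim g 0 = 0"
  by (simp add: prim_def set_lebesgue_integral_def)

lemma set_integrable_Ioo_subset:
  fixes g :: "real \<Rightarrow> real"
  shows "set_integrable lborel {0<..<T} g \<Longrightarrow> r \<le> T \<Longrightarrow> set_integrable lborel {0<..<r} g"
  by (rule set_integrable_subset) auto

lemma continuous_on_prim:
  assumes g: "set_integrable lborel {0<..<T} g"
  shows "continuous_on {0..T} (prim g)"
proof -
  have "g integrable_on {0..T}"
    using set_borel_integral_eq_integral(1)[OF g] by (simp add: integrable_on_Icc_iff_Ioo)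
  hence "continuous_on {0..T} (\<lambda>t. integral {0..t} g)"
    by (rule indefinite_integral_continuous_1)
  thus ?thesis
  proof (rule continuous_on_eq)
    fix t assume "t \<in> {0..T}"
    hence "set_integrable lborel {0<..<t} g" using g set_integrable_Ioo_subset by auto
    from set_borel_integral_eq_integral(2)[OF this]
    show "integral {0..t} g = prim g t" by (simp add: prim_def integral_open_interval_real)
  qed
qed

text \<open>Moving the variable limit into an indicator leaves a fixed domain of integration. This
  prepares the use of Fubini and identifies primitives as operators with kernel
  \<open>forward_kernel\<close>.\<close>

lemma prim_kernel:
  assumes "t \<in> {0..r}"
  shows "prim h t = (LINT s:{0<..<r}|lborel. indicator {..<t} s * h s)"
  unfolding prim_def set_lebesgue_integral_def
  by (rule Bochner_Integration.integral_cong) (use assms in \<open>auto simp: indicator_def\<close>)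

text \<open>\<open>g\<close> and \<open>h\<close> are merely integrable, so the product rule is
  replaced by Fubini: the integral of g(t) h(s) over a square splits into the two triangles on
  either side of the diagonal, and each triangle is one of the two terms on the left.\<close>

lemma prim_integration_by_parts:
  assumes g: "set_integrable lborel {0<..<T} g" and h: "set_integrable lborel {0<..<T} h" and r: "r \<le> T"
  shows "prim (\<lambda>t. g t * prim h t + h t * prim g t) r = prim g r * prim h r"
proof -
  let ?I = "{0<..<r}"
  \<comment> \<open>\<open>D\<close> and \<open>E\<close> are the indicators of the two open
    triangles; their sum is 1 off the diagonal.\<close>
  define D where "D p = (if snd p < fst p then 1 else 0 :: real)" for p :: "real \<times> real"
  define E where "E p = (if fst p < snd p then 1 else 0 :: real)" for p :: "real \<times> real"
  have open1: "open {p :: real \<times> real. snd p < fst p}" "open {p :: real \<times> real. fst p < snd p}"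
    by (intro open_Collect_less continuous_intros)+
  have [measurable]: "D \<in> borel_measurable borel" "E \<in> borel_measurable borel"
  proof -
    have "D = indicator {p. snd p < fst p}" "E = indicator {p. fst p < snd p}"
      by (auto simp: D_def E_def indicator_def)
    thus "D \<in> borel_measurable borel" "E \<in> borel_measurable borel"
      using open1 by auto
  qed
  have g': "set_integrable lborel ?I g" and h': "set_integrable lborel ?I h"
    using g h r set_integrable_Ioo_subset by auto
  have gh: "set_integrable lborel (?I \<times> ?I) (\<lambda>p. g (fst p) * h (snd p))"
    by (rule set_integrable_product[OF g' h'])
  have b: "set_integrable lborel (?I \<times> ?I) (\<lambda>p. g (fst p) * h (snd p) * W p)"
    if W: "W \<in> borel_measurable borel" "\<And>p. \<bar>W p\<bar> \<le> 1" for W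
  proof (rule set_integrable_bound_AE[OF set_integrable_abs[OF gh]])
    show "set_borel_measurable lborel (?I \<times> ?I) (\<lambda>p. g (fst p) * h (snd p) * W p)"
    proof (rule set_borel_measurable_mult)
      show "set_borel_measurable lborel (?I \<times> ?I) (\<lambda>p. g (fst p) * h (snd p))"
        using gh unfolding set_integrable_def set_borel_measurable_def by (rule borel_measurable_integrable)
      have "(\<lambda>p. indicator (?I \<times> ?I) p *\<^sub>R W p) \<in> borel_measurable borel"
        using W(1) by (intro borel_measurable_scaleR borel_measurable_indicator) (auto intro!: borel_open open_Times)
      thus "set_borel_measurable lborel (?I \<times> ?I) W"
        by (simp add: set_borel_measurable_def)
    qed
    have "\<bar>g (fst p) * h (snd p) * W p\<bar> \<le> \<bar>g (fst p) * h (snd p)\<bar>" for p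
      using W(2)[of p] unfolding abs_mult[of _ "W p"] by (simp add: mult_left_le)
    thus "AE p\<in>?I \<times> ?I in lborel. \<bar>g (fst p) * h (snd p) * W p\<bar> \<le> \<bar>g (fst p) * h (snd p)\<bar>" by simp
  qed
  have D: "set_integrable lborel (?I \<times> ?I) (\<lambda>p. g (fst p) * h (snd p) * D p)"
    and E: "set_integrable lborel (?I \<times> ?I) (\<lambda>p. g (fst p) * h (snd p) * E p)"
  proof -
    have "\<bar>D p\<bar> \<le> 1" "\<bar>E p\<bar> \<le> 1" for p by (simp_all add: D_def E_def)
    thus "set_integrable lborel (?I \<times> ?I) (\<lambda>p. g (fst p) * h (snd p) * D p)"
      "set_integrable lborel (?I \<times> ?I) (\<lambda>p. g (fst p) * h (snd p) * E p)"
      using b \<open>D \<in> borel_measurable borel\<close> \<open>E \<in> borel_measurable borel\<close> by blast+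
  qed
  have pk: "c * prim f t = (LINT s:?I|lborel. c * (indicator {..<t} s * f s))" if "t \<in> ?I" for c f t
    using that by (subst prim_kernel[of t r]) auto
  have 1: "(LINT t:?I|lborel. g t * prim h t) = (LINT p:?I \<times> ?I|lborel. g (fst p) * h (snd p) * D p)"
    unfolding Fubini_set_integral(1)[OF D]
  proof (rule set_lebesgue_integral_cong)
    show "\<forall>t. t \<in> ?I \<longrightarrow> g t * prim h t = (LINT s:?I|lborel. g (fst (t, s)) * h (snd (t, s)) * D (t, s))"
    proof (intro allI impI)
      fix t assume t: "t \<in> ?I"
      show "g t * prim h t = (LINT s:?I|lborel. g (fst (t, s)) * h (snd (t, s)) * D (t, s))"
        unfolding pk[OF t] by (rule set_lebesgue_integral_cong) (auto simp: D_def)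
    qed
  qed simp
  have 2: "(LINT t:?I|lborel. h t * prim g t) = (LINT p:?I \<times> ?I|lborel. g (fst p) * h (snd p) * E p)"
    unfolding Fubini_set_integral(2)[OF E]
  proof (rule set_lebesgue_integral_cong)
    show "\<forall>t. t \<in> ?I \<longrightarrow> h t * prim g t = (LINT s:?I|lborel. g (fst (s, t)) * h (snd (s, t)) * E (s, t))"
    proof (intro allI impI)
      fix t assume t: "t \<in> ?I"
      show "h t * prim g t = (LINT s:?I|lborel. g (fst (s, t)) * h (snd (s, t)) * E (s, t))"
        unfolding pk[OF t] by (rule set_lebesgue_integral_cong) (auto simp: E_def)
    qed
  qed simp
  have "prim (\<lambda>t. g t * prim h t + h t * prim g t) r
      = (LINT t:?I|lborel. g t * prim h t) + (LINT t:?I|lborel. h t * prim g t)"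
    unfolding prim_def[of _ r]
    by (intro set_integral_add set_integrable_mult_continuous g' h' continuous_on_prim)
  also have "\<dots> = (LINT p:?I \<times> ?I|lborel. g (fst p) * h (snd p) * (D p + E p))"
    unfolding 1 2 distrib_left by (rule set_integral_add(2)[OF D E, symmetric])
  also have "\<dots> = (LINT t:?I|lborel. LINT s:?I|lborel. g t * h s * (D (t, s) + E (t, s)))"
  proof -
    have "set_integrable lborel (?I \<times> ?I) (\<lambda>p. g (fst p) * h (snd p) * (D p + E p))"
      unfolding distrib_left by (rule set_integral_add(1)[OF D E])
    from Fubini_set_integral(1)[OF this] show ?thesis by simp
  qed
  also have "\<dots> = (LINT t:?I|lborel. g t * prim h r)"
  proof (rule set_lebesgue_integral_cong)
    show "\<forall>t. t \<in> ?I \<longrightarrow> (LINT s:?I|lborel. g t * h s * (D (t, s) + E (t, s))) = g t * prim h r"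
    proof (intro allI impI)
      fix t
      have "(LINT s:?I|lborel. g t * h s * (D (t, s) + E (t, s))) = (LINT s:?I|lborel. g t * h s)"
      proof (rule set_integral_cong_AE_on)
        have hm: "set_borel_measurable lborel ?I h"
          using h' unfolding set_integrable_def set_borel_measurable_def by (rule borel_measurable_integrable)
        show "set_borel_measurable lborel ?I (\<lambda>s. g t * h s)"
          by (rule set_borel_measurable_cmult[OF hm])
        have "(\<lambda>s. D (t, s) + E (t, s)) = (\<lambda>s. if s = t then 0 else 1)"
          by (auto simp: D_def E_def)
        hence "set_borel_measurable lborel ?I (\<lambda>s. D (t, s) + E (t, s))"
          by (simp add: set_borel_measurable_def)
        thus "set_borel_measurable lborel ?I (\<lambda>s. g t * h s * (D (t, s) + E (t, s)))"
          by (intro set_borel_measurable_mult set_borel_measurable_cmult[OF hm])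
        \<comment> \<open>Each slice of the diagonal is a single point.\<close>
        show "AE s\<in>?I in lborel. g t * h s * (D (t, s) + E (t, s)) = g t * h s"
          using AE_lborel_singleton[of t] by eventually_elim (auto simp: D_def E_def)
      qed
      thus "(LINT s:?I|lborel. g t * h s * (D (t, s) + E (t, s))) = g t * prim h r"
        by (simp add: prim_def)
    qed
  qed simp
  also have "\<dots> = prim g r * prim h r" by (simp add: prim_def)
  finally show ?thesis .
qed

lemma prim_const: "0 \<le> t \<Longrightarrow> prim (\<lambda>_. c) t = c * t"
  by (simp add: prim_def set_lebesgue_integral_def)

lemma prim_cmult: "prim (\<lambda>t. c * g t) r = c * prim g r"
  by (simp add: prim_def)

lemma prim_square:
  assumes g: "set_integrable lborel {0<..<T} g" and r: "r \<le> T"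
  shows "prim (\<lambda>t. g t * prim g t) r = (prim g r)\<^sup>2 / 2"
  using prim_integration_by_parts[OF g g r] prim_cmult[of 2 "\<lambda>t. g t * prim g t" r]
  by (simp add: power2_eq_square)

lemma set_integrable_const_interval: "set_integrable lborel {a<..<b::real} (\<lambda>_. c :: real)"
  by (simp add: set_integrable_def integrable_indicator_iff emeasure_interval[unfolded infinity_ennreal_def])

text \<open>With G the primitive of \<open>g\<close> and \<rho>(t) = T + 1 - t, this is the
  integration by parts of \<rho> times (G^2/2)'. The boundary term at \<open>T\<close> has weight
  \<rho>(T) = 1, the one at 0 vanishes with G(0), and the slope -1 of \<rho> leaves half the
  integral of G^2.\<close>

lemma prim_weighted_energy:
  assumes g: "set_integrable lborel {0<..<T} g" and T: "0 \<le> T"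
  shows "prim (\<lambda>t. (T + 1 - t) * (g t * prim g t)) T = (prim g T)\<^sup>2 / 2 + prim (\<lambda>t. (prim g t)\<^sup>2) T / 2"
proof -
  let ?q = "\<lambda>t. g t * prim g t"
  have q: "set_integrable lborel {0<..<T} ?q"
    by (rule set_integrable_mult_continuous[OF g continuous_on_prim[OF g]])
  note one = set_integrable_const_interval[of 0 T 1]
  have t: "set_integrable lborel {0<..<T} (\<lambda>t. ?q t * t)"
    by (rule set_integrable_mult_continuous[OF q]) (auto intro: continuous_intros)
  have P: "set_integrable lborel {0<..<T} (\<lambda>t. (prim g t)\<^sup>2)"
    by (rule L2_square_integrable[OF L2_continuous_closed[OF continuous_on_prim[OF g]]])
  \<comment> \<open>The factor t is the primitive of the constant 1, so the weighted integral is
    again covered by integration by parts.\<close>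
  have "prim (\<lambda>t. ?q t * t + (prim g t)\<^sup>2 / 2) T = prim (\<lambda>t. ?q t * prim (\<lambda>_. 1) t + 1 * prim ?q t) T"
    unfolding prim_def[of _ T]
    by (rule set_lebesgue_integral_cong) (use prim_square[OF g] prim_const[of _ 1] in auto)
  also have "\<dots> = prim ?q T * T"
    unfolding prim_integration_by_parts[OF q one order_refl] using T by (simp add: prim_const)
  finally have 1: "prim (\<lambda>t. ?q t * t) T + prim (\<lambda>t. (prim g t)\<^sup>2) T / 2 = prim ?q T * T"
    unfolding prim_def[of _ T] using t P by (simp add: set_integral_add)
  have "prim (\<lambda>t. (T + 1 - t) * ?q t) T = prim (\<lambda>t. (T + 1) * ?q t - ?q t * t) T"
    by (simp add: algebra_simps)
  also have "\<dots> = (T + 1) * prim ?q T - prim (\<lambda>t. ?q t * t) T"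
    unfolding prim_def[of _ T] using q t by (simp add: set_integral_diff)
  finally show ?thesis using 1 prim_square[OF g order_refl] by (simp add: algebra_simps)
qed

text \<open>Integration by parts moves the weight: the integral of h (Q(T) - Q) equals that of
  \<rho> h H with H the primitive of \<open>h\<close>, and \<open>prim_weighted_energy\<close> turns
  this into squares. Applied to \<open>Dxx\<close> of the state, it fixes the sign of the elastic
  term.\<close>

lemma prim_weighted_kernel_nonneg:
  assumes h: "set_integrable lborel {0<..<T} h" and T: "0 \<le> T"
  defines "Q \<equiv> prim (\<lambda>t. (T + 1 - t) * h t)"
  shows "prim (\<lambda>t. h t * (Q T - Q t)) T \<ge> 0"
proof -
  have w: "set_integrable lborel {0<..<T} (\<lambda>t. (T + 1 - t) * h t)"
    using set_integrable_mult_continuous[OF h, of "\<lambda>t. T + 1 - t"]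
    by (simp add: mult.commute continuous_on_diff)
  have i: "set_integrable lborel {0<..<T} (\<lambda>t. h t * Q t)"
      "set_integrable lborel {0<..<T} (\<lambda>t. (T + 1 - t) * h t * prim h t)"
    unfolding Q_def by (intro set_integrable_mult_continuous h w continuous_on_prim)+
  have "prim (\<lambda>t. h t * Q t + (T + 1 - t) * h t * prim h t) T = prim h T * Q T"
    unfolding Q_def by (rule prim_integration_by_parts[OF h w order_refl])
  hence "prim (\<lambda>t. h t * Q t) T + prim (\<lambda>t. (T + 1 - t) * (h t * prim h t)) T = prim h T * Q T"
    unfolding prim_def[of _ T] set_integral_add(2)[OF i] by (simp add: mult.assoc)
  moreover have "prim (\<lambda>t. h t * (Q T - Q t)) T = prim h T * Q T - prim (\<lambda>t. h t * Q t) T"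
    unfolding prim_def[of _ T] right_diff_distrib
    by (subst set_integral_diff) (use h i in auto)
  ultimately have "prim (\<lambda>t. h t * (Q T - Q t)) T = (prim h T)\<^sup>2 / 2 + prim (\<lambda>t. (prim h t)\<^sup>2) T / 2"
    using prim_weighted_energy[OF h T] by simp
  moreover have "prim (\<lambda>t. (prim h t)\<^sup>2) T \<ge> 0"
    unfolding prim_def[of _ T] by (rule set_integral_square_nonneg)
  ultimately show ?thesis by simp
qed

lemma prim_test_fun_derivative:
  assumes b: "b \<in> test_fun {0<..<T}" and t: "0 \<le> t"
  shows "prim (\<lambda>s. frechet_derivative b (at s) 1) t = b t"
proof -
  have cont: "isCont (\<lambda>s. frechet_derivative b (at s) 1) s" for s
    using test_fun_Ck[OF test_fun_frechet_derivative[OF b], of 0]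
    by (simp add: continuous_on_eq_continuous_at)
  have "b t - b 0 = (LINT s|lborel. frechet_derivative b (at s) 1 * indicator {0..t} s)"
    using integral_FTC_Icc_real[OF t, of b "\<lambda>s. frechet_derivative b (at s) 1"] test_fun_real_derivative[OF b] cont
    by simp
  also have "b 0 = 0" by (rule test_fun_outside[OF b]) simp
  also have "(LINT s|lborel. frechet_derivative b (at s) 1 * indicator {0..t} s)
      = (LINT s:{0..t}|lborel. frechet_derivative b (at s) 1)"
    by (simp add: set_lebesgue_integral_def mult.commute)
  also have "\<dots> = prim (\<lambda>s. frechet_derivative b (at s) 1) t"
    unfolding prim_def set_lebesgue_integral_def
  proof (rule Bochner_Integration.integral_cong_AE)
    note [measurable] = test_fun_borel[OF test_fun_frechet_derivative[OF b, of 1]]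
    show "(\<lambda>s. indicator {0..t} s *\<^sub>R frechet_derivative b (at s) 1) \<in> borel_measurable lborel"
      "(\<lambda>s. indicator {0<..<t} s *\<^sub>R frechet_derivative b (at s) 1) \<in> borel_measurable lborel"
      by measurable
    show "AE s in lborel. indicator {0..t} s *\<^sub>R frechet_derivative b (at s) 1
        = indicator {0<..<t} s *\<^sub>R frechet_derivative b (at s) 1"
      using AE_lborel_singleton[of 0] AE_lborel_singleton[of t]
      by eventually_elim (auto simp: indicator_def)
  qed
  finally show ?thesis by simp
qed

text \<open>A test function is the primitive of its own derivative, so integration by parts applies,
  and its value 0 at \<open>T\<close> kills the boundary term.\<close>

lemma prim_by_parts_test_fun:
  assumes g: "set_integrable lborel {0<..<T} g" and b: "b \<in> test_fun {0<..<T}" and T: "0 \<le> T"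
  shows "(LINT t:{0<..<T}|lborel. prim g t * frechet_derivative b (at t) 1)
    = - (LINT t:{0<..<T}|lborel. g t * b t)"
proof -
  define b' where "b' t = frechet_derivative b (at t) 1" for t
  have bt: "b' \<in> test_fun {0<..<T}" unfolding b'_def by (rule test_fun_frechet_derivative[OF b])
  have b': "set_integrable lborel {0<..<T} b'"
    using integrable_mult_indicator[OF _ test_fun_integrable[OF bt]] by (simp add: set_integrable_def)
  have pb: "t \<in> {0..T} \<Longrightarrow> prim b' t = b t" for t
    unfolding b'_def using prim_test_fun_derivative[OF b] by simp
  have i: "set_integrable lborel {0<..<T} (\<lambda>t. g t * prim b' t)" "set_integrable lborel {0<..<T} (\<lambda>t. b' t * prim g t)"
    by (intro set_integrable_mult_continuous g b' continuous_on_prim)+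
  have "prim (\<lambda>t. g t * prim b' t + b' t * prim g t) T = prim g T * prim b' T"
    by (rule prim_integration_by_parts[OF g b' order_refl])
  also have "prim b' T = 0" using pb[of T] test_fun_outside[OF b, of T] T by simp
  finally have "(LINT t:{0<..<T}|lborel. g t * prim b' t) + (LINT t:{0<..<T}|lborel. b' t * prim g t) = 0"
    unfolding prim_def[of _ T] set_integral_add(2)[OF i] by simp
  moreover have "(LINT t:{0<..<T}|lborel. g t * prim b' t) = (LINT t:{0<..<T}|lborel. g t * b t)"
    by (rule set_lebesgue_integral_cong) (use pb in auto)
  ultimately show ?thesis unfolding b'_def by (simp add: mult.commute)
qed

section \<open>Volterra operators in time\<close>

lemma set_integrable_measurable: "set_integrable M S f \<Longrightarrow> set_borel_measurable M S f"
  unfolding set_integrable_def set_borel_measurable_def by (rule borel_measurable_integrable)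

lemma set_integrable_bounded_mult:
  fixes f k :: "'a \<Rightarrow> real"
  assumes "set_integrable M S f" "set_borel_measurable M S k" "\<And>p. p \<in> S \<Longrightarrow> \<bar>k p\<bar> \<le> B"
  shows "set_integrable M S (\<lambda>p. k p * f p)"
proof (rule set_integrable_bound_AE)
  show "set_integrable M S (\<lambda>p. B * \<bar>f p\<bar>)"
    using set_integrable_abs[OF assms(1)] by simp
  show "set_borel_measurable M S (\<lambda>p. k p * f p)"
    by (intro set_borel_measurable_mult assms(2) set_integrable_measurable[OF assms(1)])
  show "AE p\<in>S in M. \<bar>k p * f p\<bar> \<le> B * \<bar>f p\<bar>"
    using assms(3) by (auto simp: abs_mult intro!: mult_right_mono)
qed

lemma set_borel_measurable_slice:
  assumes "set_borel_measurable lborel (Omega L T) f" "x \<in> {0<..<L}"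
  shows "set_borel_measurable lborel {0<..<T} (\<lambda>t. f (x, t))"
proof -
  have "(\<lambda>p. indicator (Omega L T) p *\<^sub>R f p) \<in> borel_measurable borel"
    using assms(1) by (simp add: set_borel_measurable_def)
  moreover have "(\<lambda>t. (x, t)) \<in> borel_measurable borel"
    by (intro borel_measurable_continuous_onI continuous_intros)
  ultimately have "(\<lambda>t. indicator (Omega L T) (x, t) *\<^sub>R f (x, t)) \<in> borel_measurable borel"
    by (rule measurable_compose[rotated])
  thus ?thesis using assms(2) by (simp add: set_borel_measurable_def Omega_def indicator_times)
qed

lemma set_borel_measurable_projection:
  fixes h :: "real \<Rightarrow> real" and \<pi> :: "real \<times> real \<Rightarrow> real"
  assumes h: "set_borel_measurable lborel A h" and \<pi>: "continuous_on UNIV \<pi>" "\<And>p. p \<in> Omega L T \<Longrightarrow> \<pi> p \<in> A"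
  shows "set_borel_measurable lborel (Omega L T) (\<lambda>p. h (\<pi> p))"
proof -
  have h: "(\<lambda>x. indicator A x *\<^sub>R h x) \<in> borel_measurable borel"
    using h by (simp add: set_borel_measurable_def)
  from measurable_compose[OF borel_measurable_continuous_onI[OF \<pi>(1)] h]
  have "(\<lambda>p. indicator (Omega L T) p * (indicator A (\<pi> p) *\<^sub>R h (\<pi> p))) \<in> borel_measurable borel"
    by (intro borel_measurable_times) auto
  moreover have "(\<lambda>p. indicator (Omega L T) p * (indicator A (\<pi> p) *\<^sub>R h (\<pi> p)))
      = (\<lambda>p. indicator (Omega L T) p *\<^sub>R h (\<pi> p))"
    using \<pi>(2) by (auto simp: indicator_def)
  ultimately show ?thesis by (simp add: set_borel_measurable_def)
qed

lemma set_borel_measurable_fst: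
  fixes h :: "real \<Rightarrow> real"
  shows "set_borel_measurable lborel {0<..<L} h \<Longrightarrow> set_borel_measurable lborel (Omega L T) (\<lambda>p. h (fst p))"
  by (rule set_borel_measurable_projection) (auto simp: Omega_def intro: continuous_on_fst)

lemma set_borel_measurable_snd:
  fixes h :: "real \<Rightarrow> real"
  shows "set_borel_measurable lborel {0<..<T} h \<Longrightarrow> set_borel_measurable lborel (Omega L T) (\<lambda>p. h (snd p))"
  by (rule set_borel_measurable_projection) (auto simp: Omega_def intro: continuous_on_snd)

lemma AE_fst_Omega:
  assumes "AE x\<in>{0<..<L} in lborel. P x"
  shows "AE p\<in>Omega L T in lborel. P (fst p)"
proof -
  obtain N where N: "{x. \<not> (x \<in> {0<..<L} \<longrightarrow> P x)} \<subseteq> N" "N \<in> null_sets lborel"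
  proof (rule AE_E[OF assms])
    fix N assume "{x \<in> space lborel. \<not> (x \<in> {0<..<L} \<longrightarrow> P x)} \<subseteq> N"
      "emeasure lborel N = 0" "N \<in> sets lborel"
    thus thesis using that[of N] by (simp add: null_setsI)
  qed
  have "N \<times> UNIV \<in> null_sets (lborel \<Otimes>\<^sub>M lborel)"
    using N(2) by (intro lborel.times_in_null_sets1) auto
  hence "AE p in lborel. p \<notin> N \<times> (UNIV :: real set)"
    unfolding lborel_prod by (rule AE_not_in)
  thus ?thesis
    by eventually_elim (use N(1) in \<open>force simp: Omega_def\<close>)
qed

lemma test_fun_set_measurable:
  "\<phi> \<in> test_fun S' \<Longrightarrow> S \<in> sets borel \<Longrightarrow> set_borel_measurable lborel S \<phi>"
  unfolding set_borel_measurable_def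
  by (intro borel_measurable_scaleR borel_measurable_indicator) (simp_all add: test_fun_borel)

lemma test_fun_fst_L2:
  "a \<in> test_fun {0<..<L} \<Longrightarrow> (\<lambda>p. a (fst p)) \<in> L2 (Omega L T)"
proof -
  assume a: "a \<in> test_fun {0<..<L}"
  obtain B where B: "\<bar>a p\<bar> \<le> B" for p using test_fun_bounded[OF a] by metis
  show ?thesis
    by (rule set_borel_measurable_bounded_L2[where M=B, OF _ _ _ emeasure_Omega])
      (use B in \<open>auto intro!: set_borel_measurable_fst test_fun_set_measurable[OF a]\<close>)
qed

lemma L2_slice:
  assumes f: "f \<in> L2 (Omega L T)"
  shows "AE x\<in>{0<..<L} in lborel. (\<lambda>t. f (x, t)) \<in> L2 {0<..<T}"
    and "set_integrable lborel {0<..<L} (\<lambda>x. LINT t:{0<..<T}|lborel. (f (x, t))\<^sup>2)"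
    and "(LINT x:{0<..<L}|lborel. LINT t:{0<..<T}|lborel. (f (x, t))\<^sup>2) = (L2_norm (Omega L T) f)\<^sup>2"
proof -
  have i: "set_integrable lborel ({0<..<L} \<times> {0<..<T}) (\<lambda>p. (f p)\<^sup>2)"
    using L2_square_integrable[OF f] by (simp add: Omega_def)
  show "AE x\<in>{0<..<L} in lborel. (\<lambda>t. f (x, t)) \<in> L2 {0<..<T}"
    using Fubini_set_integral(3)[OF i]
    by eventually_elim (auto simp: L2_def set_borel_measurable_slice[OF L2_measurable[OF f]])
  show "set_integrable lborel {0<..<L} (\<lambda>x. LINT t:{0<..<T}|lborel. (f (x, t))\<^sup>2)"
    by (rule Fubini_set_integral(5)[OF i])
  show "(LINT x:{0<..<L}|lborel. LINT t:{0<..<T}|lborel. (f (x, t))\<^sup>2) = (L2_norm (Omega L T) f)\<^sup>2"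
    using Fubini_set_integral(1)[OF i] by (simp add: L2_norm_power2 Omega_def)
qed

text \<open>The integral always runs over the whole time interval, and the range of integration
  proper is encoded in \<open>K\<close>. Primitives from 0 and the backward multiplier thus share
  one treatment of measurability, norms and spatial derivatives.\<close>

definition volterra :: "real \<Rightarrow> (real \<Rightarrow> real \<Rightarrow> real) \<Rightarrow> (real \<times> real \<Rightarrow> real) \<Rightarrow> real \<times> real \<Rightarrow> real" where
  "volterra T K f p = (LINT s:{0<..<T}|lborel. K (snd p) s * f (fst p, s))"

text \<open>The bound is required for every real t, so the operator can be evaluated at the end
  times 0 and \<open>T\<close> too, where traces are taken.\<close>

definition bounded_kernel :: "real \<Rightarrow> (real \<Rightarrow> real \<Rightarrow> real) \<Rightarrow> real \<Rightarrow> bool" where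
  "bounded_kernel T K M \<longleftrightarrow> (\<lambda>q. K (fst q) (snd q)) \<in> borel_measurable borel \<and>
     (\<forall>t. \<forall>s\<in>{0<..<T}. \<bar>K t s\<bar> \<le> M) \<and> 0 \<le> M"

lemma bounded_kernel_slice:
  assumes "bounded_kernel T K M"
  shows "set_borel_measurable lborel {0<..<T} (K t)"
proof -
  have "(\<lambda>q. K (fst q) (snd q)) \<in> borel_measurable borel" using assms by (simp add: bounded_kernel_def)
  moreover have "(\<lambda>s. (t, s)) \<in> borel_measurable borel"
    by (intro borel_measurable_continuous_onI continuous_intros)
  ultimately have "(\<lambda>s. K (fst (t, s)) (snd (t, s))) \<in> borel_measurable borel"
    by (rule measurable_compose[rotated])
  thus ?thesis by (simp add: set_borel_measurable_def)
qed

lemma bounded_kernel_L2: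
  assumes K: "bounded_kernel T K M" and T: "0 \<le> T"
  shows "K t \<in> L2 {0<..<T}" "(L2_norm {0<..<T} (K t))\<^sup>2 \<le> M\<^sup>2 * T"
proof -
  have b: "\<bar>K t s\<bar> \<le> M" if "s \<in> {0<..<T}" for s using K that by (simp add: bounded_kernel_def)
  show L2: "K t \<in> L2 {0<..<T}"
    by (rule set_borel_measurable_bounded_L2[where M=M, OF bounded_kernel_slice[OF K] _ _ emeasure_interval])
      (use b in auto)
  have "(L2_norm {0<..<T} (K t))\<^sup>2 \<le> (LINT s:{0<..<T}|lborel. M\<^sup>2)"
    unfolding L2_norm_power2
  proof (rule set_integral_mono)
    show "set_integrable lborel {0<..<T} (\<lambda>s. (K t s)\<^sup>2)" by (rule L2_square_integrable[OF L2])
    show "set_integrable lborel {0<..<T} (\<lambda>s. M\<^sup>2)"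
      by (rule set_integrable_const_interval)
    show "(K t s)\<^sup>2 \<le> M\<^sup>2" if "s \<in> {0<..<T}" for s
      using power_mono[OF b[OF that], of 2] by simp
  qed
  also have "\<dots> = M\<^sup>2 * T" using prim_const[OF T, of "M\<^sup>2"] by (simp add: prim_def)
  finally show "(L2_norm {0<..<T} (K t))\<^sup>2 \<le> M\<^sup>2 * T" .
qed

lemma volterra_pointwise_bound:
  assumes K: "bounded_kernel T K M" and T: "0 \<le> T" and f: "(\<lambda>s. f (x, s)) \<in> L2 {0<..<T}"
  shows "(volterra T K f (x, t))\<^sup>2 \<le> M\<^sup>2 * T * (LINT s:{0<..<T}|lborel. (f (x, s))\<^sup>2)"
proof -
  have "\<bar>volterra T K f (x, t)\<bar>\<^sup>2 \<le> (L2_norm {0<..<T} (K t) * L2_norm {0<..<T} (\<lambda>s. f (x, s)))\<^sup>2"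
    using Cauchy_Schwarz_L2[OF bounded_kernel_L2(1)[OF K T] f, of t]
    by (intro power_mono) (simp_all add: volterra_def)
  also have "\<dots> \<le> M\<^sup>2 * T * (L2_norm {0<..<T} (\<lambda>s. f (x, s)))\<^sup>2"
    unfolding power_mult_distrib by (intro mult_right_mono bounded_kernel_L2[OF K T]) simp
  finally show ?thesis by (simp add: L2_norm_power2)
qed

text \<open>\<open>f\<close> is known to be Borel on \<open>Omega\<close> only, so it is cut off by
  the indicator before the parametrised integral is formed; over spatial points inside the interval
  the cut-off changes nothing.\<close>

lemma volterra_measurable:
  assumes K: "bounded_kernel T K M" and f: "f \<in> L2 (Omega L T)"
  shows "\<exists>W \<in> borel_measurable borel. \<forall>p. fst p \<in> {0<..<L} \<longrightarrow> volterra T K f p = W p"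
proof -
  define W where "W p = (LINT s|lborel. K (snd p) s * (indicator (Omega L T) (fst p, s) * f (fst p, s)))"
    for p :: "real \<times> real"
  have f': "(\<lambda>p. indicator (Omega L T) p * f p) \<in> borel_measurable borel"
    using L2_measurable[OF f] by (simp add: set_borel_measurable_def)
  have K': "(\<lambda>q. K (fst q) (snd q)) \<in> borel_measurable borel"
    using K by (simp add: bounded_kernel_def)
  have c1: "(\<lambda>q::(real\<times>real)\<times>real. (fst (fst q), snd q)) \<in> borel_measurable borel"
    and c2: "(\<lambda>q::(real\<times>real)\<times>real. (snd (fst q), snd q)) \<in> borel_measurable borel"
    by (intro borel_measurable_continuous_onI continuous_intros)+
  have "(\<lambda>q::(real\<times>real)\<times>real. K (snd (fst q)) (snd q) * (indicator (Omega L T) (fst (fst q), snd q) * f (fst (fst q), snd q)))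
      \<in> borel_measurable borel"
    using borel_measurable_times[OF measurable_compose[OF c2 K'] measurable_compose[OF c1 f']] by simp
  hence "(\<lambda>(p, s). K (snd p) s * (indicator (Omega L T) (fst p, s) * f (fst p, s)))
      \<in> borel_measurable (borel \<Otimes>\<^sub>M lborel)"
    by (simp add: case_prod_beta' borel_prod[symmetric] cong: measurable_cong_sets)
  hence "W \<in> borel_measurable borel"
    unfolding W_def by (rule lborel.borel_measurable_lebesgue_integral)
  moreover have "volterra T K f p = W p" if "fst p \<in> {0<..<L}" for p
    unfolding volterra_def W_def set_lebesgue_integral_def
    by (rule Bochner_Integration.integral_cong) (use that in \<open>auto simp: Omega_def indicator_def\<close>)
  ultimately show ?thesis by blast
qed

text \<open>The pointwise bound does not depend on t, hence it integrates over x at one fixed time.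
  At time 0 this controls the trace of the multiplier that is paired with the initial
  velocity.\<close>

lemma volterra_L2_slice:
  assumes K: "bounded_kernel T K M" and T: "0 \<le> T" and f: "f \<in> L2 (Omega L T)"
  shows "(\<lambda>x. volterra T K f (x, t)) \<in> L2 {0<..<L}"
    and "(L2_norm {0<..<L} (\<lambda>x. volterra T K f (x, t)))\<^sup>2 \<le> M\<^sup>2 * T * (L2_norm (Omega L T) f)\<^sup>2"
proof -
  obtain W where W: "W \<in> borel_measurable borel" "\<And>p. fst p \<in> {0<..<L} \<Longrightarrow> volterra T K f p = W p"
    using volterra_measurable[OF K f] by blast
  have W': "(\<lambda>x. W (x, t)) \<in> borel_measurable borel"
    by (rule measurable_compose[OF _ W(1)]) (intro borel_measurable_continuous_onI continuous_intros)
  have "(\<lambda>x. indicator {0<..<L} x *\<^sub>R volterra T K f (x, t)) = (\<lambda>x. indicator {0<..<L} x *\<^sub>R W (x, t))"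
    using W(2) by (auto simp: indicator_def)
  hence m: "set_borel_measurable lborel {0<..<L} (\<lambda>x. volterra T K f (x, t))"
    using W' by (simp add: set_borel_measurable_def)
  let ?q = "\<lambda>x. M\<^sup>2 * T * (LINT s:{0<..<T}|lborel. (f (x, s))\<^sup>2)"
  have q: "set_integrable lborel {0<..<L} ?q"
    by (intro set_integrable_mult_right L2_slice(2)[OF f])
  have b: "AE x\<in>{0<..<L} in lborel. (volterra T K f (x, t))\<^sup>2 \<le> ?q x"
    using L2_slice(1)[OF f] by eventually_elim (auto intro: volterra_pointwise_bound[OF K T])
  have i: "set_integrable lborel {0<..<L} (\<lambda>x. (volterra T K f (x, t))\<^sup>2)"
    using set_borel_measurable_mult[OF m m] b
    by (intro set_integrable_bound_AE[OF q]) (simp_all add: power2_eq_square)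
  thus L2: "(\<lambda>x. volterra T K f (x, t)) \<in> L2 {0<..<L}" using m by (simp add: L2_def)
  have "(L2_norm {0<..<L} (\<lambda>x. volterra T K f (x, t)))\<^sup>2 \<le> (LINT x:{0<..<L}|lborel. ?q x)"
    unfolding L2_norm_power2 using b by (intro set_integral_mono_AE i q) (auto elim: eventually_mono)
  also have "\<dots> = M\<^sup>2 * T * (L2_norm (Omega L T) f)\<^sup>2"
    using L2_slice(3)[OF f] by simp
  finally show "(L2_norm {0<..<L} (\<lambda>x. volterra T K f (x, t)))\<^sup>2 \<le> M\<^sup>2 * T * (L2_norm (Omega L T) f)\<^sup>2" .
qed

lemma volterra_L2:
  assumes K: "bounded_kernel T K M" and T: "0 \<le> T" and f: "f \<in> L2 (Omega L T)"
  shows "volterra T K f \<in> L2 (Omega L T)"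
    and "(L2_norm (Omega L T) (volterra T K f))\<^sup>2 \<le> M\<^sup>2 * T\<^sup>2 * (L2_norm (Omega L T) f)\<^sup>2"
proof -
  obtain W where W: "W \<in> borel_measurable borel" "\<And>p. fst p \<in> {0<..<L} \<Longrightarrow> volterra T K f p = W p"
    using volterra_measurable[OF K f] by blast
  have "(\<lambda>p. indicator (Omega L T) p *\<^sub>R volterra T K f p) = (\<lambda>p. indicator (Omega L T) p *\<^sub>R W p)"
    using W(2) by (auto simp: indicator_def Omega_def)
  hence m: "set_borel_measurable lborel (Omega L T) (volterra T K f)"
    using W(1) by (simp add: set_borel_measurable_def)
  let ?q = "\<lambda>x. M\<^sup>2 * T * (LINT s:{0<..<T}|lborel. (f (x, s))\<^sup>2)"
  note one = set_integrable_const_interval[of 0 T 1]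
  have q: "set_integrable lborel (Omega L T) (\<lambda>p. ?q (fst p) * 1)"
    unfolding Omega_def
    by (rule set_integrable_product[OF _ one]) (intro set_integrable_mult_right L2_slice(2)[OF f])
  have b: "AE p\<in>Omega L T in lborel. (volterra T K f p)\<^sup>2 \<le> ?q (fst p) * 1"
    using AE_fst_Omega[OF L2_slice(1)[OF f], of T]
  proof eventually_elim
    case (elim p)
    show ?case
    proof
      assume "p \<in> Omega L T"
      with elim have "(\<lambda>t. f (fst p, t)) \<in> L2 {0<..<T}" by blast
      from volterra_pointwise_bound[OF K T this, of "snd p"]
      show "(volterra T K f p)\<^sup>2 \<le> ?q (fst p) * 1" by simp
    qed
  qed
  have i: "set_integrable lborel (Omega L T) (\<lambda>p. (volterra T K f p)\<^sup>2)"
    using set_borel_measurable_mult[OF m m] b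
    by (intro set_integrable_bound_AE[OF q]) (simp_all add: power2_eq_square)
  thus "volterra T K f \<in> L2 (Omega L T)" using m by (simp add: L2_def)
  have "(L2_norm (Omega L T) (volterra T K f))\<^sup>2 \<le> (LINT p:Omega L T|lborel. ?q (fst p) * 1)"
    unfolding L2_norm_power2 using b by (intro set_integral_mono_AE i q) (auto elim: eventually_mono)
  also have "\<dots> = (LINT x:{0<..<L}|lborel. LINT t:{0<..<T}|lborel. ?q x)"
    using Fubini_set_integral(1)[OF q[unfolded Omega_def]] by (simp add: Omega_def)
  also have "\<dots> = (LINT x:{0<..<L}|lborel. ?q x * T)"
    using prim_const[OF T] by (simp add: prim_def)
  also have "\<dots> = M\<^sup>2 * T\<^sup>2 * (L2_norm (Omega L T) f)\<^sup>2"
    using L2_slice(3)[OF f] by (simp add: power2_eq_square)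
  finally show "(L2_norm (Omega L T) (volterra T K f))\<^sup>2 \<le> M\<^sup>2 * T\<^sup>2 * (L2_norm (Omega L T) f)\<^sup>2" .
qed

text \<open>Testing with a(x) b(t) and letting \<open>b\<close> vary separates the times, by the
  fundamental lemma in t. The exceptional null set of times may depend on \<open>a\<close>.\<close>

lemma weak_x_deriv_slice:
  assumes w: "has_weak_deriv (Omega L T) (1, 0) f g" and L2: "f \<in> L2 (Omega L T)" "g \<in> L2 (Omega L T)"
    and a: "a \<in> test_fun {0<..<L}"
  defines "h \<equiv> \<lambda>p. f p * frechet_derivative a (at (fst p)) 1 + g p * a (fst p)"
  shows "AE t\<in>{0<..<T} in lborel. (LINT x:{0<..<L}|lborel. h (x, t)) = 0"
    and "set_integrable lborel (Omega L T) h"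
proof -
  let ?da = "\<lambda>x. frechet_derivative a (at x) 1"
  have da: "?da \<in> test_fun {0<..<L}" by (rule test_fun_frechet_derivative[OF a])
  show h: "set_integrable lborel (Omega L T) h"
    unfolding h_def by (intro set_integral_add L2_mult_integrable L2 test_fun_fst_L2[OF da] test_fun_fst_L2[OF a])
  show "AE t\<in>{0<..<T} in lborel. (LINT x:{0<..<L}|lborel. h (x, t)) = 0"
  proof (rule fundamental_lemma_interval)
    show "set_integrable lborel {0<..<T} (\<lambda>t. LINT x:{0<..<L}|lborel. h (x, t))"
      by (rule Fubini_set_integral(6)[OF h[unfolded Omega_def]])
    fix b :: "real \<Rightarrow> real" assume b: "b \<in> test_fun {0<..<T}"
    let ?ab = "\<lambda>p. a (fst p) * b (snd p)"
    have ab: "?ab \<in> test_fun (Omega L T)"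
      unfolding Omega_def by (rule test_fun_product(1)[OF a b])
    obtain B where B: "\<bar>b p\<bar> \<le> B" for p using test_fun_bounded[OF b] by metis
    have hb: "set_integrable lborel (Omega L T) (\<lambda>p. b (snd p) * h p)"
      by (rule set_integrable_bounded_mult[OF h set_borel_measurable_snd[OF test_fun_set_measurable[OF b]] B]) simp
    have "(LINT t:{0<..<T}|lborel. (LINT x:{0<..<L}|lborel. h (x, t)) * b t) = (LINT p:Omega L T|lborel. b (snd p) * h p)"
      using Fubini_set_integral(2)[OF hb[unfolded Omega_def]] by (simp add: Omega_def mult.commute)
    also have "\<dots> = (LINT p:Omega L T|lborel. f p * frechet_derivative ?ab (at p) (1, 0) + g p * ?ab p)"
      unfolding test_fun_product(2)[OF a b] h_def by (simp add: algebra_simps)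
    also have "\<dots> = (LINT p:Omega L T|lborel. f p * frechet_derivative ?ab (at p) (1, 0)) + (LINT p:Omega L T|lborel. g p * ?ab p)"
      by (intro set_integral_add L2_mult_integrable L2 test_fun_Omega_L2[OF ab] test_fun_deriv_Omega_L2[OF ab])
    also have "\<dots> = 0" using w ab by (simp add: has_weak_deriv_def)
    finally show "(LINT t:{0<..<T}|lborel. (LINT x:{0<..<L}|lborel. h (x, t)) * b t) = 0" .
  qed
qed

text \<open>An integral operator in time commutes with the weak derivative in x because the two
  integrations can be interchanged. This is what makes the multiplier admissible without further
  regularity of \<open>u\<close>.\<close>

lemma volterra_weak_x_deriv:
  assumes w: "has_weak_deriv (Omega L T) (1, 0) f g" and L2: "f \<in> L2 (Omega L T)" "g \<in> L2 (Omega L T)"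
    and K: "bounded_kernel T K M" and T: "0 \<le> T"
  shows "has_weak_deriv (Omega L T) (1, 0) (volterra T K f) (volterra T K g)"
  unfolding has_weak_deriv_def
proof
  fix \<phi> assume \<phi>: "\<phi> \<in> test_fun (Omega L T)"
  let ?d\<phi> = "\<lambda>p. frechet_derivative \<phi> (at p) (1, 0)"
  note V = volterra_L2(1)[OF K T L2(1)] volterra_L2(1)[OF K T L2(2)]
  have i: "set_integrable lborel (Omega L T) (\<lambda>p. volterra T K f p * ?d\<phi> p)"
     "set_integrable lborel (Omega L T) (\<lambda>p. volterra T K g p * \<phi> p)"
    by (intro L2_mult_integrable V test_fun_Omega_L2[OF \<phi>] test_fun_deriv_Omega_L2[OF \<phi>])+
  let ?\<Phi> = "\<lambda>p. volterra T K f p * ?d\<phi> p + volterra T K g p * \<phi> p"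
  have \<Phi>: "set_integrable lborel (Omega L T) ?\<Phi>" by (rule set_integral_add(1)[OF i])
  have inner: "(LINT x:{0<..<L}|lborel. ?\<Phi> (x, t)) = 0" if t: "t \<in> {0<..<T}" for t
  proof -
    \<comment> \<open>Freezing t turns \<phi> into a test function of x alone and \<open>K t\<close>
      into a function of s alone; after the interchange of integrals the slice identity for
      \<open>a\<close> applies at almost every s.\<close>
    define a where "a x = \<phi> (x, t)" for x
    have a: "a \<in> test_fun {0<..<L}"
      using test_fun_slice(1)[of \<phi> "{0<..<L}" "{0<..<T}" t] \<phi> unfolding a_def Omega_def by blast
    let ?da = "\<lambda>x. frechet_derivative a (at x) 1"
    have da: "?da x = ?d\<phi> (x, t)" for x
      using test_fun_slice(3)[of \<phi> "{0<..<L}" "{0<..<T}" t x] \<phi> unfolding a_def Omega_def by blast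
    have dat: "?da \<in> test_fun {0<..<L}" by (rule test_fun_frechet_derivative[OF a])
    define h where "h p = f p * ?da (fst p) + g p * a (fst p)" for p
    have h0: "AE t\<in>{0<..<T} in lborel. (LINT x:{0<..<L}|lborel. h (x, t)) = 0"
      and hi: "set_integrable lborel (Omega L T) h"
      using weak_x_deriv_slice[OF w L2 a] unfolding h_def by blast+
    have Kb: "\<And>s. s \<in> {0<..<T} \<Longrightarrow> \<bar>K t s\<bar> \<le> M" using K by (simp add: bounded_kernel_def)
    have Kh: "set_integrable lborel (Omega L T) (\<lambda>p. K t (snd p) * h p)"
      by (rule set_integrable_bounded_mult[where B=M, OF hi set_borel_measurable_snd[OF bounded_kernel_slice[OF K]]])
        (auto simp: Omega_def Kb)
    note KhF = Fubini_set_integral[OF Kh[unfolded Omega_def]]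
    have "(LINT x:{0<..<L}|lborel. ?\<Phi> (x, t)) = (LINT x:{0<..<L}|lborel. LINT s:{0<..<T}|lborel. K t s * h (x, s))"
    proof (rule set_integral_cong_AE_on)
      show "set_borel_measurable lborel {0<..<L} (\<lambda>x. ?\<Phi> (x, t))"
        unfolding da[symmetric] a_def[symmetric]
        by (intro set_borel_measurable_add set_borel_measurable_mult L2_measurable volterra_L2_slice[OF K T] L2
            test_fun_set_measurable[OF a] test_fun_set_measurable[OF dat]) auto
      show "set_borel_measurable lborel {0<..<L} (\<lambda>x. LINT s:{0<..<T}|lborel. K t s * h (x, s))"
        using set_integrable_measurable[OF KhF(5)] by simp
      show "AE x\<in>{0<..<L} in lborel. ?\<Phi> (x, t) = (LINT s:{0<..<T}|lborel. K t s * h (x, s))"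
        using L2_slice(1)[OF L2(1)] L2_slice(1)[OF L2(2)]
      proof eventually_elim
        case (elim x)
        show ?case
        proof
          assume x: "x \<in> {0<..<L}"
          note Ki = L2_mult_integrable[OF bounded_kernel_L2(1)[OF K T, of t]]
          have fi: "set_integrable lborel {0<..<T} (\<lambda>s. K t s * f (x, s))"
            and gi: "set_integrable lborel {0<..<T} (\<lambda>s. K t s * g (x, s))"
            using elim x by (auto intro!: Ki)
          have "(LINT s:{0<..<T}|lborel. K t s * h (x, s))
            = (LINT s:{0<..<T}|lborel. (K t s * f (x, s)) * ?da x + (K t s * g (x, s)) * a x)"
            by (simp add: h_def algebra_simps)
          also have "\<dots> = (LINT s:{0<..<T}|lborel. (K t s * f (x, s)) * ?da x)
              + (LINT s:{0<..<T}|lborel. (K t s * g (x, s)) * a x)"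
            by (rule set_integral_add) (use fi gi in auto)
          also have "\<dots> = volterra T K f (x, t) * ?da x + volterra T K g (x, t) * a x"
            by (simp add: volterra_def)
          finally show "?\<Phi> (x, t) = (LINT s:{0<..<T}|lborel. K t s * h (x, s))"
            unfolding da a_def by simp
        qed
      qed
    qed
    also have "\<dots> = (LINT s:{0<..<T}|lborel. LINT x:{0<..<L}|lborel. K t s * h (x, s))"
      using KhF(1,2) by simp
    also have "\<dots> = (LINT s:{0<..<T}|lborel. 0)"
    proof (rule set_integral_cong_AE_on)
      show "set_borel_measurable lborel {0<..<T} (\<lambda>s. LINT x:{0<..<L}|lborel. K t s * h (x, s))"
        using set_integrable_measurable[OF KhF(6)] by simp
      \<comment> \<open>The null set of times in \<open>h0\<close> depends on \<open>a\<close> and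
        so on t, which is harmless while t is fixed.\<close>
      show "AE s\<in>{0<..<T} in lborel. (LINT x:{0<..<L}|lborel. K t s * h (x, s)) = 0"
        using h0 by eventually_elim auto
    qed (simp add: set_borel_measurable_def)
    finally show ?thesis by simp
  qed
  have "(LINT p:Omega L T|lborel. ?\<Phi> p) = (LINT t:{0<..<T}|lborel. LINT x:{0<..<L}|lborel. ?\<Phi> (x, t))"
    unfolding Omega_def by (rule Fubini_set_integral(2)) (use \<Phi> in \<open>simp add: Omega_def\<close>)
  also have "\<dots> = (LINT t:{0<..<T}|lborel. 0)"
    by (rule set_lebesgue_integral_cong) (use inner in auto)
  finally show "(LINT p:Omega L T|lborel. volterra T K f p * ?d\<phi> p) = - (LINT p:Omega L T|lborel. volterra T K g p * \<phi> p)"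
    unfolding set_integral_add(2)[OF i] by simp
qed

lemma set_integral_neg: "(LINT p:S|M. - f p :: real) = - (LINT p:S|M. f p)"
  by (simp add: set_lebesgue_integral_def)

text \<open>The offset \<open>C\<close> is constant on each slice and disappears because the
  derivative of a test function has zero mean. It is 0 for forward primitives and the full integral
  with a minus sign for backward ones.\<close>

lemma has_weak_deriv_time_primitive:
  assumes f: "f \<in> L2 (Omega L T)" and g: "g \<in> L2 (Omega L T)" and T: "0 \<le> T"
    and prim: "AE x\<in>{0<..<L} in lborel. \<forall>t\<in>{0<..<T}. f (x, t) = C x + prim (\<lambda>s. g (x, s)) t"
  shows "has_weak_deriv (Omega L T) (0, 1) f g"
  unfolding has_weak_deriv_def
proof
  fix \<phi> assume \<phi>: "\<phi> \<in> test_fun (Omega L T)"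
  let ?d\<phi> = "\<lambda>p. frechet_derivative \<phi> (at p) (0, 1)"
  have i: "set_integrable lborel (Omega L T) (\<lambda>p. f p * ?d\<phi> p)" "set_integrable lborel (Omega L T) (\<lambda>p. - (g p * \<phi> p))"
    using L2_mult_integrable[OF f test_fun_deriv_Omega_L2[OF \<phi>]]
      set_integrable_mult_right[of "- 1", OF _] L2_mult_integrable[OF L2_minus[OF g] test_fun_Omega_L2[OF \<phi>]] by simp_all
  note F = Fubini_set_integral[OF i(1)[unfolded Omega_def]] and G = Fubini_set_integral[OF i(2)[unfolded Omega_def]]
  have "(LINT p:Omega L T|lborel. f p * ?d\<phi> p) = (LINT p:Omega L T|lborel. - (g p * \<phi> p))"
    unfolding Omega_def F(1) G(1)
  proof (rule set_integral_cong_AE_on[OF set_integrable_measurable[OF F(5)] set_integrable_measurable[OF G(5)]])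
    show "AE x\<in>{0<..<L} in lborel. (LINT t:{0<..<T}|lborel. f (x, t) * ?d\<phi> (x, t)) = (LINT t:{0<..<T}|lborel. - (g (x, t) * \<phi> (x, t)))"
      using prim L2_slice(1)[OF g]
    proof eventually_elim
      case (elim x)
      show ?case
      proof
        assume x: "x \<in> {0<..<L}"
        define b where "b t = \<phi> (x, t)" for t
        have b: "b \<in> test_fun {0<..<T}"
          using test_fun_slice(2)[of \<phi> "{0<..<L}" "{0<..<T}" x] \<phi> unfolding b_def Omega_def by blast
        let ?db = "\<lambda>t. frechet_derivative b (at t) 1"
        have db: "?d\<phi> (x, t) = ?db t" for t
          using test_fun_slice(4)[of \<phi> "{0<..<L}" "{0<..<T}" x t] \<phi> unfolding b_def Omega_def by simp
        have gi: "set_integrable lborel {0<..<T} (\<lambda>s. g (x, s))"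
          using elim x by (intro L2_integrable emeasure_interval) auto
        have dbi: "set_integrable lborel {0<..<T} ?db"
          using integrable_mult_indicator[OF _ test_fun_integrable[OF test_fun_frechet_derivative[OF b]]]
          by (simp add: set_integrable_def)
        have "(LINT t:{0<..<T}|lborel. f (x, t) * ?d\<phi> (x, t))
            = (LINT t:{0<..<T}|lborel. C x * ?db t + prim (\<lambda>s. g (x, s)) t * ?db t)"
          using elim x by (intro set_lebesgue_integral_cong) (auto simp: db algebra_simps)
        also have "\<dots> = (LINT t:{0<..<T}|lborel. C x * ?db t) + (LINT t:{0<..<T}|lborel. prim (\<lambda>s. g (x, s)) t * ?db t)"
          using set_integrable_mult_continuous[OF dbi continuous_on_prim[OF gi]] dbi
          by (intro set_integral_add set_integrable_mult_right) (simp_all add: mult.commute)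
        also have "(LINT t:{0<..<T}|lborel. C x * ?db t) = C x * prim ?db T"
          by (simp add: prim_def)
        also have "prim ?db T = 0"
          using prim_test_fun_derivative[OF b T] test_fun_outside[OF b, of T] by simp
        finally show "(LINT t:{0<..<T}|lborel. f (x, t) * ?d\<phi> (x, t)) = (LINT t:{0<..<T}|lborel. - (g (x, t) * \<phi> (x, t)))"
          using prim_by_parts_test_fun[OF gi b T] unfolding set_integral_neg b_def by simp
      qed
    qed
  qed
  thus "(LINT p:Omega L T|lborel. f p * ?d\<phi> p) = - (LINT p:Omega L T|lborel. g p * \<phi> p)"
    by (simp only: set_integral_neg)
qed

section \<open>Functions with vanishing weak time derivative\<close>

lemma test_fun_diff_cmult:
  assumes "\<phi> \<in> test_fun S" "\<psi> \<in> test_fun S"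
  shows "(\<lambda>p. \<phi> p - c * \<psi> p) \<in> test_fun S"
proof -
  obtain K where K: "compact K" "K \<subseteq> S" "\<forall>p. p \<notin> K \<longrightarrow> \<phi> p = 0" using test_fun_support[OF assms(1)] by blast
  obtain M where M: "compact M" "M \<subseteq> S" "\<forall>p. p \<notin> M \<longrightarrow> \<psi> p = 0" using test_fun_support[OF assms(2)] by blast
  show ?thesis
  proof (rule test_funI)
    show "Ck n (\<lambda>p. \<phi> p - c * \<psi> p)" for n
      using Ck_add[OF test_fun_Ck[OF assms(1)] Ck_mult[OF Ck_const[of _ "- c"] test_fun_Ck[OF assms(2)]]] by simp
    show "compact (K \<union> M)" using K M by (intro compact_Un)
  qed (use K M in auto)
qed

lemma test_fun_set_integral:
  assumes "\<phi> \<in> test_fun S" shows "(LINT p:S|lborel. \<phi> p) = (LINT p|lborel. \<phi> p)"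
proof -
  have "indicator S p *\<^sub>R \<phi> p = \<phi> p" for p
    using test_fun_outside[OF assms, of p] by (cases "p \<in> S") auto
  hence "(\<lambda>p. indicator S p *\<^sub>R \<phi> p) = \<phi>" by (rule ext)
  thus ?thesis by (simp only: set_lebesgue_integral_def)
qed

text \<open>If every test function had zero mean, the constant 1 would be orthogonal to all of them
  and would vanish almost everywhere by the fundamental lemma.\<close>

lemma unit_mass_test_fun:
  assumes T: "0 < (T::real)"
  shows "\<exists>\<theta>\<in>test_fun {0<..<T}. (LINT t|lborel. \<theta> t) = 1"
proof -
  have "\<exists>\<phi>\<in>test_fun {0<..<T}. (LINT t|lborel. \<phi> t) \<noteq> 0"
  proof (rule ccontr)
    assume "\<not> ?thesis"
    hence "AE t\<in>{0<..<T} in lborel. (1::real) = 0"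
      by (intro fundamental_lemma_interval)
        (auto simp: set_integrable_def integrable_indicator_iff emeasure_interval[unfolded infinity_ennreal_def] test_fun_set_integral)
    hence "{0<..<T} \<in> null_sets lborel" by (subst AE_iff_null_sets) auto
    thus False using T by (simp add: null_sets_def)
  qed
  then obtain \<phi> where \<phi>: "\<phi> \<in> test_fun {0<..<T}" "(LINT t|lborel. \<phi> t) \<noteq> 0" by blast
  let ?c = "1 / (LINT t|lborel. \<phi> t)"
  \<comment> \<open>The normalised function \<open>?c\<close> times \<phi> is written as a
    difference so that \<open>test_fun_diff_cmult\<close> covers it.\<close>
  have "(\<lambda>t. \<phi> t - (1 - ?c) * \<phi> t) \<in> test_fun {0<..<T}" by (rule test_fun_diff_cmult[OF \<phi>(1,1)])
  moreover have "(\<lambda>t. \<phi> t - (1 - ?c) * \<phi> t) = (\<lambda>t. ?c * \<phi> t)" by (auto simp: algebra_simps)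
  ultimately have "(\<lambda>t. ?c * \<phi> t) \<in> test_fun {0<..<T}" by (simp only:)
  moreover have "(LINT t|lborel. ?c * \<phi> t) = 1" using \<phi>(2) by simp
  ultimately show ?thesis by blast
qed

text \<open>The du Bois-Reymond argument: testing with antiderivatives of mean-zero test functions.\<close>

lemma weak_t_deriv_zero:
  assumes H: "H \<in> L2 (Omega L T)" and w: "has_weak_deriv (Omega L T) (0, 1) H (\<lambda>_. 0)" and T: "0 < T"
  shows "\<exists>c. AE p\<in>Omega L T in lborel. H p = c (fst p)"
proof -
  obtain \<theta> where \<theta>: "\<theta> \<in> test_fun {0<..<T}" "(LINT t|lborel. \<theta> t) = 1" using unit_mass_test_fun[OF T] by blast
  obtain B\<theta> where B\<theta>: "\<bar>\<theta> p\<bar> \<le> B\<theta>" for p using test_fun_bounded[OF \<theta>(1)] by metis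
  have H\<theta>: "set_integrable lborel (Omega L T) (\<lambda>p. \<theta> (snd p) * H p)"
    by (rule set_integrable_bounded_mult[where B=B\<theta>, OF L2_Omega_integrable[OF H] set_borel_measurable_snd])
       (use B\<theta> in \<open>auto intro!: test_fun_set_measurable[OF \<theta>(1)]\<close>)
  \<comment> \<open>Since \<theta> has mass 1, the \<theta>-weighted mean in time of a function of x
    alone returns that function; this dictates the candidate.\<close>
  define c where "c x = (LINT t:{0<..<T}|lborel. \<theta> t * H (x, t))" for x
  have c: "set_integrable lborel {0<..<L} c"
    using Fubini_set_integral(5)[OF H\<theta>[unfolded Omega_def]] by (simp add: c_def[abs_def])
  note one = set_integrable_const_interval[of 0 T 1]
  have c1: "set_integrable lborel (Omega L T) (\<lambda>p. c (fst p))"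
    using set_integrable_product[OF c one] by (simp add: Omega_def)
  have "AE p\<in>{0<..<L} \<times> {0<..<T} in lborel. H p - c (fst p) = 0"
  proof (rule fundamental_lemma_rectangle)
    show "set_integrable lborel ({0<..<L} \<times> {0<..<T}) (\<lambda>p. H p - c (fst p))"
      using set_integral_diff(1)[OF L2_Omega_integrable[OF H] c1] by (simp add: Omega_def)
    fix a \<beta> :: "real \<Rightarrow> real" assume a: "a \<in> test_fun {0<..<L}" and \<beta>: "\<beta> \<in> test_fun {0<..<T}"
    define m where "m = (LINT t|lborel. \<beta> t)"
    \<comment> \<open>Removing \<open>m\<close> copies of \<theta> makes the mean zero, so the
      remainder is the derivative of a test function, to which the hypothesis on \<open>H\<close>
      applies.\<close>
    have d: "(\<lambda>t. \<beta> t - m * \<theta> t) \<in> test_fun {0<..<T}" by (rule test_fun_diff_cmult[OF \<beta> \<theta>(1)])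
    have "(LINT t|lborel. \<beta> t - m * \<theta> t) = 0"
      using test_fun_integrable[OF \<beta>] test_fun_integrable[OF \<theta>(1)] \<theta>(2) by (simp add: m_def)
    then obtain B where B: "B \<in> test_fun {0<..<T}" "\<And>t. frechet_derivative B (at t) 1 = \<beta> t - m * \<theta> t"
      using test_fun_antiderivative[OF d T] by blast
    let ?aB = "\<lambda>p. a (fst p) * B (snd p)"
    have aB: "?aB \<in> test_fun (Omega L T)" unfolding Omega_def by (rule test_fun_product(1)[OF a B(1)])
    have a\<beta>: "(\<lambda>p. a (fst p) * \<beta> (snd p)) \<in> test_fun (Omega L T)"
      unfolding Omega_def by (rule test_fun_product(1)[OF a \<beta>])
    have a\<theta>: "(\<lambda>p. a (fst p) * \<theta> (snd p)) \<in> test_fun (Omega L T)"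
      unfolding Omega_def by (rule test_fun_product(1)[OF a \<theta>(1)])
    have i1: "set_integrable lborel (Omega L T) (\<lambda>p. H p * (a (fst p) * \<beta> (snd p)))"
      by (rule L2_mult_integrable[OF H test_fun_Omega_L2[OF a\<beta>]])
    have i2: "set_integrable lborel (Omega L T) (\<lambda>p. H p * (a (fst p) * \<theta> (snd p)))"
      by (rule L2_mult_integrable[OF H test_fun_Omega_L2[OF a\<theta>]])
    have ca: "set_integrable lborel {0<..<L} (\<lambda>x. c x * a x)"
      by (rule set_integrable_mult_continuous[OF c]) (use test_fun_Ck[OF a, of 0] in \<open>auto intro: continuous_on_subset\<close>)
    have \<beta>i: "set_integrable lborel {0<..<T} \<beta>"
      using integrable_mult_indicator[OF _ test_fun_integrable[OF \<beta>]] by (simp add: set_integrable_def)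
    have i3: "set_integrable lborel (Omega L T) (\<lambda>p. (c (fst p) * a (fst p)) * \<beta> (snd p))"
      unfolding Omega_def by (rule set_integrable_product[OF ca \<beta>i])
    have "(LINT p:Omega L T|lborel. (c (fst p) * a (fst p)) * \<beta> (snd p)) = (LINT x:{0<..<L}|lborel. (c x * a x) * m)"
      using Fubini_set_integral(1)[OF i3[unfolded Omega_def]] test_fun_set_integral[OF \<beta>] by (simp add: Omega_def m_def)
    also have "\<dots> = m * (LINT x:{0<..<L}|lborel. a x * c x)" by (simp add: mult.commute)
    also have "(LINT x:{0<..<L}|lborel. a x * c x) = (LINT p:Omega L T|lborel. H p * (a (fst p) * \<theta> (snd p)))"
    proof -
      have "a x * c x = (LINT t:{0<..<T}|lborel. H (x, t) * (a x * \<theta> t))" for x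
      proof -
        have "a x * c x = (LINT t:{0<..<T}|lborel. a x * (\<theta> t * H (x, t)))" by (simp add: c_def)
        thus ?thesis by (simp add: ac_simps)
      qed
      thus ?thesis using Fubini_set_integral(1)[OF i2[unfolded Omega_def]] by (simp add: Omega_def)
    qed
    finally have "(LINT p:Omega L T|lborel. (H p - c (fst p)) * (a (fst p) * \<beta> (snd p)))
        = (LINT p:Omega L T|lborel. H p * (a (fst p) * \<beta> (snd p))) - m * (LINT p:Omega L T|lborel. H p * (a (fst p) * \<theta> (snd p)))"
      unfolding left_diff_distrib using set_integral_diff(2)[OF i1 i3] by (simp add: mult.assoc)
    also have "\<dots> = (LINT p:Omega L T|lborel. H p * (a (fst p) * \<beta> (snd p)) - m * (H p * (a (fst p) * \<theta> (snd p))))"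
      using set_integral_diff(2)[OF i1 set_integrable_mult_right[OF i2, of m]] by simp
    also have "\<dots> = (LINT p:Omega L T|lborel. H p * frechet_derivative ?aB (at p) (0, 1))"
      unfolding test_fun_product(3)[OF a B(1)] B(2) by (simp add: algebra_simps)
    also have "\<dots> = 0" using w aB by (simp add: has_weak_deriv_def)
    finally show "(LINT p:{0<..<L} \<times> {0<..<T}|lborel. (H p - c (fst p)) * (a (fst p) * \<beta> (snd p))) = 0"
      by (simp add: Omega_def)
  qed
  hence "AE p\<in>Omega L T in lborel. H p = c (fst p)" by (simp add: Omega_def)
  thus ?thesis by blast
qed

text \<open>The set where \<open>F\<close> equals \<open>c\<close> is closed. Having full measure in
  the open interval it contains that interval, hence its closure, which yields the values at the end
  points.\<close>

lemma continuous_AE_const: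
  fixes F :: "real \<Rightarrow> real"
  assumes F: "continuous_on {0..T} F" and T: "0 < T" and AE: "AE t\<in>{0<..<T} in lborel. F t = c"
  shows "t \<in> {0..T} \<Longrightarrow> F t = c"
proof -
  define Z where "Z = {t \<in> {0..T}. F t = c}"
  have Z: "closed Z" unfolding Z_def
    by (rule continuous_closed_preimage_constant[OF F]) simp
  have "AE t\<in>{0<..<T} in lebesgue. t \<in> Z"
    by (rule AE_completion) (use AE in \<open>auto simp: Z_def elim: eventually_mono\<close>)
  hence "{0<..<T} \<subseteq> Z" using mem_closed_if_AE_lebesgue_open[OF open_greaterThanLessThan Z] by blast
  hence "closure {0<..<T} \<subseteq> Z" by (rule closure_minimal[OF _ Z])
  thus "t \<in> {0..T} \<Longrightarrow> F t = c" using T by (auto simp: Z_def)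
qed

definition forward_kernel :: "real \<Rightarrow> real \<Rightarrow> real" where
  "forward_kernel t s = indicator {..<t} s"

text \<open>Applied to \<open>u\<close>, this kernel gives the multiplier of the energy method. At t
  = T its support misses the open time interval, so the multiplier vanishes there.\<close>

definition backward_kernel :: "real \<Rightarrow> real \<Rightarrow> real \<Rightarrow> real" where
  "backward_kernel T t s = - (T + 1 - s) * indicator {t..} s"

lemma bounded_forward_kernel: "bounded_kernel T forward_kernel 1"
proof -
  have "open {q :: real \<times> real. snd q < fst q}" by (intro open_Collect_less continuous_intros)
  hence "indicator {q :: real \<times> real. snd q < fst q} \<in> borel_measurable (borel :: (real \<times> real) measure)"
    by (intro borel_measurable_indicator borel_open)
  moreover have "(\<lambda>q. forward_kernel (fst q) (snd q)) = indicator {q :: real \<times> real. snd q < fst q}"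
    by (auto simp: forward_kernel_def indicator_def)
  ultimately show ?thesis by (simp add: bounded_kernel_def) (simp add: forward_kernel_def indicator_def)
qed

lemma bounded_backward_kernel:
  assumes "0 \<le> T" shows "bounded_kernel T (backward_kernel T) (T + 1)"
proof -
  have "closed {q :: real \<times> real. fst q \<le> snd q}" by (intro closed_Collect_le continuous_intros)
  hence "indicator {q :: real \<times> real. fst q \<le> snd q} \<in> borel_measurable (borel :: (real \<times> real) measure)"
    by (intro borel_measurable_indicator borel_closed)
  moreover have "(\<lambda>q::real \<times> real. - (T + 1 - snd q)) \<in> borel_measurable borel"
    by (intro borel_measurable_continuous_onI continuous_intros)
  ultimately have "(\<lambda>q. - (T + 1 - snd q) * indicator {q :: real \<times> real. fst q \<le> snd q} q) \<in> borel_measurable borel"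
    by (intro borel_measurable_times)
  moreover have "(\<lambda>q. backward_kernel T (fst q) (snd q)) = (\<lambda>q. - (T + 1 - snd q) * indicator {q :: real \<times> real. fst q \<le> snd q} q)"
    by (auto simp: backward_kernel_def indicator_def)
  ultimately show ?thesis using assms unfolding bounded_kernel_def
    by (auto simp: backward_kernel_def indicator_def)
qed

lemma volterra_forward:
  "t \<in> {0..T} \<Longrightarrow> volterra T forward_kernel g (x, t) = prim (\<lambda>s. g (x, s)) t"
  using prim_kernel[of t T "\<lambda>s. g (x, s)"] by (simp add: volterra_def forward_kernel_def)

lemma volterra_backward:
  assumes t: "t \<in> {0..T}" and g: "set_integrable lborel {0<..<T} (\<lambda>s. g (x, s))"
  shows "volterra T (backward_kernel T) g (x, t)
    = prim (\<lambda>s. (T + 1 - s) * g (x, s)) t - prim (\<lambda>s. (T + 1 - s) * g (x, s)) T"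
proof -
  let ?h = "\<lambda>s. (T + 1 - s) * g (x, s)"
  have h: "set_integrable lborel {0<..<T} ?h"
    using set_integrable_mult_continuous[OF g, of "\<lambda>s. T + 1 - s"]
    by (simp add: mult.commute continuous_on_diff)
  have hi: "set_integrable lborel {0<..<T} (\<lambda>s. indicator {..<t} s * ?h s)"
    by (rule set_integrable_bounded_mult[OF h, where B=1])
       (auto simp: set_borel_measurable_def indicator_def)
  have "volterra T (backward_kernel T) g (x, t) = (LINT s:{0<..<T}|lborel. indicator {..<t} s * ?h s - ?h s)"
    unfolding volterra_def
    by (rule set_lebesgue_integral_cong) (auto simp: backward_kernel_def indicator_def algebra_simps)
  also have "\<dots> = (LINT s:{0<..<T}|lborel. indicator {..<t} s * ?h s) - (LINT s:{0<..<T}|lborel. ?h s)"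
    by (rule set_integral_diff(2)[OF hi h])
  finally show ?thesis using prim_kernel[OF t, of ?h] by (simp add: prim_def)
qed

text \<open>The primitive of \<open>Dt L T u\<close> has the same weak time derivative as
  \<open>u\<close>, so their difference depends on x alone. On almost every slice both are
  continuous in time, which turns equality for almost all times into equality for all of them, the
  end times included.\<close>

lemma hatH21_absolutely_continuous:
  assumes u: "u \<in> hatH21 L T" and T: "0 < T"
  shows "AE x\<in>{0<..<L} in lborel. \<forall>t\<in>{0..T}. u (x, t) = u (x, 0) + prim (\<lambda>s. Dt L T u (x, s)) t"
proof -
  note U = H21D[OF hatH21_H21[OF u]]
  define V where "V = volterra T forward_kernel (Dt L T u)"
  have V: "V \<in> L2 (Omega L T)"
    unfolding V_def using volterra_L2(1)[OF bounded_forward_kernel _ U(2)] T by simp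
  have Vp: "t \<in> {0..T} \<Longrightarrow> V (x, t) = prim (\<lambda>s. Dt L T u (x, s)) t" for x t
    unfolding V_def by (rule volterra_forward)
  have "has_weak_deriv (Omega L T) (0, 1) V (Dt L T u)"
    by (rule has_weak_deriv_time_primitive[OF V U(2), where C="\<lambda>_. 0"]) (use T Vp in auto)
  from has_weak_deriv_diff[OF U(5) this U(1) V U(2,2)]
  have "has_weak_deriv (Omega L T) (0, 1) (\<lambda>p. u p - V p) (\<lambda>_. 0)" by simp
  from weak_t_deriv_zero[OF L2_diff[OF U(1) V] this T] obtain c
    where "AE p\<in>Omega L T in lborel. u p - V p = c (fst p)" by blast
  from lborel_pair.AE_pair[OF this[folded lborel_prod]]
  have "AE x in lborel. AE t in lborel. (x, t) \<in> Omega L T \<longrightarrow> u (x, t) - V (x, t) = c x" by simp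
  thus ?thesis using L2_slice(1)[OF U(2)]
  proof eventually_elim
    case (elim x)
    show ?case
    proof (intro impI ballI)
      fix t assume x: "x \<in> {0<..<L}" and t: "t \<in> {0..T}"
      let ?F = "\<lambda>t. u (x, t) - prim (\<lambda>s. Dt L T u (x, s)) t"
      have "set_integrable lborel {0<..<T} (\<lambda>s. Dt L T u (x, s))"
        using elim(2) x by (intro L2_integrable emeasure_interval) auto
      moreover have "continuous_on {0..T} (\<lambda>t. u (x, t))"
        by (rule continuous_on_compose2[of "{0..L} \<times> {0..T}" u])
           (use u x in \<open>auto simp: hatH21_def intro!: continuous_intros\<close>)
      ultimately have c: "continuous_on {0..T} ?F" by (intro continuous_on_diff continuous_on_prim)
      have "AE t\<in>{0<..<T} in lborel. ?F t = c x"
        using elim(1) by eventually_elim (use x in \<open>auto simp: Omega_def Vp\<close>)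
      note eq = continuous_AE_const[OF c T this]
      have "?F t = c x" by (rule eq[OF t])
      moreover have "?F 0 = c x" by (rule eq) (use T in simp)
      ultimately show "u (x, t) = u (x, 0) + prim (\<lambda>s. Dt L T u (x, s)) t" by simp
    qed
  qed
qed

section \<open>The energy estimate\<close>

lemma set_integral_nonneg_AE:
  fixes f :: "'a \<Rightarrow> real"
  assumes "AE x\<in>S in M. 0 \<le> f x" shows "0 \<le> (LINT x:S|M. f x)"
  unfolding set_lebesgue_integral_def
  by (rule integral_nonneg_AE) (use assms in \<open>auto simp: indicator_def elim: eventually_mono\<close>)

lemma hatH21_continuous_slices:
  assumes u: "u \<in> hatH21 L T"
  shows "x \<in> {0..L} \<Longrightarrow> continuous_on {0..T} (\<lambda>t. u (x, t))"
    and "t \<in> {0..T} \<Longrightarrow> continuous_on {0..L} (\<lambda>x. u (x, t))"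
  by (rule continuous_on_compose2[of "{0..L} \<times> {0..T}" u];
      use u in \<open>auto simp: hatH21_def intro!: continuous_intros\<close>)+

lemma L2_mult_time_weight:
  assumes f: "f \<in> L2 (Omega L T)" shows "(\<lambda>p. (T + 1 - snd p) * f p) \<in> L2 (Omega L T)"
proof (rule L2_bounded_mult[OF f, where M="T + 1"])
  show "set_borel_measurable lborel (Omega L T) (\<lambda>p. T + 1 - snd p)"
    by (rule set_borel_measurable_snd[OF set_borel_measurable_continuous_closed]) (intro continuous_intros)
  show "AE p\<in>Omega L T in lborel. \<bar>T + 1 - snd p\<bar> \<le> T + 1"
    by (rule AE_I2) (auto simp: Omega_def)
qed

text \<open>\<open>hatH21\<close> asks for continuity up to the boundary of the rectangle. The
  kernel jumps only where s = t, a null set of s, and everything is bounded on the compact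
  rectangle, so dominated convergence along sequences applies.\<close>

lemma continuous_on_volterra_backward:
  assumes u: "continuous_on ({0..L} \<times> {0..T}) u"
  shows "continuous_on ({0..L} \<times> {0..T}) (volterra T (backward_kernel T) u)"
  unfolding continuous_on_sequentially
proof (intro allI ballI impI)
  fix X :: "nat \<Rightarrow> real \<times> real" and q
  assume q: "q \<in> {0..L} \<times> {0..T}" and X: "(\<forall>n. X n \<in> {0..L} \<times> {0..T}) \<and> X \<longlonglongrightarrow> q"
  have Xq: "X \<longlonglongrightarrow> q" and XD: "X n \<in> {0..L} \<times> {0..T}" for n using X by simp_all
  have "compact (u ` ({0..L} \<times> {0..T}))"
    by (intro compact_continuous_image u compact_Times) auto
  then obtain B where B: "\<forall>p\<in>{0..L} \<times> {0..T}. \<bar>u p\<bar> \<le> B"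
    using compact_imp_bounded[of "u ` ({0..L} \<times> {0..T})"] by (auto simp: bounded_iff)
  have sl: "continuous_on {0..T} (\<lambda>t. u (x, t))" if "x \<in> {0..L}" for x
    by (rule continuous_on_compose2[OF u]) (use that in \<open>auto intro!: continuous_intros\<close>)
  define G where "G p s = indicator {0<..<T} s *\<^sub>R (backward_kernel T (snd p) s * u (fst p, s))" for p s
  have m: "G p \<in> borel_measurable lborel" if p: "p \<in> {0..L} \<times> {0..T}" for p
  proof -
    have "0 \<le> T" using p by auto
    hence "set_borel_measurable lborel {0<..<T} (\<lambda>s. backward_kernel T (snd p) s * u (fst p, s))"
      using p by (intro set_borel_measurable_mult bounded_kernel_slice[OF bounded_backward_kernel]
          set_borel_measurable_continuous_closed sl) auto
    thus ?thesis unfolding G_def[abs_def] set_borel_measurable_def .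
  qed
  have "(\<lambda>n. LINT s|lborel. G (X n) s) \<longlonglongrightarrow> (LINT s|lborel. G q s)"
  proof (rule integral_dominated_convergence[where w="\<lambda>s. indicator {0<..<T} s *\<^sub>R ((T + 1) * B)"])
    show "integrable lborel (\<lambda>s. indicator {0<..<T} s *\<^sub>R ((T + 1) * B))"
      by (simp add: integrable_indicator_iff emeasure_interval[unfolded infinity_ennreal_def])
    show "AE s in lborel. (\<lambda>n. G (X n) s) \<longlonglongrightarrow> G q s"
      using AE_lborel_singleton[of "snd q"]
    proof eventually_elim
      case (elim s)
      show ?case
      proof (cases "s \<in> {0<..<T}")
        case True
        have "(\<lambda>n. snd (X n)) \<longlonglongrightarrow> snd q" by (rule tendsto_snd[OF Xq])
        \<comment> \<open>Off the jump, the position of s relative to the time of \<open>X n\<close>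
          is eventually that of the limit, so the kernel values become stationary.\<close>
        hence "\<forall>\<^sub>F n in sequentially. snd (X n) \<le> s \<longleftrightarrow> snd q \<le> s"
        proof (cases "snd q < s")
          case True
          hence "\<forall>\<^sub>F n in sequentially. snd (X n) < s"
            using \<open>(\<lambda>n. snd (X n)) \<longlonglongrightarrow> snd q\<close> by (rule order_tendstoD(2)[rotated])
          thus ?thesis by eventually_elim (use True in auto)
        next
          case False
          hence "\<forall>\<^sub>F n in sequentially. s < snd (X n)"
            using \<open>(\<lambda>n. snd (X n)) \<longlonglongrightarrow> snd q\<close> elim by (intro order_tendstoD(1)[where y="snd q"]) auto
          thus ?thesis by eventually_elim (use False elim in auto)
        qed
        hence k: "(\<lambda>n. backward_kernel T (snd (X n)) s) \<longlonglongrightarrow> backward_kernel T (snd q) s"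
          by (intro tendsto_eventually, elim eventually_mono) (simp add: backward_kernel_def indicator_def)
        have "(\<lambda>n. (fst (X n), s)) \<longlonglongrightarrow> (fst q, s)" by (intro tendsto_Pair tendsto_fst Xq tendsto_const)
        moreover have "\<forall>\<^sub>F n in sequentially. (fst (X n), s) \<in> {0..L} \<times> {0..T}"
          using XD True by (intro always_eventually allI) (auto simp: mem_Times_iff)
        moreover have "(fst q, s) \<in> {0..L} \<times> {0..T}" using q True by (auto simp: mem_Times_iff)
        ultimately have "(\<lambda>n. u (fst (X n), s)) \<longlonglongrightarrow> u (fst q, s)"
          by (intro continuous_on_tendsto_compose[OF u])
        thus ?thesis unfolding G_def by (intro tendsto_intros k)
      qed (simp add: G_def)
    qed
    show "AE s in lborel. norm (G (X n) s) \<le> indicator {0<..<T} s *\<^sub>R ((T + 1) * B)" for n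
    proof (rule AE_I2)
      fix s
      have Xn: "X n \<in> {0..L} \<times> {0..T}" by (rule XD)
      show "norm (G (X n) s) \<le> indicator {0<..<T} s *\<^sub>R ((T + 1) * B)"
      proof (cases "s \<in> {0<..<T}")
        case True
        have "\<bar>backward_kernel T (snd (X n)) s\<bar> \<le> T + 1"
          using bounded_backward_kernel[of T] True by (auto simp: bounded_kernel_def)
        moreover have "\<bar>u (fst (X n), s)\<bar> \<le> B" using B Xn True by (auto simp: mem_Times_iff)
        ultimately have "\<bar>backward_kernel T (snd (X n)) s\<bar> * \<bar>u (fst (X n), s)\<bar> \<le> (T + 1) * B"
          by (intro mult_mono) auto
        thus ?thesis using True by (simp add: G_def abs_mult)
      qed (simp add: G_def)
    qed
  qed (use m[OF q] m[OF XD] in simp_all)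
  thus "(volterra T (backward_kernel T) u \<circ> X) \<longlonglongrightarrow> volterra T (backward_kernel T) u q"
    unfolding comp_def volterra_def set_lebesgue_integral_def G_def .
qed

text \<open>All requirements of \<open>hatH21\<close> are inherited from \<open>u\<close>:
  integration in time preserves square integrability, continuity and the zero boundary values, and
  it commutes with the derivatives in x. The time derivative is the integrand, with a plus sign
  because the lower limit varies and the integral carries a minus.\<close>

lemma energy_multiplier:
  assumes u: "u \<in> hatH21 L T" and T: "0 < T"
  defines "\<eta> \<equiv> volterra T (backward_kernel T) u"
  shows "\<eta> \<in> hatH21 L T"
    and "AE p\<in>Omega L T in lborel. Dt L T \<eta> p = (T + 1 - snd p) * u p"
    and "AE p\<in>Omega L T in lborel. Dxx L T \<eta> p = volterra T (backward_kernel T) (Dxx L T u) p"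
    and "\<eta> (x, T) = 0"
proof -
  note U = H21D[OF hatH21_H21[OF u]]
  have T0: "0 \<le> T" using T by simp
  note K = bounded_backward_kernel[OF T0]
  note V = volterra_L2(1)[OF K T0] and Vx = volterra_weak_x_deriv[OF _ _ _ K T0]
  have \<eta>: "\<eta> \<in> L2 (Omega L T)" unfolding \<eta>_def by (rule V[OF U(1)])
  \<comment> \<open>A backward integral is a forward primitive minus the full integral over time,
    which plays the role of the offset in \<open>has_weak_deriv_time_primitive\<close>.\<close>
  have "AE x\<in>{0<..<L} in lborel. \<forall>t\<in>{0<..<T}. \<eta> (x, t) =
      - prim (\<lambda>s. (T + 1 - s) * u (x, s)) T + prim (\<lambda>s. (T + 1 - snd (x, s)) * u (x, s)) t"
    using L2_slice(1)[OF U(1)]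
  proof eventually_elim
    case (elim x)
    show ?case
    proof (intro impI ballI)
      fix t assume "x \<in> {0<..<L}" and t: "t \<in> {0<..<T}"
      hence "set_integrable lborel {0<..<T} (\<lambda>s. u (x, s))"
        using elim by (intro L2_integrable emeasure_interval) auto
      from volterra_backward[OF _ this, of t] t
      show "\<eta> (x, t) = - prim (\<lambda>s. (T + 1 - s) * u (x, s)) T + prim (\<lambda>s. (T + 1 - snd (x, s)) * u (x, s)) t"
        by (simp add: \<eta>_def)
    qed
  qed
  from has_weak_deriv_time_primitive[OF \<eta> L2_mult_time_weight[OF U(1)] T0 this]
  have t: "has_weak_deriv (Omega L T) (0, 1) \<eta> (\<lambda>p. (T + 1 - snd p) * u p)" .
  note h = H21I[OF \<eta> L2_mult_time_weight[OF U(1)] V[OF U(3)] V[OF U(4)] t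
      Vx[OF U(6) U(1) U(3), folded \<eta>_def] Vx[OF U(7) U(3) U(4)]]
  have "continuous_on ({0..L} \<times> {0..T}) \<eta>"
    unfolding \<eta>_def by (rule continuous_on_volterra_backward) (use u in \<open>auto simp: hatH21_def\<close>)
  moreover have "\<eta> (0, t) = 0 \<and> \<eta> (L, t) = 0" for t
  proof -
    have "\<eta> (0, t) = (LINT s:{0<..<T}|lborel. 0)" "\<eta> (L, t) = (LINT s:{0<..<T}|lborel. 0)"
      unfolding \<eta>_def volterra_def
      by (rule set_lebesgue_integral_cong; use u in \<open>auto simp: hatH21_def\<close>)+
    thus ?thesis by simp
  qed
  ultimately show "\<eta> \<in> hatH21 L T" using h(1) by (simp add: hatH21_def)
  show "AE p\<in>Omega L T in lborel. Dt L T \<eta> p = (T + 1 - snd p) * u p"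
    and "AE p\<in>Omega L T in lborel. Dxx L T \<eta> p = volterra T (backward_kernel T) (Dxx L T u) p"
    by (rule h(2), rule h(3))
  have "\<eta> (x, T) = (LINT s:{0<..<T}|lborel. 0)"
    unfolding \<eta>_def volterra_def
    by (rule set_lebesgue_integral_cong) (auto simp: backward_kernel_def)
  thus "\<eta> (x, T) = 0" by simp
qed

text \<open>On almost every slice \<open>u\<close> is the primitive of its time derivative, because
  the initial value is zero; the weighted energy identity is applied there and then integrated over
  x.\<close>

lemma kinetic_energy_identity:
  assumes u: "u \<in> hatH21 L T" and T: "0 < T" and u0: "\<And>x. x \<in> {0<..<L} \<Longrightarrow> u (x, 0) = 0"
  shows "(LINT p:Omega L T|lborel. Dt L T u p * ((T + 1 - snd p) * u p))
    = ((L2_norm {0<..<L} (\<lambda>x. u (x, T)))\<^sup>2 + (L2_norm (Omega L T) u)\<^sup>2) / 2"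
proof -
  note U = H21D[OF hatH21_H21[OF u]]
  have i: "set_integrable lborel (Omega L T) (\<lambda>p. Dt L T u p * ((T + 1 - snd p) * u p))"
    by (rule L2_mult_integrable[OF U(2) L2_mult_time_weight[OF U(1)]])
  note F = Fubini_set_integral[OF i[unfolded Omega_def], folded Omega_def]
  have T1: "set_integrable lborel {0<..<L} (\<lambda>x. (u (x, T))\<^sup>2)"
    by (rule L2_square_integrable[OF L2_continuous_closed[OF hatH21_continuous_slices(2)[OF u]]]) (use T in auto)
  have T2: "set_integrable lborel {0<..<L} (\<lambda>x. LINT t:{0<..<T}|lborel. (u (x, t))\<^sup>2)"
    by (rule L2_slice(2)[OF U(1)])
  have s: "set_integrable lborel {0<..<L} (\<lambda>x. (1 / 2) * ((u (x, T))\<^sup>2 + (LINT t:{0<..<T}|lborel. (u (x, t))\<^sup>2)))"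
    using T1 T2 by (intro set_integrable_mult_right set_integral_add) auto
  have "(LINT p:Omega L T|lborel. Dt L T u p * ((T + 1 - snd p) * u p))
    = (LINT x:{0<..<L}|lborel. (1 / 2) * ((u (x, T))\<^sup>2 + (LINT t:{0<..<T}|lborel. (u (x, t))\<^sup>2)))"
    unfolding F(1)
  proof (rule set_integral_cong_AE_on[OF set_integrable_measurable[OF F(5)] set_integrable_measurable[OF s]])
    show "AE x\<in>{0<..<L} in lborel. (LINT t:{0<..<T}|lborel. Dt L T u (x, t) * ((T + 1 - snd (x, t)) * u (x, t)))
        = (1 / 2) * ((u (x, T))\<^sup>2 + (LINT t:{0<..<T}|lborel. (u (x, t))\<^sup>2))"
      using hatH21_absolutely_continuous[OF u T] L2_slice(1)[OF U(2)]
    proof eventually_elim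
      case (elim x)
      show ?case
      proof
        assume x: "x \<in> {0<..<L}"
        define g where "g s = Dt L T u (x, s)" for s
        have g: "set_integrable lborel {0<..<T} g"
          using elim x unfolding g_def by (intro L2_integrable emeasure_interval) auto
        have ug: "t \<in> {0..T} \<Longrightarrow> u (x, t) = prim g t" for t
          using elim(1) x u0[OF x] unfolding g_def by auto
        have "(LINT t:{0<..<T}|lborel. Dt L T u (x, t) * ((T + 1 - snd (x, t)) * u (x, t)))
            = prim (\<lambda>t. (T + 1 - t) * (g t * prim g t)) T"
          unfolding prim_def[of _ T] by (rule set_lebesgue_integral_cong) (auto simp: ug g_def)
        also have "\<dots> = (prim g T)\<^sup>2 / 2 + prim (\<lambda>t. (prim g t)\<^sup>2) T / 2"
          using T by (intro prim_weighted_energy g) simp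
        also have "prim (\<lambda>t. (prim g t)\<^sup>2) T = (LINT t:{0<..<T}|lborel. (u (x, t))\<^sup>2)"
          unfolding prim_def[of _ T] by (rule set_lebesgue_integral_cong) (auto simp: ug)
        also have "prim g T = u (x, T)" using ug[of T] T by simp
        finally show "(LINT t:{0<..<T}|lborel. Dt L T u (x, t) * ((T + 1 - snd (x, t)) * u (x, t)))
            = (1 / 2) * ((u (x, T))\<^sup>2 + (LINT t:{0<..<T}|lborel. (u (x, t))\<^sup>2))" by simp
      qed
    qed
  qed
  also have "\<dots> = (1 / 2) * ((LINT x:{0<..<L}|lborel. (u (x, T))\<^sup>2) + (LINT x:{0<..<L}|lborel. LINT t:{0<..<T}|lborel. (u (x, t))\<^sup>2))"
    using set_integral_add(2)[OF T1 T2] by simp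
  finally show ?thesis using L2_slice(3)[OF U(1)] by (simp add: L2_norm_power2)
qed

lemma Linf_mult_L2:
  assumes k: "k \<in> Linf {0<..<L}" and f: "f \<in> L2 (Omega L T)"
  shows "(\<lambda>p. k (fst p) * f p) \<in> L2 (Omega L T)"
proof -
  obtain M where M: "AE x\<in>{0<..<L} in lborel. \<bar>k x\<bar> \<le> M" and m: "set_borel_measurable lborel {0<..<L} k"
    using k by (auto simp: Linf_def)
  show ?thesis
    by (rule L2_bounded_mult[OF f set_borel_measurable_fst[OF m] AE_fst_Omega[OF M]])
qed

text \<open>For fixed x the coefficient is a positive constant and leaves the integral over time;
  what remains is minus the quantity in \<open>prim_weighted_kernel_nonneg\<close>.\<close>

lemma elastic_energy_nonpos:
  assumes k: "k \<in> Linf {0<..<L}" "AE x\<in>{0<..<L} in lborel. k x > 0"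
    and h: "h \<in> L2 (Omega L T)" and T: "0 < T"
  shows "(LINT p:Omega L T|lborel. k (fst p) * h p * volterra T (backward_kernel T) h p) \<le> 0"
proof -
  have T0: "0 \<le> T" using T by simp
  let ?V = "volterra T (backward_kernel T) h"
  have "set_integrable lborel (Omega L T) (\<lambda>p. k (fst p) * h p * ?V p)"
    by (rule L2_mult_integrable[OF Linf_mult_L2[OF k(1) h] volterra_L2(1)[OF bounded_backward_kernel[OF T0] T0 h]])
  note F = Fubini_set_integral[OF this[unfolded Omega_def], folded Omega_def]
  have "0 \<le> (LINT x:{0<..<L}|lborel. - (LINT t:{0<..<T}|lborel. k (fst (x, t)) * h (x, t) * ?V (x, t)))"
  proof (rule set_integral_nonneg_AE)
    show "AE x\<in>{0<..<L} in lborel. 0 \<le> - (LINT t:{0<..<T}|lborel. k (fst (x, t)) * h (x, t) * ?V (x, t))"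
      using k(2) L2_slice(1)[OF h]
    proof eventually_elim
      case (elim x)
      show ?case
      proof
        assume x: "x \<in> {0<..<L}"
        define g where "g s = h (x, s)" for s
        have g: "set_integrable lborel {0<..<T} g"
          using elim x unfolding g_def by (intro L2_integrable emeasure_interval) auto
        let ?Q = "prim (\<lambda>t. (T + 1 - t) * g t)"
        have V: "?V (x, t) = ?Q t - ?Q T" if "t \<in> {0..T}" for t
          using volterra_backward[OF that, of h x] g unfolding g_def by simp
        have "(LINT t:{0<..<T}|lborel. k (fst (x, t)) * h (x, t) * ?V (x, t))
            = (LINT t:{0<..<T}|lborel. - k x * (g t * (?Q T - ?Q t)))"
          by (rule set_lebesgue_integral_cong) (auto simp: V g_def algebra_simps)
        also have "\<dots> = - k x * prim (\<lambda>t. g t * (?Q T - ?Q t)) T"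
          by (simp only: set_integral_mult_right prim_def[of _ T])
        finally show "0 \<le> - (LINT t:{0<..<T}|lborel. k (fst (x, t)) * h (x, t) * ?V (x, t))"
          using prim_weighted_kernel_nonneg[OF g T0] elim(1) x by simp
      qed
    qed
  qed
  thus ?thesis unfolding F(1) set_integral_neg by simp
qed

text \<open>Dropping the square of \<open>a\<close> bounds \<open>b\<close>; reinserting this bound
  on the right then bounds \<open>a\<close>.\<close>

lemma quadratic_bound:
  fixes a b e :: real
  assumes "a\<^sup>2 + b\<^sup>2 \<le> b * e" "0 \<le> b" "0 \<le> e"
  shows "b \<le> e" "a \<le> e"
proof -
  have "b * b \<le> b * e" using assms(1) zero_le_power2[of a] unfolding power2_eq_square by linarith
  thus b: "b \<le> e" using assms(2,3) by (cases "b = 0") auto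
  have "a\<^sup>2 \<le> b * e" using assms(1) zero_le_power2[of b] by linarith
  also have "\<dots> \<le> e\<^sup>2" unfolding power2_eq_square by (rule mult_right_mono[OF b assms(3)])
  finally show "a \<le> e" by (rule power2_le_imp_le[OF _ assms(3)])
qed

text \<open>The arithmetic end of the energy estimate: \<open>a\<close> is the trace norm at the
  final time, \<open>b\<close> the norm of the state, \<open>C * b\<close> the bound on the
  multiplier, and \<open>I\<close>, \<open>J\<close> are its pairings with the load and the initial
  velocity.\<close>

lemma energy_balance_bounds:
  fixes a b C f w I J :: real
  assumes "(a\<^sup>2 + b\<^sup>2) / 2 \<le> - (I + J)" "\<bar>I\<bar> \<le> (C * b) * f" "\<bar>J\<bar> \<le> (C * b) * w"
    and "0 \<le> b" "0 \<le> C" "0 \<le> f" "0 \<le> w"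
  shows "b \<le> 2 * C * (f + w)" "a \<le> 2 * C * (f + w)"
proof -
  \<comment> \<open>The names hide the products, so that the next inequality is linear in its
    atoms.\<close>
  define X Y Z where "X = a\<^sup>2 + b\<^sup>2" and "Y = (C * b) * f" and "Z = (C * b) * w"
  have "X \<le> 2 * Y + 2 * Z"
    using assms(1) abs_le_D2[OF assms(2)] abs_le_D2[OF assms(3)]
    unfolding X_def[symmetric] Y_def[symmetric] Z_def[symmetric] by linarith
  hence "a\<^sup>2 + b\<^sup>2 \<le> 2 * ((C * b) * f + (C * b) * w)"
    unfolding X_def Y_def Z_def distrib_left[of 2] .
  also have "\<dots> = b * (2 * C * (f + w))" by (simp add: algebra_simps)
  finally have *: "a\<^sup>2 + b\<^sup>2 \<le> b * (2 * C * (f + w))" .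
  have "0 \<le> 2 * C * (f + w)" using assms(5-7) by simp
  from quadratic_bound[OF * assms(4) this]
  show "b \<le> 2 * C * (f + w)" "a \<le> 2 * C * (f + w)" .
qed

text \<open>Two bounds are extracted from one identity: the norm over \<open>Omega\<close> serves
  the state, and the trace at \<open>T\<close> serves the adjoint state, whose value at time 0
  becomes a final trace under reflection. The factor 2 undoes the halves of the kinetic
  term.\<close>

lemma beam_energy_estimate:
  assumes T: "0 < T" and k: "k \<in> Linf {0<..<L}" "AE x\<in>{0<..<L} in lborel. k x > 0"
    and u: "u \<in> hatH21 L T" and u0: "\<And>x. x \<in> {0<..<L} \<Longrightarrow> u (x, 0) = 0"
    and F: "F \<in> L2 (Omega L T)" and v: "v \<in> L2 {0<..<L}"
    and weak: "\<And>\<eta>. \<eta> \<in> hatH21 L T \<Longrightarrow> (\<forall>x\<in>{0<..<L}. \<eta> (x, T) = 0) \<Longrightarrow>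
        (LINT p:Omega L T|lborel. - Dt L T u p * Dt L T \<eta> p + k (fst p) * Dxx L T u p * Dxx L T \<eta> p)
        = (LINT p:Omega L T|lborel. \<eta> p * F p) + (LINT x:{0<..<L}|lborel. v x * \<eta> (x, 0))"
  shows "L2_norm (Omega L T) u \<le> 2 * (T + 1)\<^sup>2 * (L2_norm (Omega L T) F + L2_norm {0<..<L} v)"
    and "L2_norm {0<..<L} (\<lambda>x. u (x, T)) \<le> 2 * (T + 1)\<^sup>2 * (L2_norm (Omega L T) F + L2_norm {0<..<L} v)"
proof -
  have T0: "0 \<le> T" using T by simp
  note U = H21D[OF hatH21_H21[OF u]]
  note K = bounded_backward_kernel[OF T0]
  define \<eta> where "\<eta> = volterra T (backward_kernel T) u"
  note \<eta> = energy_multiplier[OF u T, folded \<eta>_def]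
  note H = H21D[OF hatH21_H21[OF \<eta>(1)]]
  let ?V = "volterra T (backward_kernel T) (Dxx L T u)"
  have V: "?V \<in> L2 (Omega L T)" by (rule volterra_L2(1)[OF K T0 U(4)])
  note W = L2_mult_time_weight[OF U(1)]
  have i1: "set_integrable lborel (Omega L T) (\<lambda>p. Dt L T u p * ((T + 1 - snd p) * u p))"
    by (rule L2_mult_integrable[OF U(2) W])
  have i2: "set_integrable lborel (Omega L T) (\<lambda>p. k (fst p) * Dxx L T u p * ?V p)"
    by (rule L2_mult_integrable[OF Linf_mult_L2[OF k(1) U(4)] V])
  have kin: "(LINT p:Omega L T|lborel. Dt L T u p * ((T + 1 - snd p) * u p))
    = ((L2_norm {0<..<L} (\<lambda>x. u (x, T)))\<^sup>2 + (L2_norm (Omega L T) u)\<^sup>2) / 2"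
    by (rule kinetic_energy_identity[OF u T]) (rule u0)
  have "(LINT p:Omega L T|lborel. - Dt L T u p * Dt L T \<eta> p + k (fst p) * Dxx L T u p * Dxx L T \<eta> p)
    = (LINT p:Omega L T|lborel. k (fst p) * Dxx L T u p * ?V p - Dt L T u p * ((T + 1 - snd p) * u p))"
  proof (rule set_integral_cong_AE_on)
    show "set_borel_measurable lborel (Omega L T)
        (\<lambda>p. - Dt L T u p * Dt L T \<eta> p + k (fst p) * Dxx L T u p * Dxx L T \<eta> p)"
      by (intro set_borel_measurable_add set_borel_measurable_mult[OF L2_measurable L2_measurable]
          L2_minus U H Linf_mult_L2 k)
    show "set_borel_measurable lborel (Omega L T) (\<lambda>p. k (fst p) * Dxx L T u p * ?V p - Dt L T u p * ((T + 1 - snd p) * u p))"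
      by (rule set_integrable_measurable[OF set_integral_diff(1)[OF i2 i1]])
    show "AE p\<in>Omega L T in lborel. - Dt L T u p * Dt L T \<eta> p + k (fst p) * Dxx L T u p * Dxx L T \<eta> p
       = k (fst p) * Dxx L T u p * ?V p - Dt L T u p * ((T + 1 - snd p) * u p)"
      using \<eta>(2,3) by eventually_elim auto
  qed
  also have "\<dots> = (LINT p:Omega L T|lborel. k (fst p) * Dxx L T u p * ?V p)
      - ((L2_norm {0<..<L} (\<lambda>x. u (x, T)))\<^sup>2 + (L2_norm (Omega L T) u)\<^sup>2) / 2"
    unfolding set_integral_diff(2)[OF i2 i1] kin by (rule refl)
  \<comment> \<open>The elastic term is discarded on account of its sign.\<close>
  also have "\<dots> \<le> - (((L2_norm {0<..<L} (\<lambda>x. u (x, T)))\<^sup>2 + (L2_norm (Omega L T) u)\<^sup>2) / 2)"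
    using elastic_energy_nonpos[OF k U(4) T] by simp
  finally have E: "((L2_norm {0<..<L} (\<lambda>x. u (x, T)))\<^sup>2 + (L2_norm (Omega L T) u)\<^sup>2) / 2
      \<le> - ((LINT p:Omega L T|lborel. \<eta> p * F p) + (LINT x:{0<..<L}|lborel. v x * \<eta> (x, 0)))"
    unfolding weak[OF \<eta>(1) ballI[OF \<eta>(4)]] by linarith
  \<comment> \<open>The two operator bounds, (T + 1) T over \<open>Omega\<close> and (T + 1) sqrt T
    at time 0, are both rounded up to (T + 1)^2.\<close>
  let ?N = "L2_norm (Omega L T) u" and ?C = "(T + 1)\<^sup>2"
  have N: "0 \<le> ?N" by (rule L2_norm_nonneg)
  have CN: "0 \<le> ?C * ?N" by (rule mult_nonneg_nonneg[OF zero_le_power2 N])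
  have "(L2_norm (Omega L T) \<eta>)\<^sup>2 \<le> (T + 1)\<^sup>2 * T\<^sup>2 * ?N\<^sup>2"
    unfolding \<eta>_def by (rule volterra_L2(2)[OF K T0 U(1)])
  also have "\<dots> \<le> (T + 1)\<^sup>2 * (T + 1)\<^sup>2 * ?N\<^sup>2"
    using T by (intro mult_right_mono mult_left_mono power_mono) auto
  also have "\<dots> = (?C * ?N)\<^sup>2" by (simp add: power2_eq_square ac_simps)
  finally have n1: "L2_norm (Omega L T) \<eta> \<le> ?C * ?N" by (rule power2_le_imp_le[OF _ CN])
  have "(L2_norm {0<..<L} (\<lambda>x. \<eta> (x, 0)))\<^sup>2 \<le> (T + 1)\<^sup>2 * T * ?N\<^sup>2"
    unfolding \<eta>_def by (rule volterra_L2_slice(2)[OF K T0 U(1)])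
  also have "\<dots> \<le> (T + 1)\<^sup>2 * (T + 1)\<^sup>2 * ?N\<^sup>2"
    using T by (intro mult_right_mono mult_left_mono) (auto simp: power2_eq_square algebra_simps)
  also have "\<dots> = (?C * ?N)\<^sup>2" by (simp add: power2_eq_square ac_simps)
  finally have n2: "L2_norm {0<..<L} (\<lambda>x. \<eta> (x, 0)) \<le> ?C * ?N" by (rule power2_le_imp_le[OF _ CN])
  have c1: "\<bar>LINT p:Omega L T|lborel. \<eta> p * F p\<bar> \<le> (?C * ?N) * L2_norm (Omega L T) F"
    by (rule order_trans[OF Cauchy_Schwarz_L2[OF H(1) F] mult_right_mono[OF n1 L2_norm_nonneg]])
  have "(\<lambda>x. \<eta> (x, 0)) \<in> L2 {0<..<L}"
    unfolding \<eta>_def by (rule volterra_L2_slice(1)[OF K T0 U(1)])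
  from order_trans[OF Cauchy_Schwarz_L2[OF v this] mult_left_mono[OF n2 L2_norm_nonneg]]
  have c2: "\<bar>LINT x:{0<..<L}|lborel. v x * \<eta> (x, 0)\<bar> \<le> (?C * ?N) * L2_norm {0<..<L} v"
    unfolding mult.commute[of "?C * ?N"] .
  note est = energy_balance_bounds[OF E c1 c2 N zero_le_power2 L2_norm_nonneg L2_norm_nonneg]
  show "?N \<le> 2 * ?C * (L2_norm (Omega L T) F + L2_norm {0<..<L} v)"
    by (rule est(1))
  show "L2_norm {0<..<L} (\<lambda>x. u (x, T)) \<le> 2 * ?C * (L2_norm (Omega L T) F + L2_norm {0<..<L} v)"
    by (rule est(2))
qed

section \<open>Differences of solutions and uniqueness of the gradient\<close>

lemma L2_norm_zero [simp]: "L2_norm S (\<lambda>p. 0) = 0"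
  by (simp add: L2_norm_def)

lemma L2_norm_cmult: "L2_norm S (\<lambda>p. c * f p) = \<bar>c\<bar> * L2_norm S f"
  by (simp add: L2_norm_def power_mult_distrib real_sqrt_mult)

lemma L2_norm_cong_AE:
  assumes "f \<in> L2 S" "g \<in> L2 S" "AE p\<in>S in lborel. f p = g p"
  shows "L2_norm S f = L2_norm S g"
proof -
  have "(LINT p:S|lborel. (f p)\<^sup>2) = (LINT p:S|lborel. (g p)\<^sup>2)"
    by (rule set_integral_cong_AE_on[OF set_integrable_measurable set_integrable_measurable])
      (use assms L2_square_integrable in \<open>auto elim: eventually_mono\<close>)
  thus ?thesis by (simp add: L2_norm_def)
qed

lemma L2_norm_add_power2:
  assumes f: "f \<in> L2 S" and g: "g \<in> L2 S"
  shows "(L2_norm S (\<lambda>p. f p + g p))\<^sup>2 = (L2_norm S f)\<^sup>2 + 2 * (LINT p:S|lborel. f p * g p) + (L2_norm S g)\<^sup>2"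
proof -
  have i: "set_integrable lborel S (\<lambda>p. (f p)\<^sup>2)" "set_integrable lborel S (\<lambda>p. 2 * (f p * g p))"
    "set_integrable lborel S (\<lambda>p. (g p)\<^sup>2)"
    using f g L2_square_integrable L2_mult_integrable by auto
  have "(\<lambda>p. (f p + g p)\<^sup>2) = (\<lambda>p. ((f p)\<^sup>2 + 2 * (f p * g p)) + (g p)\<^sup>2)"
    by (simp add: power2_sum fun_eq_iff)
  thus ?thesis
    unfolding L2_norm_power2
    using set_integral_add(2)[OF set_integral_add(1)[OF i(1,2)] i(3)] set_integral_add(2)[OF i(1,2)] by simp
qed

lemma L2_norm_triangle:
  assumes f: "f \<in> L2 S" and g: "g \<in> L2 S"
  shows "L2_norm S (\<lambda>p. f p + g p) \<le> L2_norm S f + L2_norm S g"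
proof -
  have "(LINT p:S|lborel. f p * g p) \<le> L2_norm S f * L2_norm S g"
    using Cauchy_Schwarz_L2[OF f g] by linarith
  hence "(L2_norm S (\<lambda>p. f p + g p))\<^sup>2 \<le> (L2_norm S f + L2_norm S g)\<^sup>2"
    unfolding L2_norm_add_power2[OF f g] power2_sum by simp
  thus ?thesis by (rule power2_le_imp_le) (simp add: L2_norm_nonneg)
qed

lemma L2_norm_eq_zero:
  assumes f: "f \<in> L2 S" and "L2_norm S f = 0"
  shows "AE p\<in>S in lborel. f p = 0"
proof -
  have "(LINT p|lborel. indicator S p *\<^sub>R (f p)\<^sup>2) = 0"
    using assms(2) L2_norm_power2[of S f] by (simp add: set_lebesgue_integral_def)
  hence "AE p in lborel. indicator S p *\<^sub>R (f p)\<^sup>2 = 0"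
    using L2_square_integrable[OF f] unfolding set_integrable_def
    by (subst (asm) integral_nonneg_eq_0_iff_AE) auto
  thus ?thesis by eventually_elim auto
qed

text \<open>State and adjoint equation share this left-hand side, so its symmetry gives the duality
  between them.\<close>

definition beam_form ::
  "real \<Rightarrow> real \<Rightarrow> (real \<Rightarrow> real) \<Rightarrow> (real \<times> real \<Rightarrow> real) \<Rightarrow> (real \<times> real \<Rightarrow> real) \<Rightarrow> real" where
  "beam_form L T k f g =
     (LINT p:Omega L T|lborel. - Dt L T f p * Dt L T g p + k (fst p) * Dxx L T f p * Dxx L T g p)"

lemma beam_form_commute: "beam_form L T k f g = beam_form L T k g f"
  by (simp add: beam_form_def ac_simps)

lemma beam_form_integrable:
  assumes "k \<in> Linf {0<..<L}" "f \<in> hatH21 L T" "g \<in> hatH21 L T"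
  shows "set_integrable lborel (Omega L T)
    (\<lambda>p. - Dt L T f p * Dt L T g p + k (fst p) * Dxx L T f p * Dxx L T g p)"
  using assms
  by (intro set_integral_add L2_mult_integrable L2_minus Linf_mult_L2 H21D hatH21_H21)

text \<open>\<open>Dt\<close> and \<open>Dxx\<close> are choices and additive only up to null sets;
  under the integral this gives exact linearity.\<close>

lemma beam_form_diff:
  assumes k: "k \<in> Linf {0<..<L}" and f: "f \<in> hatH21 L T" and f': "f' \<in> hatH21 L T" and g: "g \<in> hatH21 L T"
  shows "beam_form L T k (\<lambda>p. f p - f' p) g = beam_form L T k f g - beam_form L T k f' g"
proof -
  note d = hatH21_diff[OF f f']
  note i = beam_form_integrable[OF k f g] beam_form_integrable[OF k f' g]
  show ?thesis
    unfolding beam_form_def set_integral_diff(2)[OF i, symmetric]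
  proof (rule set_integral_cong_AE_on)
    show "AE p\<in>Omega L T in lborel.
        - Dt L T (\<lambda>p. f p - f' p) p * Dt L T g p + k (fst p) * Dxx L T (\<lambda>p. f p - f' p) p * Dxx L T g p
        = - Dt L T f p * Dt L T g p + k (fst p) * Dxx L T f p * Dxx L T g p
          - (- Dt L T f' p * Dt L T g p + k (fst p) * Dxx L T f' p * Dxx L T g p)"
      using d(2,3)
    proof eventually_elim
      case (elim p)
      show ?case
      proof
        assume p: "p \<in> Omega L T"
        show "- Dt L T (\<lambda>p. f p - f' p) p * Dt L T g p + k (fst p) * Dxx L T (\<lambda>p. f p - f' p) p * Dxx L T g p
          = - Dt L T f p * Dt L T g p + k (fst p) * Dxx L T f p * Dxx L T g p
            - (- Dt L T f' p * Dt L T g p + k (fst p) * Dxx L T f' p * Dxx L T g p)"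
          unfolding elim(1)[rule_format, OF p] elim(2)[rule_format, OF p] by (simp add: algebra_simps)
      qed
    qed
  qed (rule set_integrable_measurable[OF beam_form_integrable[OF k d(1) g]],
       rule set_integrable_measurable[OF set_integral_diff(1)[OF i]])
qed

text \<open>The reflection changes the sign of both time derivatives, and the two signs cancel in
  their product.\<close>

lemma beam_form_treflect:
  assumes k: "k \<in> Linf {0<..<L}" and f: "f \<in> hatH21 L T" and g: "g \<in> hatH21 L T"
  shows "beam_form L T k (\<lambda>p. f (treflect T p)) (\<lambda>p. g (treflect T p)) = beam_form L T k f g"
proof -
  note F = hatH21_treflect[OF f] and G = hatH21_treflect[OF g]
  define I where "I p = - Dt L T f p * Dt L T g p + k (fst p) * Dxx L T f p * Dxx L T g p" for p
  have I: "set_borel_measurable lborel (Omega L T) I"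
    unfolding I_def by (rule set_integrable_measurable[OF beam_form_integrable[OF k f g]])
  have "beam_form L T k (\<lambda>p. f (treflect T p)) (\<lambda>p. g (treflect T p)) = (LINT p:Omega L T|lborel. I (treflect T p))"
    unfolding beam_form_def
  proof (rule set_integral_cong_AE_on[OF set_integrable_measurable[OF beam_form_integrable[OF k F(1) G(1)]]
        set_borel_measurable_treflect[OF I]])
    show "AE p\<in>Omega L T in lborel.
        - Dt L T (\<lambda>p. f (treflect T p)) p * Dt L T (\<lambda>p. g (treflect T p)) p
        + k (fst p) * Dxx L T (\<lambda>p. f (treflect T p)) p * Dxx L T (\<lambda>p. g (treflect T p)) p = I (treflect T p)"
      using F(2,3) G(2,3) by eventually_elim (auto simp: I_def)
  qed
  also have "\<dots> = beam_form L T k f g"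
    unfolding set_integral_treflect(1)[OF I] unfolding I_def beam_form_def by (rule refl)
  finally show ?thesis .
qed

lemma beam_solution_difference:
  assumes L: "0 < L" and T: "0 < T" and k: "k \<in> Linf {0<..<L}"
    and v: "v \<in> L2 {0<..<L}" "v' \<in> L2 {0<..<L}"
    and u: "beam_weak_solution L T k w v F u" and u': "beam_weak_solution L T k w v' F u'"
  shows "(\<lambda>p. u p - u' p) \<in> hatH21 L T"
    and "\<And>x. x \<in> {0<..<L} \<Longrightarrow> u (x, 0) - u' (x, 0) = 0"
    and "\<And>\<eta>. \<eta> \<in> hatH21 L T \<Longrightarrow> (\<forall>x\<in>{0<..<L}. \<eta> (x, T) = 0) \<Longrightarrow>
      beam_form L T k (\<lambda>p. u p - u' p) \<eta> = (LINT x:{0<..<L}|lborel. (v x - v' x) * \<eta> (x, 0))"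
proof -
  have h: "u \<in> hatH21 L T" "u' \<in> hatH21 L T" using u u' by (simp_all add: beam_weak_solution_def)
  show d: "(\<lambda>p. u p - u' p) \<in> hatH21 L T" by (rule hatH21_diff(1)[OF h])
  show "u (x, 0) - u' (x, 0) = 0" if x: "x \<in> {0<..<L}" for x
  \<comment> \<open>Each initial value is prescribed almost everywhere only, while test functions of
    the adjoint problem must vanish at every point; continuity closes the gap.\<close>
  proof (rule continuous_AE_const[where F = "\<lambda>x. u (x, 0) - u' (x, 0)" and T = L])
    show "continuous_on {0..L} (\<lambda>x. u (x, 0) - u' (x, 0))"
      using hatH21_continuous_slices(2)[OF d, of 0] T by simp
    have "AE x\<in>{0<..<L} in lborel. u (x, 0) = w x" "AE x\<in>{0<..<L} in lborel. u' (x, 0) = w x"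
      using u u' by (simp_all add: beam_weak_solution_def)
    thus "AE x\<in>{0<..<L} in lborel. u (x, 0) - u' (x, 0) = 0" by eventually_elim auto
  qed (use L x in auto)
  fix \<eta> assume \<eta>: "\<eta> \<in> hatH21 L T" "\<forall>x\<in>{0<..<L}. \<eta> (x, T) = 0"
  have \<eta>0: "(\<lambda>x. \<eta> (x, 0)) \<in> L2 {0<..<L}"
    using hatH21_continuous_slices(2)[OF \<eta>(1), of 0] T by (intro L2_continuous_closed) simp
  have "beam_form L T k u \<eta> = (LINT p:Omega L T|lborel. \<eta> p * F p) + (LINT x:{0<..<L}|lborel. v x * \<eta> (x, 0))"
    "beam_form L T k u' \<eta> = (LINT p:Omega L T|lborel. \<eta> p * F p) + (LINT x:{0<..<L}|lborel. v' x * \<eta> (x, 0))"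
    using u u' \<eta> by (simp_all add: beam_weak_solution_def beam_form_def)
  thus "beam_form L T k (\<lambda>p. u p - u' p) \<eta> = (LINT x:{0<..<L}|lborel. (v x - v' x) * \<eta> (x, 0))"
    unfolding beam_form_diff[OF k h \<eta>(1)] left_diff_distrib
      set_integral_diff(2)[OF L2_mult_integrable[OF v(1) \<eta>0] L2_mult_integrable[OF v(2) \<eta>0]] by simp
qed

text \<open>Load and initial displacement cancel in the difference, so only the velocity term of the
  energy estimate survives.\<close>

lemma beam_solution_Lipschitz:
  assumes L: "0 < L" and T: "0 < T" and k: "k \<in> Linf {0<..<L}" "AE x\<in>{0<..<L} in lborel. k x > 0"
    and v: "v \<in> L2 {0<..<L}" "v' \<in> L2 {0<..<L}"
    and u: "beam_weak_solution L T k w v F u" and u': "beam_weak_solution L T k w v' F u'"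
  shows "L2_norm (Omega L T) (\<lambda>p. u p - u' p) \<le> 2 * (T + 1)\<^sup>2 * L2_norm {0<..<L} (\<lambda>x. v x - v' x)"
proof -
  note d = beam_solution_difference[OF L T k(1) v u u']
  have zero: "(\<lambda>p. 0) \<in> L2 (Omega L T)" by (rule L2_const[OF _ emeasure_Omega]) simp
  have "L2_norm (Omega L T) (\<lambda>p. u p - u' p)
      \<le> 2 * (T + 1)\<^sup>2 * (L2_norm (Omega L T) (\<lambda>p. 0) + L2_norm {0<..<L} (\<lambda>x. v x - v' x))"
    by (rule beam_energy_estimate(1)[OF T k d(1) _ zero L2_diff[OF v]])
      (use d(2,3) in \<open>simp_all add: beam_form_def\<close>)
  thus ?thesis by simp
qed

text \<open>Reflected in time, the difference of the adjoint states solves a beam problem with zero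
  initial data and load -2 times the reflected difference of the states. The factor 2 of this load
  doubles the constant of the energy estimate.\<close>

lemma adjoint_solution_Lipschitz:
  assumes T: "0 < T" and k: "k \<in> Linf {0<..<L}" "AE x\<in>{0<..<L} in lborel. k x > 0"
    and y: "y \<in> L2 (Omega L T)" and u: "u \<in> L2 (Omega L T)" "u' \<in> L2 (Omega L T)"
    and \<psi>: "adjoint_weak_solution L T k y u \<psi>" and \<psi>': "adjoint_weak_solution L T k y u' \<psi>'"
  shows "L2_norm {0<..<L} (\<lambda>x. \<psi> (x, 0) - \<psi>' (x, 0)) \<le> 4 * (T + 1)\<^sup>2 * L2_norm (Omega L T) (\<lambda>p. u p - u' p)"
proof -
  have h: "\<psi> \<in> hatH21 L T" "\<psi>' \<in> hatH21 L T" using \<psi> \<psi>' by (simp_all add: adjoint_weak_solution_def)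
  define d where "d p = \<psi> p - \<psi>' p" for p
  have d: "d \<in> hatH21 L T" unfolding d_def by (rule hatH21_diff(1)[OF h])
  define D where "D p = d (treflect T p)" for p
  have D: "D \<in> hatH21 L T" unfolding D_def by (rule hatH21_treflect(1)[OF d])
  define G where "G p = - 2 * (u (treflect T p) - u' (treflect T p))" for p
  have du: "(\<lambda>p. u p - u' p) \<in> L2 (Omega L T)" by (rule L2_diff[OF u])
  have G: "G \<in> L2 (Omega L T)" unfolding G_def by (intro L2_cmult L2_treflect[OF du])
  have zero: "(\<lambda>x. 0) \<in> L2 {0<..<L}" by (rule L2_const[OF _ emeasure_interval]) simp
  have weak: "beam_form L T k D \<eta> = (LINT p:Omega L T|lborel. \<eta> p * G p)"
    if \<eta>: "\<eta> \<in> hatH21 L T" "\<forall>x\<in>{0<..<L}. \<eta> (x, T) = 0" for \<eta>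
  proof -
    \<comment> \<open>Reflection exchanges test functions vanishing at \<open>T\<close> with those
      vanishing at 0, which are the ones the adjoint problem admits.\<close>
    define \<zeta> where "\<zeta> p = \<eta> (treflect T p)" for p
    have \<zeta>: "\<zeta> \<in> hatH21 L T" "\<forall>x\<in>{0<..<L}. \<zeta> (x, 0) = 0" "\<eta> = (\<lambda>p. \<zeta> (treflect T p))"
      unfolding \<zeta>_def using hatH21_treflect(1)[OF \<eta>(1)] \<eta>(2) by simp_all
    note Z = H21D(1)[OF hatH21_H21[OF \<zeta>(1)]]
    have "beam_form L T k D \<eta> = beam_form L T k d \<zeta>"
      unfolding D_def \<zeta>(3) by (rule beam_form_treflect[OF k(1) d \<zeta>(1)])
    also have "\<dots> = beam_form L T k \<psi> \<zeta> - beam_form L T k \<psi>' \<zeta>"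
      unfolding d_def by (rule beam_form_diff[OF k(1) h \<zeta>(1)])
    also have "\<dots> = - 2 * (LINT p:Omega L T|lborel. (u p - y p) * \<zeta> p) + 2 * (LINT p:Omega L T|lborel. (u' p - y p) * \<zeta> p)"
      using \<psi> \<psi>' \<zeta>(1,2) by (simp add: adjoint_weak_solution_def beam_form_def)
    also have "\<dots> = - 2 * (LINT p:Omega L T|lborel. (u p - y p) * \<zeta> p - (u' p - y p) * \<zeta> p)"
      using set_integral_diff(2)[OF L2_mult_integrable[OF L2_diff[OF u(1) y] Z] L2_mult_integrable[OF L2_diff[OF u(2) y] Z]]
      by simp
    also have "\<dots> = (LINT p:Omega L T|lborel. \<zeta> p * (- 2 * (u p - u' p)))"
      by (subst set_integral_mult_right[symmetric]) (simp add: algebra_simps)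
    also have "\<dots> = (LINT p:Omega L T|lborel. \<zeta> (treflect T p) * G p)"
      using set_integral_treflect(1)[OF set_borel_measurable_mult[OF L2_measurable[OF Z]
          L2_measurable[OF L2_cmult[OF du, of "- 2"]]]]
      by (simp add: G_def)
    finally show ?thesis unfolding \<zeta>(3) .
  qed
  have "L2_norm {0<..<L} (\<lambda>x. D (x, T)) \<le> 2 * (T + 1)\<^sup>2 * (L2_norm (Omega L T) G + L2_norm {0<..<L} (\<lambda>x. 0))"
  proof (rule beam_energy_estimate(2)[OF T k D _ G zero])
    show "D (x, 0) = 0" if "x \<in> {0<..<L}" for x
      using that \<psi> \<psi>' by (simp add: D_def d_def adjoint_weak_solution_def)
  qed (use weak in \<open>simp_all add: beam_form_def\<close>)
  moreover have "L2_norm (Omega L T) G = 2 * L2_norm (Omega L T) (\<lambda>p. u p - u' p)"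
  proof -
    have "(LINT p:Omega L T|lborel. (u (treflect T p) - u' (treflect T p))\<^sup>2) = (LINT p:Omega L T|lborel. (u p - u' p)\<^sup>2)"
      by (rule set_integral_treflect(1)[OF set_integrable_measurable[OF L2_square_integrable[OF du]]])
    hence "L2_norm (Omega L T) (\<lambda>p. u (treflect T p) - u' (treflect T p)) = L2_norm (Omega L T) (\<lambda>p. u p - u' p)"
      by (simp add: L2_norm_def)
    thus ?thesis unfolding G_def L2_norm_cmult by simp
  qed
  ultimately show ?thesis by (simp add: D_def d_def)
qed

text \<open>Convexity allows an admissible increment to be shrunk, as the limit in the definition of
  the gradient requires.\<close>

lemma Vad_convex:
  assumes v: "v \<in> Vad L vc" and z: "z \<in> Vad L vc" and s: "0 \<le> s" "s \<le> 1"
  shows "(\<lambda>x. v x + s * (z x - v x)) \<in> Vad L vc"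
proof -
  have L2: "v \<in> L2 {0<..<L}" "z \<in> L2 {0<..<L}" using v z by (simp_all add: Vad_def)
  have eq: "(\<lambda>x. v x + s * (z x - v x)) = (\<lambda>x. (1 - s) * v x + s * z x)"
    by (simp add: fun_eq_iff algebra_simps)
  have "L2_norm {0<..<L} (\<lambda>x. (1 - s) * v x + s * z x) \<le> \<bar>1 - s\<bar> * L2_norm {0<..<L} v + \<bar>s\<bar> * L2_norm {0<..<L} z"
    using L2_norm_triangle[OF L2_cmult[OF L2(1), of "1 - s"] L2_cmult[OF L2(2), of s]] by (simp add: L2_norm_cmult)
  also have "\<dots> \<le> (1 - s) * vc + s * vc"
    using s v z by (intro add_mono) (auto simp: Vad_def intro!: mult_left_mono)
  also have "\<dots> = vc" by (simp add: algebra_simps)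
  finally show ?thesis
    unfolding eq using L2_add[OF L2_cmult[OF L2(1)] L2_cmult[OF L2(2)]] by (simp add: Vad_def)
qed

text \<open>Only increments that stay in the ball may be used, and \<open>v\<close> may lie on its
  boundary. Shrinking an increment shows that the difference \<open>e\<close> of two gradients is
  orthogonal to z - v for every admissible z; taking z = 0 and z a small multiple of
  \<open>e\<close> then forces \<open>e\<close> to have norm 0.\<close>

lemma is_L2_gradient_unique:
  assumes v: "v \<in> Vad L vc" and vc: "0 < vc"
    and g: "is_L2_gradient {0<..<L} (Vad L vc) \<Phi> v g" and g': "is_L2_gradient {0<..<L} (Vad L vc) \<Phi> v g'"
  shows "AE x\<in>{0<..<L} in lborel. g x = g' x"
proof -
  let ?S = "{0<..<L}"
  have L2: "g \<in> L2 ?S" "g' \<in> L2 ?S" "v \<in> L2 ?S" using g g' v by (simp_all add: is_L2_gradient_def Vad_def)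
  define e where "e x = g x - g' x" for x
  have e: "e \<in> L2 ?S" unfolding e_def by (rule L2_diff[OF L2(1,2)])
  have orth: "L2_inner ?S e (\<lambda>x. z x - v x) = 0" if z: "z \<in> Vad L vc" for z
  proof -
    define h where "h x = z x - v x" for x
    have h: "h \<in> L2 ?S" unfolding h_def using z L2(3) by (intro L2_diff) (simp_all add: Vad_def)
    let ?n = "L2_norm ?S h"
    have n: "0 \<le> ?n" by (rule L2_norm_nonneg)
    have small: "\<bar>L2_inner ?S e h\<bar> \<le> 2 * \<epsilon> * ?n" if \<epsilon>: "\<epsilon> > 0" for \<epsilon>
    proof -
      obtain \<delta> where \<delta>: "\<delta> > 0" "\<forall>h\<in>L2 ?S. (\<lambda>x. v x + h x) \<in> Vad L vc \<and> L2_norm ?S h < \<delta> \<longrightarrow>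
          \<bar>\<Phi> (\<lambda>x. v x + h x) - \<Phi> v - L2_inner ?S g h\<bar> \<le> \<epsilon> * L2_norm ?S h"
        using g \<epsilon> unfolding is_L2_gradient_def by blast
      obtain \<delta>' where \<delta>': "\<delta>' > 0" "\<forall>h\<in>L2 ?S. (\<lambda>x. v x + h x) \<in> Vad L vc \<and> L2_norm ?S h < \<delta>' \<longrightarrow>
          \<bar>\<Phi> (\<lambda>x. v x + h x) - \<Phi> v - L2_inner ?S g' h\<bar> \<le> \<epsilon> * L2_norm ?S h"
        using g' \<epsilon> unfolding is_L2_gradient_def by blast
      \<comment> \<open>The scaled increment must stay admissible and be smaller than both radii;
        adding 1 to the norm covers the case of norm 0.\<close>
      define s where "s = min 1 (min \<delta> \<delta>' / (2 * (?n + 1)))"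
      have s: "0 < s" "s \<le> 1" using \<delta>(1) \<delta>'(1) n by (auto simp: s_def)
      have sh: "(\<lambda>x. s * h x) \<in> L2 ?S" by (rule L2_cmult[OF h])
      have Vs: "(\<lambda>x. v x + s * h x) \<in> Vad L vc"
        unfolding h_def using Vad_convex[OF v z, of s] s by simp
      have "s * ?n \<le> min \<delta> \<delta>' / (2 * (?n + 1)) * ?n"
        using n by (intro mult_right_mono) (auto simp: s_def)
      also have "\<dots> = min \<delta> \<delta>' * (?n / (2 * (?n + 1)))" by simp
      also have "\<dots> < min \<delta> \<delta>' * 1"
        using n \<delta>(1) \<delta>'(1) by (intro mult_strict_left_mono) (auto simp: divide_less_eq)
      finally have ns: "L2_norm ?S (\<lambda>x. s * h x) < \<delta>" "L2_norm ?S (\<lambda>x. s * h x) < \<delta>'"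
        using s by (auto simp: L2_norm_cmult)
      have "\<bar>L2_inner ?S g (\<lambda>x. s * h x) - L2_inner ?S g' (\<lambda>x. s * h x)\<bar>
          \<le> \<epsilon> * L2_norm ?S (\<lambda>x. s * h x) + \<epsilon> * L2_norm ?S (\<lambda>x. s * h x)"
        using \<delta>(2)[rule_format, OF sh conjI[OF Vs ns(1)]] \<delta>'(2)[rule_format, OF sh conjI[OF Vs ns(2)]] by linarith
      moreover have "L2_inner ?S g (\<lambda>x. s * h x) - L2_inner ?S g' (\<lambda>x. s * h x) = s * L2_inner ?S e h"
      proof -
        have "L2_inner ?S g (\<lambda>x. s * h x) = s * L2_inner ?S g h" "L2_inner ?S g' (\<lambda>x. s * h x) = s * L2_inner ?S g' h"
          unfolding L2_inner_def by (simp_all add: mult.left_commute)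
        moreover have "L2_inner ?S e h = L2_inner ?S g h - L2_inner ?S g' h"
          unfolding L2_inner_def e_def left_diff_distrib
          by (rule set_integral_diff(2)[OF L2_mult_integrable[OF L2(1) h] L2_mult_integrable[OF L2(2) h]])
        ultimately show ?thesis by (simp add: right_diff_distrib)
      qed
      ultimately have "s * \<bar>L2_inner ?S e h\<bar> \<le> s * (2 * \<epsilon> * ?n)"
        using s by (simp add: L2_norm_cmult abs_mult)
      thus ?thesis using s(1) by simp
    qed
    have "\<bar>L2_inner ?S e h\<bar> \<le> 0"
    proof (rule field_le_epsilon)
      fix r :: real assume r: "r > 0"
      have "\<bar>L2_inner ?S e h\<bar> \<le> 2 * (r / (2 * (?n + 1))) * ?n" by (rule small) (use r n in simp)
      also have "\<dots> = r * (?n / (?n + 1))"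
        using n by (simp add: divide_simps)
      also have "\<dots> \<le> r * 1" using r n by (intro mult_left_mono) auto
      finally show "\<bar>L2_inner ?S e h\<bar> \<le> 0 + r" by simp
    qed
    thus ?thesis unfolding h_def by simp
  qed
  \<comment> \<open>The choice z = 0 shows that \<open>e\<close> is orthogonal to \<open>v\<close>
    itself.\<close>
  have "(\<lambda>x. 0) \<in> Vad L vc"
    using vc L2_const[OF _ emeasure_interval, of 0 L 0] by (simp add: Vad_def)
  from orth[OF this] have ev: "L2_inner ?S e v = 0"
    by (simp add: L2_inner_def set_integral_neg)
  \<comment> \<open>Scaled so that the norm of \<open>c * e\<close> is at most \<open>vc\<close>;
    \<open>vc > 0\<close> makes the multiple nontrivial.\<close>
  define c where "c = vc / (L2_norm ?S e + 1)"
  have n: "0 \<le> L2_norm ?S e" by (rule L2_norm_nonneg)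
  have c: "0 < c" using vc n by (simp add: c_def)
  have "c * L2_norm ?S e = vc * (L2_norm ?S e / (L2_norm ?S e + 1))" by (simp add: c_def)
  also have "\<dots> \<le> vc * 1" using vc n by (intro mult_left_mono) auto
  finally have "(\<lambda>x. c * e x) \<in> Vad L vc"
    using L2_cmult[OF e] c by (simp add: Vad_def L2_norm_cmult)
  from orth[OF this] have "(LINT x:?S|lborel. e x * (c * e x) - e x * v x) = 0"
    by (simp add: L2_inner_def right_diff_distrib)
  hence "c * (LINT x:?S|lborel. e x * e x) = 0"
    using set_integral_diff(2)[OF L2_mult_integrable[OF e L2_cmult[OF e, of c]] L2_mult_integrable[OF e L2(3)]] ev
    by (simp add: L2_inner_def mult.left_commute)
  hence "(L2_norm ?S e)\<^sup>2 = 0" using c unfolding L2_norm_power2 by (simp add: power2_eq_square)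
  hence "AE x\<in>?S in lborel. e x = 0" by (intro L2_norm_eq_zero[OF e]) simp
  thus ?thesis unfolding e_def by (auto elim: eventually_mono)
qed

text \<open>The cost is quadratic and the state depends affinely on the velocity, so the expansion
  is exact, with no term beyond second order. The adjoint state turns the linear term in the state
  increment into an inner product with \<open>h\<close>.\<close>

lemma cost_gradient_identity:
  assumes L: "0 < L" and T: "0 < T" and k: "k \<in> Linf {0<..<L}"
    and y: "y \<in> L2 (Omega L T)" and v: "v \<in> L2 {0<..<L}" and h: "h \<in> L2 {0<..<L}"
    and u: "beam_weak_solution L T k w v F (u v)"
    and uh: "beam_weak_solution L T k w (\<lambda>x. v x + h x) F (u (\<lambda>x. v x + h x))"
    and \<psi>: "adjoint_weak_solution L T k y (u v) \<psi>"
  shows "J L T \<alpha> y u (\<lambda>x. v x + h x) - J L T \<alpha> y u v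
      - L2_inner {0<..<L} (\<lambda>x. - \<psi> (x, 0) + 2 * \<alpha> * v x) h
    = (L2_norm (Omega L T) (\<lambda>p. u (\<lambda>x. v x + h x) p - u v p))\<^sup>2 + \<alpha> * (L2_norm {0<..<L} h)\<^sup>2"
proof -
  define d where "d p = u (\<lambda>x. v x + h x) p - u v p" for p
  have H: "u v \<in> hatH21 L T" "\<psi> \<in> hatH21 L T"
    using u \<psi> by (simp_all add: beam_weak_solution_def adjoint_weak_solution_def)
  note U = H21D(1)[OF hatH21_H21[OF H(1)]]
  have d: "d \<in> hatH21 L T" unfolding d_def[abs_def] by (rule beam_solution_difference(1)[OF L T k L2_add[OF v h] v uh u])
  have dL2: "d \<in> L2 (Omega L T)" by (rule H21D(1)[OF hatH21_H21[OF d]])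
  have r: "(\<lambda>p. u v p - y p) \<in> L2 (Omega L T)" by (rule L2_diff[OF U y])
  have \<psi>0: "(\<lambda>x. \<psi> (x, 0)) \<in> L2 {0<..<L}"
    using hatH21_continuous_slices(2)[OF H(2), of 0] T by (intro L2_continuous_closed) simp
  \<comment> \<open>\<psi> vanishes at \<open>T\<close> and \<open>d\<close> vanishes at 0, so each
    is admissible in the equation of the other. Both tests evaluate the same symmetric form, and
    comparing them gives the identity.\<close>
  have duality: "2 * (LINT p:Omega L T|lborel. d p * (u v p - y p)) = - (LINT x:{0<..<L}|lborel. \<psi> (x, 0) * h x)"
  proof -
    have "beam_form L T k d \<psi> = (LINT x:{0<..<L}|lborel. (v x + h x - v x) * \<psi> (x, 0))"
      unfolding d_def[abs_def]
      by (rule beam_solution_difference(3)[OF L T k L2_add[OF v h] v uh u H(2)])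
        (use \<psi> in \<open>simp add: adjoint_weak_solution_def\<close>)
    moreover have "beam_form L T k \<psi> d = - 2 * (LINT p:Omega L T|lborel. (u v p - y p) * d p)"
    proof -
      have "\<forall>x\<in>{0<..<L}. d (x, 0) = 0"
        unfolding d_def using beam_solution_difference(2)[OF L T k L2_add[OF v h] v uh u] by blast
      thus ?thesis using \<psi> d by (simp add: adjoint_weak_solution_def beam_form_def)
    qed
    ultimately show ?thesis unfolding beam_form_commute[of L T k \<psi> d] by (simp add: mult.commute)
  qed
  have "(L2_norm (Omega L T) (\<lambda>p. u (\<lambda>x. v x + h x) p - y p))\<^sup>2
      = (L2_norm (Omega L T) d)\<^sup>2 + 2 * (LINT p:Omega L T|lborel. d p * (u v p - y p))
        + (L2_norm (Omega L T) (\<lambda>p. u v p - y p))\<^sup>2"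
    using L2_norm_add_power2[OF dL2 r] by (simp add: d_def)
  moreover have "(L2_norm {0<..<L} (\<lambda>x. v x + h x))\<^sup>2
      = (L2_norm {0<..<L} v)\<^sup>2 + 2 * (LINT x:{0<..<L}|lborel. v x * h x) + (L2_norm {0<..<L} h)\<^sup>2"
    by (rule L2_norm_add_power2[OF v h])
  moreover have "L2_inner {0<..<L} (\<lambda>x. - \<psi> (x, 0) + 2 * \<alpha> * v x) h
      = - (LINT x:{0<..<L}|lborel. \<psi> (x, 0) * h x) + 2 * \<alpha> * (LINT x:{0<..<L}|lborel. v x * h x)"
  proof -
    have i: "set_integrable lborel {0<..<L} (\<lambda>x. - \<psi> (x, 0) * h x)"
      "set_integrable lborel {0<..<L} (\<lambda>x. 2 * \<alpha> * (v x * h x))"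
      using L2_mult_integrable[OF L2_minus[OF \<psi>0] h] L2_mult_integrable[OF v h] by simp_all
    have "L2_inner {0<..<L} (\<lambda>x. - \<psi> (x, 0) + 2 * \<alpha> * v x) h
        = (LINT x:{0<..<L}|lborel. - \<psi> (x, 0) * h x + 2 * \<alpha> * (v x * h x))"
      unfolding L2_inner_def by (simp only: distrib_right mult.assoc)
    also have "\<dots> = (LINT x:{0<..<L}|lborel. - (\<psi> (x, 0) * h x)) + 2 * \<alpha> * (LINT x:{0<..<L}|lborel. v x * h x)"
      unfolding set_integral_add(2)[OF i] by simp
    finally show ?thesis by (simp only: set_integral_neg)
  qed
  ultimately show ?thesis
    using duality unfolding J_def L2_norm_power2[symmetric] d_def[abs_def, symmetric]
    by (simp add: distrib_left)
qed

theorem lemma4: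
  fixes L T \<alpha> vc :: real
    and k w :: "real \<Rightarrow> real"
    and F y :: "real \<times> real \<Rightarrow> real"
    and u \<psi> :: "(real \<Rightarrow> real) \<Rightarrow> real \<times> real \<Rightarrow> real"
  assumes "L > 0" and "T > 0" and "\<alpha> > 0"
    and "y \<in> L2 (Omega L T)"
    and "k \<in> Linf {0<..<L}" and "AE x\<in>{0<..<L} in lborel. k x > 0"
    and "w \<in> H2 {0<..<L}" and "F \<in> L2 (Omega L T)"
    and "\<And>v. v \<in> Vad L vc \<Longrightarrow> beam_weak_solution L T k w v F (u v)"
    and "\<And>v. v \<in> Vad L vc \<Longrightarrow> adjoint_weak_solution L T k y (u v) (\<psi> v)"
  shows "(\<forall>v\<in>Vad L vc. \<forall>\<delta>v. (\<lambda>x. v x + \<delta>v x) \<in> Vad L vc \<longrightarrow>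
            (L2_norm {0<..<L}
               (\<lambda>x. J' L T \<alpha> y u vc (\<lambda>x. v x + \<delta>v x) x - J' L T \<alpha> y u vc v x))\<^sup>2
            = (LINT x:{0<..<L}|lborel.
                 (- (\<psi> (\<lambda>x. v x + \<delta>v x) (x, 0) - \<psi> v (x, 0)) + 2 * \<alpha> * \<delta>v x)\<^sup>2)) \<and>
         (\<exists>\<L>\<ge>0. \<forall>v\<in>Vad L vc. \<forall>\<delta>v. (\<lambda>x. v x + \<delta>v x) \<in> Vad L vc \<longrightarrow>
            L2_norm {0<..<L}
              (\<lambda>x. J' L T \<alpha> y u vc (\<lambda>x. v x + \<delta>v x) x - J' L T \<alpha> y u vc v x)
            \<le> \<L> * L2_norm {0<..<L} \<delta>v)"
proof -
  let ?S = "{0<..<L}" and ?V = "Vad L vc" and ?G = "J' L T \<alpha> y u vc"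
  \<comment> \<open>The Lipschitz constant of the map from velocity to state.\<close>
  define C where "C = 2 * (T + 1)\<^sup>2"
  have C: "0 \<le> C" by (simp add: C_def)
  \<comment> \<open>\<open>g\<close> is the explicit gradient built from the adjoint state, whereas
    \<open>?G\<close> is the selected one. The claims are established for \<open>g\<close> and
    transferred to \<open>?G\<close> by \<open>key\<close>.\<close>
  define g where "g v x = - \<psi> v (x, 0) + 2 * \<alpha> * v x" for v x
  have VL2: "v \<in> L2 ?S" if "v \<in> ?V" for v using that by (simp add: Vad_def)
  have \<psi>0: "(\<lambda>x. \<psi> v (x, 0)) \<in> L2 ?S" if "v \<in> ?V" for v
    using hatH21_continuous_slices(2)[of "\<psi> v" L T 0] assms(10)[OF that] \<open>T > 0\<close>
    by (intro L2_continuous_closed) (simp add: adjoint_weak_solution_def)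
  have uL2: "u v \<in> L2 (Omega L T)" if "v \<in> ?V" for v
    using assms(9)[OF that] by (intro H21D(1) hatH21_H21) (simp add: beam_weak_solution_def)
  have gL2: "g v \<in> L2 ?S" if "v \<in> ?V" for v
    unfolding g_def using L2_add[OF L2_minus[OF \<psi>0[OF that]] L2_cmult[OF VL2[OF that], of "2 * \<alpha>"]] .
  have incr: "h \<in> L2 ?S" if "v \<in> ?V" "(\<lambda>x. v x + h x) \<in> ?V" for v h
    using L2_diff[OF VL2[OF that(2)] VL2[OF that(1)]] by simp
  have du: "L2_norm (Omega L T) (\<lambda>p. u (\<lambda>x. v x + h x) p - u v p) \<le> C * L2_norm ?S h"
    if "v \<in> ?V" "(\<lambda>x. v x + h x) \<in> ?V" for v h
    using beam_solution_Lipschitz[OF assms(1,2,5,6) VL2[OF that(2)] VL2[OF that(1)] assms(9)[OF that(2)] assms(9)[OF that(1)]]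
    by (simp add: C_def)
  have remainder: "\<bar>J L T \<alpha> y u (\<lambda>x. v x + h x) - J L T \<alpha> y u v - L2_inner ?S (g v) h\<bar>
      \<le> (C\<^sup>2 + \<alpha>) * (L2_norm ?S h)\<^sup>2" if vh: "v \<in> ?V" "(\<lambda>x. v x + h x) \<in> ?V" for v h
  proof -
    let ?A = "(L2_norm (Omega L T) (\<lambda>p. u (\<lambda>x. v x + h x) p - u v p))\<^sup>2" and ?B = "(L2_norm ?S h)\<^sup>2"
    have "?A \<le> C\<^sup>2 * ?B"
      unfolding power_mult_distrib[symmetric] by (rule power_mono[OF du[OF vh] L2_norm_nonneg])
    hence "?A + \<alpha> * ?B \<le> (C\<^sup>2 + \<alpha>) * ?B" unfolding distrib_right by (rule add_right_mono)
    moreover have "\<bar>?A + \<alpha> * ?B\<bar> = ?A + \<alpha> * ?B"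
      by (rule abs_of_nonneg) (use \<open>\<alpha> > 0\<close> in \<open>intro add_nonneg_nonneg mult_nonneg_nonneg; simp\<close>)
    moreover have "J L T \<alpha> y u (\<lambda>x. v x + h x) - J L T \<alpha> y u v - L2_inner ?S (g v) h
      = (L2_norm (Omega L T) (\<lambda>p. u (\<lambda>x. v x + h x) p - u v p))\<^sup>2 + \<alpha> * (L2_norm ?S h)\<^sup>2"
      unfolding g_def[abs_def]
      by (rule cost_gradient_identity[where u=u and v=v and h=h and \<psi>="\<psi> v",
          OF assms(1,2,5,4) VL2[OF vh(1)] incr[OF vh] assms(9)[OF vh(1)] assms(9)[OF vh(2)] assms(10)[OF vh(1)]])
    ultimately show ?thesis by (simp only:)
  qed
  have gradient: "is_L2_gradient ?S ?V (J L T \<alpha> y u) v (g v)" if v: "v \<in> ?V" for v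
    unfolding is_L2_gradient_def
  proof (intro conjI allI impI gL2[OF v])
    fix \<epsilon> :: real assume \<epsilon>: "\<epsilon> > 0"
    have P: "0 < C\<^sup>2 + \<alpha>" using \<open>\<alpha> > 0\<close> by (simp add: add_nonneg_pos)
    have "\<bar>J L T \<alpha> y u (\<lambda>x. v x + h x) - J L T \<alpha> y u v - L2_inner ?S (g v) h\<bar> \<le> \<epsilon> * L2_norm ?S h"
      if h: "(\<lambda>x. v x + h x) \<in> ?V" "L2_norm ?S h < \<epsilon> / (C\<^sup>2 + \<alpha>)" for h
    proof -
      have "(C\<^sup>2 + \<alpha>) * L2_norm ?S h \<le> \<epsilon>"
        using h(2) unfolding pos_less_divide_eq[OF P] by (simp add: mult.commute)
      hence "((C\<^sup>2 + \<alpha>) * L2_norm ?S h) * L2_norm ?S h \<le> \<epsilon> * L2_norm ?S h"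
        by (rule mult_right_mono[OF _ L2_norm_nonneg])
      thus ?thesis using remainder[OF v h(1)] by (simp add: power2_eq_square mult.assoc)
    qed
    \<comment> \<open>With this radius the quadratic remainder is at most \<epsilon> times the norm
      of the increment.\<close>
    moreover have "\<epsilon> / (C\<^sup>2 + \<alpha>) > 0" using \<epsilon> P by simp
    ultimately show "\<exists>\<delta>>0. \<forall>h\<in>L2 ?S. (\<lambda>x. v x + h x) \<in> ?V \<and> L2_norm ?S h < \<delta> \<longrightarrow>
        \<bar>J L T \<alpha> y u (\<lambda>x. v x + h x) - J L T \<alpha> y u v - L2_inner ?S (g v) h\<bar> \<le> \<epsilon> * L2_norm ?S h"
      by blast
  qed
  have Gprop: "is_L2_gradient ?S ?V (J L T \<alpha> y u) v (?G v)" if "v \<in> ?V" for v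
    unfolding L2_gradient_def using gradient[OF that] by (rule someI[where P="is_L2_gradient ?S ?V (J L T \<alpha> y u) v"])
  have GL2: "?G v \<in> L2 ?S" if "v \<in> ?V" for v using Gprop[OF that] by (simp add: is_L2_gradient_def)
  have dg: "L2_norm ?S (\<lambda>x. g (\<lambda>x. v x + h x) x - g v x) \<le> (2 * C\<^sup>2 + 2 * \<alpha>) * L2_norm ?S h"
    if vh: "v \<in> ?V" "(\<lambda>x. v x + h x) \<in> ?V" for v h
  proof -
    have "L2_norm ?S (\<lambda>x. \<psi> (\<lambda>x. v x + h x) (x, 0) - \<psi> v (x, 0))
        \<le> 4 * (T + 1)\<^sup>2 * L2_norm (Omega L T) (\<lambda>p. u (\<lambda>x. v x + h x) p - u v p)"
      by (rule adjoint_solution_Lipschitz[OF assms(2,5,6,4) uL2[OF vh(2)] uL2[OF vh(1)] assms(10)[OF vh(2)] assms(10)[OF vh(1)]])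
    also have "\<dots> \<le> (2 * C) * (C * L2_norm ?S h)"
      \<comment> \<open>The adjoint constant is twice \<open>C\<close>, and the state contributes a
        further factor \<open>C\<close>.\<close>
      using mult_left_mono[OF du[OF vh], of "2 * C"] C by (simp add: C_def)
    finally have d\<psi>: "L2_norm ?S (\<lambda>x. \<psi> (\<lambda>x. v x + h x) (x, 0) - \<psi> v (x, 0)) \<le> 2 * C\<^sup>2 * L2_norm ?S h"
      by (simp add: power2_eq_square mult.assoc)
    have "(\<lambda>x. g (\<lambda>x. v x + h x) x - g v x)
        = (\<lambda>x. (- 1) * (\<psi> (\<lambda>x. v x + h x) (x, 0) - \<psi> v (x, 0)) + 2 * \<alpha> * h x)"
      by (simp add: g_def fun_eq_iff algebra_simps)
    hence "L2_norm ?S (\<lambda>x. g (\<lambda>x. v x + h x) x - g v x)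
        \<le> L2_norm ?S (\<lambda>x. (- 1) * (\<psi> (\<lambda>x. v x + h x) (x, 0) - \<psi> v (x, 0))) + L2_norm ?S (\<lambda>x. 2 * \<alpha> * h x)"
      using L2_norm_triangle[OF L2_cmult[OF L2_diff[OF \<psi>0[OF vh(2)] \<psi>0[OF vh(1)]], of "- 1"] L2_cmult[OF incr[OF vh], of "2 * \<alpha>"]]
      by (simp only:)
    also have "\<dots> \<le> 2 * C\<^sup>2 * L2_norm ?S h + 2 * \<alpha> * L2_norm ?S h"
      unfolding L2_norm_cmult using d\<psi> \<open>\<alpha> > 0\<close> by simp
    finally show ?thesis by (simp only: distrib_right)
  qed
  text \<open>If \<open>vc = 0\<close> then every square integrable function is a gradient at every admissible point, so
    that the gradient is not determined by its defining property. The choice operator in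
    \<^const>\<open>L2_gradient\<close> nevertheless selects the same function at all admissible points.\<close>
  have key: "L2_norm ?S (\<lambda>x. ?G (\<lambda>x. v x + h x) x - ?G v x) = L2_norm ?S (\<lambda>x. g (\<lambda>x. v x + h x) x - g v x)"
    if vh: "v \<in> ?V" "(\<lambda>x. v x + h x) \<in> ?V" for v h
  proof (cases "0 < vc")
    case True
    have "AE x\<in>?S in lborel. ?G v' x = g v' x" if "v' \<in> ?V" for v'
      by (rule is_L2_gradient_unique[OF that True Gprop[OF that] gradient[OF that]])
    from this[OF vh(1)] this[OF vh(2)]
    have "AE x\<in>?S in lborel. ?G (\<lambda>x. v x + h x) x - ?G v x = g (\<lambda>x. v x + h x) x - g v x"
      by eventually_elim auto
    thus ?thesis by (rule L2_norm_cong_AE[OF L2_diff[OF GL2[OF vh(2)] GL2[OF vh(1)]] L2_diff[OF gL2[OF vh(2)] gL2[OF vh(1)]]])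
  next
    case False
    \<comment> \<open>This case also covers negative \<open>vc\<close>, where no \<open>v'\<close>
      is admissible and the claims are vacuous.\<close>
    have norm0: "L2_norm ?S v' = 0" if "v' \<in> ?V" for v'
      using that False L2_norm_nonneg[of ?S v'] by (simp add: Vad_def)
    have h0: "L2_norm ?S h' = 0" if "v' \<in> ?V" "(\<lambda>x. v' x + h' x) \<in> ?V" for v' h'
    proof -
      have "L2_norm ?S (\<lambda>x. (v' x + h' x) + (- 1) * v' x) \<le> L2_norm ?S (\<lambda>x. v' x + h' x) + L2_norm ?S (\<lambda>x. (- 1) * v' x)"
        by (rule L2_norm_triangle[OF VL2[OF that(2)] L2_cmult[OF VL2[OF that(1)]]])
      also have "\<dots> = 0" unfolding L2_norm_cmult norm0[OF that(1)] norm0[OF that(2)] by simp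
      finally show ?thesis using L2_norm_nonneg[of ?S h'] by simp
    qed
    have inner0: "L2_inner ?S f h' = 0" if "v' \<in> ?V" "(\<lambda>x. v' x + h' x) \<in> ?V" "f \<in> L2 ?S" for f v' h'
      using Cauchy_Schwarz_L2[OF that(3) incr[OF that(1,2)]] h0[OF that(1,2)] by (simp add: L2_inner_def)
    have J0: "J L T \<alpha> y u (\<lambda>x. v' x + h' x) - J L T \<alpha> y u v' = 0" if "v' \<in> ?V" "(\<lambda>x. v' x + h' x) \<in> ?V" for v' h'
      using remainder[OF that] h0[OF that] inner0[OF that gL2[OF that(1)]] by simp
    have all: "is_L2_gradient ?S ?V (J L T \<alpha> y u) v' = (\<lambda>f. f \<in> L2 ?S)" if "v' \<in> ?V" for v'
    proof (intro ext iffI)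
      fix f assume f: "f \<in> L2 ?S"
      have "\<bar>J L T \<alpha> y u (\<lambda>x. v' x + h' x) - J L T \<alpha> y u v' - L2_inner ?S f h'\<bar> \<le> \<epsilon> * L2_norm ?S h'"
        if "(\<lambda>x. v' x + h' x) \<in> ?V" for h' \<epsilon>
        using J0[OF \<open>v' \<in> ?V\<close> that] inner0[OF \<open>v' \<in> ?V\<close> that f] h0[OF \<open>v' \<in> ?V\<close> that] by simp
      thus "is_L2_gradient ?S ?V (J L T \<alpha> y u) v' f"
        using f unfolding is_L2_gradient_def by (blast intro: zero_less_one)
    qed (simp add: is_L2_gradient_def)
    \<comment> \<open>The two predicates of being a gradient are equal as functions, so the choice
      operator receives the same argument at both points and returns the same value.\<close>
    have "?G (\<lambda>x. v x + h x) = ?G v" unfolding L2_gradient_def all[OF vh(1)] all[OF vh(2)] ..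
    moreover have "L2_norm ?S (\<lambda>x. g (\<lambda>x. v x + h x) x - g v x) = 0"
      using dg[OF vh] h0[OF vh] L2_norm_nonneg[of ?S "\<lambda>x. g (\<lambda>x. v x + h x) x - g v x"] by simp
    ultimately show ?thesis by simp
  qed
  show ?thesis
  \<comment> \<open>The witness is the constant from \<open>dg\<close>: the first summand comes from
    the trace of the adjoint state, the second from the regularising term.\<close>
  proof (intro conjI ballI allI impI exI[of _ "2 * C\<^sup>2 + 2 * \<alpha>"])
    fix v \<delta>v assume vh: "v \<in> ?V" "(\<lambda>x. v x + \<delta>v x) \<in> ?V"
    have "g (\<lambda>x. v x + \<delta>v x) x - g v x = - (\<psi> (\<lambda>x. v x + \<delta>v x) (x, 0) - \<psi> v (x, 0)) + 2 * \<alpha> * \<delta>v x" for x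
      by (simp add: g_def algebra_simps)
    thus "(L2_norm ?S (\<lambda>x. ?G (\<lambda>x. v x + \<delta>v x) x - ?G v x))\<^sup>2
        = (LINT x:?S|lborel. (- (\<psi> (\<lambda>x. v x + \<delta>v x) (x, 0) - \<psi> v (x, 0)) + 2 * \<alpha> * \<delta>v x)\<^sup>2)"
      unfolding key[OF vh] L2_norm_power2 by simp
    show "L2_norm ?S (\<lambda>x. ?G (\<lambda>x. v x + \<delta>v x) x - ?G v x) \<le> (2 * C\<^sup>2 + 2 * \<alpha>) * L2_norm ?S \<delta>v"
      unfolding key[OF vh] by (rule dg[OF vh])
  next
    show "0 \<le> 2 * C\<^sup>2 + 2 * \<alpha>" using \<open>\<alpha> > 0\<close> by simp
  qed
qed

end
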